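(* Let $d\geq3$ be an integer, let $\mathcal{F}_0^{d-1}$ be the Fermat foliation of degree $d-1$ on $\mathbb{P}^2_{\mathbb{C}}$, and let $\ell$ be a line of $\mathbb{P}^2_{\mathbb{C}}$. Assume that $\ell$ is not invariant by $\mathcal{F}_0^{d-1}$ and that the $d$-web $\mathrm{Leg}(\ell\boxtimes\mathcal{F}_0^{d-1})$ is flat. Then $d\in\{3,4\}$ and the line $\ell$ joins two (resp. three) singularities, necessarily non-radial, of $\mathcal{F}_0^{d-1}$ if $d=3$ (resp. if $d=4$).
   Context: The Fermat foliation $\mathcal F_0^{d-1}$ is defined in the affine chart $(x,y)$ by $x\,dy-y\,dx+y^{d-1}dx-x^{d-1}dy$, i.e. in homogeneous coordinates by $x^{d-1}(y\,dz-z\,dy)+y^{d-1}(z\,dx-x\,dz)+z^{d-1}(x\,dy-y\,dx)$. Its singularities are the zeros in $\mathbb{P}^2_{\mathbb{C}}$ of this 1-form. A singularity $s$ of a foliation, locally defined by a vector field $X$, is radial if the linear part of $X$ at $s$ is a nonzero multiple of the radial field $u\partial_u+v\partial_v$ ($(u,v)$ local coordinates centered at $s$). Pre-foliations. A pre-foliation of co-degree $1$ and degree $d$ on $\mathbb{P}^2_{\mathbb{C}}$ is a pair, written $\ell\boxtimes\mathcal{F}$, of a line $\ell$ and a holomorphic foliation $\mathcal{F}$ of degree $d-1$. Legendre transform. If $\ell\boxtimes\mathcal F$ is given in an affine chart by $f(x,y)(A\,dx+B\,dy)$ ($f=0$ being an equation of $\ell$), then in the affine chart $(p,q)$ of $\check{\mathbb{P}}^2_{\mathbb{C}}$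 associated to the line $\{y=px-q\}$, $\mathrm{Leg}(\ell\boxtimes\mathcal F)$ is the $d$-web given by $f(x,px-q)\big(A(x,px-q)+pB(x,px-q)\big)=0$ with $x=dq/dp$. Equivalently $\mathrm{Leg}(\ell\boxtimes\mathcal F)=\mathrm{Leg}\,\ell\boxtimes\mathrm{Leg}\,\mathcal F$, where $\mathrm{Leg}\,\ell$ is the pencil of lines through the point $\check\ell$ dual to $\ell$, and the tangents of $\mathrm{Leg}\,\mathcal F$ at a generic $L\in\check{\mathbb{P}}^2_{\mathbb{C}}$ are the lines dual to the tangency points of $L$ with $\mathcal F$. Curvature. At a generic point a $d$-web is a superposition $\mathcal F_1\boxtimes\cdots\boxtimes\mathcal F_d$ of $d$ pairwise transverse foliations, $\mathcal F_i:\omega_i=0$. Put $\omega_i\wedge\omega_j=\delta_{ij}\,dx\wedge dy$. For $r<s<t$ let $\eta_{rst}$ be the unique meromorphic 1-form with $d(\delta_{st}\omega_r)=\eta_{rst}\wedge\delta_{st}\omega_r$, $d(\delta_{tr}\omega_s)=\eta_{rst}\wedge\delta_{tr}\omega_s$, $d(\delta_{rs}\omega_t)=\eta_{rst}\wedge\delta_{rs}\omega_t$. The curvature $K(\mathcal W)=d\big(\sum_{r<s<t}\eta_{rst}\big)$ is a well-defined global meromorphic 2-form; $\mathcal W$ is flat if $K(\mathcal W)\equiv0$. *)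

theory Defs
  imports "HOL-Analysis.Analysis"
begin

text \<open>
  Points of the complex projective plane are given by homogeneous coordinates
  \<open>v :: complex^3\<close>, \<open>v \<noteq> 0\<close>. A line is given by the coefficients \<open>l \<noteq> 0\<close> of an equation
  \<open>l $ 1 * x + l $ 2 * y + l $ 3 * z = 0\<close>. The affine chart \<open>(x, y)\<close> is \<open>z = 1\<close>.
\<close>

text \<open>The complex bilinear pairing; the library's \<open>inner\<close> on \<open>complex^3\<close> is only real bilinear.\<close>

definition pairing :: "complex^3 \<Rightarrow> complex^3 \<Rightarrow> complex" where
  "pairing a v = (\<Sum>i\<in>UNIV. a $ i * v $ i)"

definition on_line :: "complex^3 \<Rightarrow> complex^3 \<Rightarrow> bool" where
  "on_line l v \<longleftrightarrow> pairing l v = 0"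

definition proj_point :: "complex^3 \<Rightarrow> (complex^3) set" where
  "proj_point v = {c *s v | c. c \<noteq> 0}"

section \<open>Foliations of the projective plane\<close>

text \<open>
  A foliation is given by a homogeneous 1-form \<open>a dx + b dy + c dz\<close> on \<open>complex^3\<close>,
  encoded as the map sending a point to the covector \<open>(a, b, c)\<close>.
\<close>

type_synonym hform = "complex^3 \<Rightarrow> complex^3"

text \<open>
  The Fermat foliation of degree \<open>n\<close>: the coefficients of \<open>dx\<close>, \<open>dy\<close>, \<open>dz\<close> in
  \<open>x^n (y dz - z dy) + y^n (z dx - x dz) + z^n (x dy - y dx)\<close>.
\<close>

definition fermat_form :: "nat \<Rightarrow> hform" where
  "fermat_form n v =
     (let x = v $ 1; y = v $ 2; z = v $ 3
      in vector [y ^ n * z - z ^ n * y, z ^ n * x - x ^ n * z, x ^ n * y - y ^ n * x])"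

definition singular :: "hform \<Rightarrow> complex^3 \<Rightarrow> bool" where
  "singular \<Omega> s \<longleftrightarrow> s \<noteq> 0 \<and> \<Omega> s = 0"

text \<open>
  For a basis \<open>s, e, f\<close>, the map \<open>(u, v) \<mapsto> s + u e + v f\<close> is an affine chart centered at \<open>s\<close>.
  There \<open>\<Omega>\<close> pulls back to \<open>A du + B dv\<close> with \<open>A = \<Omega>(e)\<close>, \<open>B = \<Omega>(f)\<close>, and the foliation is
  defined by the vector field \<open>B \<partial>\<^sub>u - A \<partial>\<^sub>v\<close>.
\<close>

definition local_field ::
    "hform \<Rightarrow> complex^3 \<Rightarrow> complex^3 \<Rightarrow> complex^3 \<Rightarrow> complex \<times> complex \<Rightarrow> complex \<times> complex" where
  "local_field \<Omega> s e f = (\<lambda>(u, v).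
     let m = s + u *s e + v *s f in (pairing (\<Omega> m) f, - pairing (\<Omega> m) e))"

text \<open>
  That the linear part is a nonzero multiple of the radial field does not depend on the local
  coordinates (nor on the defining vector field), so one affine chart centered at \<open>s\<close> suffices.
\<close>

definition radial :: "hform \<Rightarrow> complex^3 \<Rightarrow> bool" where
  "radial \<Omega> s \<longleftrightarrow> singular \<Omega> s \<and>
     (\<exists>e f c. det (vector [s, e, f] :: complex^3^3) \<noteq> 0 \<and> c \<noteq> 0 \<and>
        (local_field \<Omega> s e f has_derivative (\<lambda>(u, v). (c * u, c * v))) (at (0, 0)))"

text \<open>A line is invariant if it is everywhere tangent to the foliation: \<open>\<Omega>\<close> pulls back to 0 on it.\<close>

definition invariant_line :: "hform \<Rightarrow> complex^3 \<Rightarrow> bool" where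
  "invariant_line \<Omega> l \<longleftrightarrow> (\<forall>m v. on_line l m \<and> on_line l v \<longrightarrow> pairing (\<Omega> m) v = 0)"

section \<open>Webs on the dual plane\<close>

text \<open>
  A \<open>d\<close>-web in the chart \<open>(p, q)\<close> is given by an implicit differential equation
  \<open>F (p, q) (dq/dp) = 0\<close>, with \<open>F (p, q)\<close> polynomial of degree at most \<open>d\<close>.
  It stands for the binary form \<open>dp ^ d * F (p, q) (dq/dp)\<close> of degree \<open>d\<close>: when the degree
  of \<open>F (p, q)\<close> drops, the missing directions are \<open>dp = 0\<close>.
\<close>

type_synonym implicit_web = "complex \<times> complex \<Rightarrow> complex \<Rightarrow> complex"

text \<open>
  The Legendre transform of the pre-foliation consisting of the line \<open>l\<close> and the foliation \<open>\<Omega>\<close>: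
  on \<open>z = 1\<close> it is defined by \<open>f (A dx + B dy)\<close>, where \<open>f = l $ 1 * x + l $ 2 * y + l $ 3\<close> and
  \<open>A\<close>, \<open>B\<close> are the first two components of \<open>\<Omega>\<close>. On a line \<open>y = p x - q\<close> the degree of
  \<open>A + p B\<close> in \<open>x\<close> is at most that of the foliation, since \<open>\<Omega>\<close> vanishes on the Euler field. If \<open>l\<close> is the line at infinity, \<open>f\<close> is a nonzero
  constant, and by the above convention its contribution to the web is the pencil \<open>dp = 0\<close>.
\<close>

definition legendre :: "complex^3 \<Rightarrow> hform \<Rightarrow> implicit_web" where
  "legendre l \<Omega> = (\<lambda>(p, q) x.
     let m = vector [x, p * x - q, 1]
     in pairing l m * (\<Omega> m $ 1 + p * (\<Omega> m $ 2)))"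

section \<open>Curvature\<close>

text \<open>A 1-form \<open>a dp + b dq\<close> is encoded by \<open>(a, b)\<close>, a 2-form by its coefficient of \<open>dp \<and> dq\<close>.\<close>

type_synonym form1 = "complex \<times> complex \<Rightarrow> complex \<times> complex"

definition wedge :: "complex \<times> complex \<Rightarrow> complex \<times> complex \<Rightarrow> complex" where
  "wedge v w = fst v * snd w - snd v * fst w"

definition ext_deriv :: "form1 \<Rightarrow> complex \<times> complex \<Rightarrow> complex" where
  "ext_deriv \<omega> = (\<lambda>(p, q). deriv (\<lambda>t. snd (\<omega> (t, q))) p - deriv (\<lambda>t. fst (\<omega> (p, t))) q)"

definition holomorphic2_on :: "(complex \<times> complex \<Rightarrow> complex) \<Rightarrow> (complex \<times> complex) set \<Rightarrow> bool" where
  "holomorphic2_on g U \<longleftrightarrow>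
     (\<forall>z\<in>U. \<exists>a b. (g has_derivative (\<lambda>(h, k). a * h + b * k)) (at z))"

text \<open>On \<open>U\<close>, the web is the superposition of the pairwise transverse foliations \<open>\<omega> i = 0\<close>, \<open>i < d\<close>.\<close>

definition local_decomposition ::
    "nat \<Rightarrow> implicit_web \<Rightarrow> (complex \<times> complex) set \<Rightarrow> (nat \<Rightarrow> form1) \<Rightarrow> bool" where
  "local_decomposition d F U \<omega> \<longleftrightarrow> open U \<and>
     (\<forall>i<d. holomorphic2_on (\<lambda>z. fst (\<omega> i z)) U \<and> holomorphic2_on (\<lambda>z. snd (\<omega> i z)) U) \<and>
     (\<forall>z\<in>U. \<forall>i<d. \<forall>j<d. i \<noteq> j \<longrightarrow> wedge (\<omega> i z) (\<omega> j z) \<noteq> 0) \<and>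
     (\<forall>z\<in>U. \<exists>c. c \<noteq> 0 \<and> (\<forall>x. F z x = c * (\<Prod>i<d. fst (\<omega> i z) + snd (\<omega> i z) * x)))"

text \<open>\<open>\<delta>\<^sub>j\<^sub>k \<omega>\<^sub>i\<close>\<close>

definition weighted_form :: "(nat \<Rightarrow> form1) \<Rightarrow> nat \<Rightarrow> nat \<Rightarrow> nat \<Rightarrow> form1" where
  "weighted_form \<omega> i j k z =
     (wedge (\<omega> j z) (\<omega> k z) * fst (\<omega> i z), wedge (\<omega> j z) (\<omega> k z) * snd (\<omega> i z))"

text \<open>
  The equations defining \<open>\<eta>\<^sub>r\<^sub>s\<^sub>t\<close> are linear algebraic in \<open>\<eta>\<^sub>r\<^sub>s\<^sub>t\<close>; where \<open>\<omega> r\<close>, \<open>\<omega> s\<close>, \<open>\<omega> t\<close> are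
  holomorphic and pairwise transverse, they have a unique solution at each point.
\<close>

definition eta :: "(nat \<Rightarrow> form1) \<Rightarrow> nat \<Rightarrow> nat \<Rightarrow> nat \<Rightarrow> form1" where
  "eta \<omega> r s t z = (THE e.
     ext_deriv (weighted_form \<omega> r s t) z = wedge e (weighted_form \<omega> r s t z) \<and>
     ext_deriv (weighted_form \<omega> s t r) z = wedge e (weighted_form \<omega> s t r z) \<and>
     ext_deriv (weighted_form \<omega> t r s) z = wedge e (weighted_form \<omega> t r s z))"

definition curvature :: "nat \<Rightarrow> (nat \<Rightarrow> form1) \<Rightarrow> complex \<times> complex \<Rightarrow> complex" where
  "curvature d \<omega> =
     ext_deriv (\<lambda>z. \<Sum>(r, s, t) \<in> {(r, s, t). r < s \<and> s < t \<and> t < d}. eta \<omega> r s t z)"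

text \<open>
  The curvature is a global meromorphic 2-form, so it vanishes identically iff it vanishes
  at the generic points, where the web decomposes. If the discriminant of \<open>F\<close> vanishes
  identically, \<open>F\<close> is not a \<open>d\<close>-web, there are no decompositions, and the condition is void.
\<close>

definition flat_web :: "nat \<Rightarrow> implicit_web \<Rightarrow> bool" where
  "flat_web d F \<longleftrightarrow>
     (\<forall>U \<omega>. local_decomposition d F U \<omega> \<longrightarrow> (\<forall>z\<in>U. curvature d \<omega> z = 0))"

end

theory Submission
  imports Defs "HOL-Complex_Analysis.Cauchy_Integral_Formula"
    "HOL-Computational_Algebra.Fundamental_Theorem_Algebra"
begin

text \<open>
  Let \<open>n = d - 1\<close>. In the dual chart the web of the foliation is given by the roots
  \<open>x\<^sub>1, \<dots>, x\<^sub>n\<close> of \<open>(p x - q)^n - p x^n + q\<close>, and the line contributes one more slope \<open>x\<^sub>0\<close>.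
  Along the curve of tangents to the foliation at points of the line, \<open>x\<^sub>0\<close> meets one root, say
  \<open>x\<^sub>1\<close>, and the curvature acquires a double pole, whose leading coefficient must vanish. The
  discriminant of the web consists of the pencils through the radial singularities, so at a general
  point of the line everything else is holomorphic and the coefficient is explicit: it is a
  polynomial condition on the points \<open>(x, y)\<close> of the line. Restricting this condition to
  neighbourhoods of the intersections of the line with the coordinate axes gives \<open>n \<le> 3\<close> and
  determines the line. The general point argument breaks down only for lines whose tangents to the
  foliation all pass through one singularity, and these are found in the same way.
\<close>

section \<open>Holomorphic functions of two variables\<close>

text \<open>The tangent to the foliation at a point of the line meets the line in that same point;
  this is why \<open>x\<^sub>0\<close> coincides with a root along a whole curve. The vanishing
  coefficient has a geometric meaning: in the affine coordinate \<open>1 / (x - x\<^sub>0)\<close>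
  on the directions at a point of the curve, the tangent of the curve is the barycenter of
  \<open>x\<^sub>2, \<dots>, x\<^sub>n\<close>. The sum of the
  \<open>1 / (x\<^sub>t - x\<^sub>1)\<close> over the unknown roots is a logarithmic derivative,
  hence expressed by two derivatives of the tangency polynomial at the known root. The axes are
  useful because near \<open>y = 0\<close> the power \<open>y^(n - 1)\<close> is negligible to order
  \<open>n - 1\<close>: the low Taylor coefficients of the condition are binomial, with essentially
  one unknown, \<open>(- c / a)^(n - 1)\<close>. They give \<open>n \<le> 4\<close>, and
  \<open>n = 4\<close> falls because the quotients for the three axes multiply to \<open>-1\<close>.
  The exceptional lines really occur: along \<open>x + y = 1\<close> all tangents have slope 1 if
  \<open>n = 2\<close>, and all pass through \<open>(-1, -1)\<close> if \<open>n = 3\<close>. They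
  satisfy the conclusion, so it is enough to identify them.\<close>

lemma holomorphic2_onI:
  assumes "\<And>z. z \<in> U \<Longrightarrow> (g has_derivative (\<lambda>(h, k). a z * h + b z * k)) (at z)"
  shows "holomorphic2_on g U"
  using assms unfolding holomorphic2_on_def by blast

lemma holomorphic2_onE:
  assumes "holomorphic2_on g U" "z \<in> U"
  obtains a b where "(g has_derivative (\<lambda>(h, k). a * h + b * k)) (at z)"
  using assms unfolding holomorphic2_on_def by blast

lemma holomorphic2_on_const: "holomorphic2_on (\<lambda>_. c) U"
  by (rule holomorphic2_onI[of _ _ "\<lambda>_. 0" "\<lambda>_. 0"]) (simp add: case_prod_beta')

lemma holomorphic2_on_fst: "holomorphic2_on fst U"
  by (rule holomorphic2_onI[of _ _ "\<lambda>_. 1" "\<lambda>_. 0"])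
     (simp add: case_prod_beta' has_derivative_fst)

lemma holomorphic2_on_snd: "holomorphic2_on snd U"
  by (rule holomorphic2_onI[of _ _ "\<lambda>_. 0" "\<lambda>_. 1"])
     (simp add: case_prod_beta' has_derivative_snd)

lemma holomorphic2_on_add:
  assumes "holomorphic2_on f U" "holomorphic2_on g U"
  shows "holomorphic2_on (\<lambda>z. f z + g z) U"
  unfolding holomorphic2_on_def
proof
  fix z assume z: "z \<in> U"
  obtain a b where f: "(f has_derivative (\<lambda>(h, k). a * h + b * k)) (at z)"
    using holomorphic2_onE[OF assms(1) z] .
  obtain a' b' where g: "(g has_derivative (\<lambda>(h, k). a' * h + b' * k)) (at z)"
    using holomorphic2_onE[OF assms(2) z] .
  have "((\<lambda>z. f z + g z) has_derivative (\<lambda>(h, k). (a + a') * h + (b + b') * k)) (at z)"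
    by (rule has_derivative_eq_rhs[OF has_derivative_add[OF f g]]) (auto simp: algebra_simps)
  then show "\<exists>a b. ((\<lambda>z. f z + g z) has_derivative (\<lambda>(h, k). a * h + b * k)) (at z)"
    by blast
qed

lemma holomorphic2_on_mult:
  assumes "holomorphic2_on f U" "holomorphic2_on g U"
  shows "holomorphic2_on (\<lambda>z. f z * g z) U"
  unfolding holomorphic2_on_def
proof
  fix z assume z: "z \<in> U"
  obtain a b where f: "(f has_derivative (\<lambda>(h, k). a * h + b * k)) (at z)"
    using holomorphic2_onE[OF assms(1) z] .
  obtain a' b' where g: "(g has_derivative (\<lambda>(h, k). a' * h + b' * k)) (at z)"
    using holomorphic2_onE[OF assms(2) z] .
  have "((\<lambda>z. f z * g z) has_derivative
      (\<lambda>(h, k). (a * g z + f z * a') * h + (b * g z + f z * b') * k)) (at z)"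
    by (rule has_derivative_eq_rhs[OF has_derivative_mult[OF f g]]) (auto simp: algebra_simps)
  then show "\<exists>a b. ((\<lambda>z. f z * g z) has_derivative (\<lambda>(h, k). a * h + b * k)) (at z)"
    by blast
qed

lemma holomorphic2_on_inverse:
  assumes "holomorphic2_on f U" "\<And>z. z \<in> U \<Longrightarrow> f z \<noteq> 0"
  shows "holomorphic2_on (\<lambda>z. inverse (f z)) U"
  unfolding holomorphic2_on_def
proof
  fix z assume z: "z \<in> U"
  obtain a b where f: "(f has_derivative (\<lambda>(h, k). a * h + b * k)) (at z)"
    using holomorphic2_onE[OF assms(1) z] .
  have "((\<lambda>z. inverse (f z)) has_derivative
      (\<lambda>(h, k). (- inverse (f z) * a * inverse (f z)) * h + (- inverse (f z) * b * inverse (f z)) * k)) (at z)"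
    by (rule has_derivative_eq_rhs[OF Deriv.has_derivative_inverse[OF assms(2)[OF z] f]])
       (auto simp: algebra_simps)
  then show "\<exists>a b. ((\<lambda>z. inverse (f z)) has_derivative (\<lambda>(h, k). a * h + b * k)) (at z)"
    by blast
qed

lemma holomorphic2_on_minus:
  "holomorphic2_on f U \<Longrightarrow> holomorphic2_on (\<lambda>z. - f z) U"
  using holomorphic2_on_mult[OF holomorphic2_on_const[of "-1" U], of f] by simp

lemma holomorphic2_on_diff:
  "holomorphic2_on f U \<Longrightarrow> holomorphic2_on g U \<Longrightarrow> holomorphic2_on (\<lambda>z. f z - g z) U"
  using holomorphic2_on_add[of f U "\<lambda>z. - g z"] holomorphic2_on_minus[of g U] by simp

lemma holomorphic2_on_divide:
  "holomorphic2_on f U \<Longrightarrow> holomorphic2_on g U \<Longrightarrow> (\<And>z. z \<in> U \<Longrightarrow> g z \<noteq> 0) \<Longrightarrow>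
     holomorphic2_on (\<lambda>z. f z / g z) U"
  using holomorphic2_on_mult[of f U "\<lambda>z. inverse (g z)"] holomorphic2_on_inverse[of g U]
  by (simp add: divide_inverse)

lemma holomorphic2_on_power:
  "holomorphic2_on f U \<Longrightarrow> holomorphic2_on (\<lambda>z. f z ^ n) U"
  by (induction n) (auto intro: holomorphic2_on_const holomorphic2_on_mult)

lemma holomorphic2_on_sum:
  "(\<And>i. i \<in> I \<Longrightarrow> holomorphic2_on (f i) U) \<Longrightarrow> holomorphic2_on (\<lambda>z. \<Sum>i\<in>I. f i z) U"
  by (induction I rule: infinite_finite_induct)
     (auto intro: holomorphic2_on_const holomorphic2_on_add)

lemmas holomorphic2_intros =
  holomorphic2_on_const holomorphic2_on_fst holomorphic2_on_snd holomorphic2_on_add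
  holomorphic2_on_diff holomorphic2_on_minus holomorphic2_on_mult holomorphic2_on_divide
  holomorphic2_on_power holomorphic2_on_sum

lemma holomorphic2_on_subset:
  "holomorphic2_on f U \<Longrightarrow> V \<subseteq> U \<Longrightarrow> holomorphic2_on f V"
  unfolding holomorphic2_on_def by blast

lemma holomorphic2_on_isCont:
  "holomorphic2_on f U \<Longrightarrow> z \<in> U \<Longrightarrow> isCont f z"
  by (elim holomorphic2_onE) (auto intro: has_derivative_continuous)

section \<open>Partial derivatives and their local boundedness\<close>

definition partial_p :: "(complex \<times> complex \<Rightarrow> complex) \<Rightarrow> complex \<times> complex \<Rightarrow> complex" where
  "partial_p g z = deriv (\<lambda>t. g (t, snd z)) (fst z)"

definition partial_q :: "(complex \<times> complex \<Rightarrow> complex) \<Rightarrow> complex \<times> complex \<Rightarrow> complex" where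
  "partial_q g z = deriv (\<lambda>t. g (fst z, t)) (snd z)"

lemma has_derivative_partials:
  assumes "(g has_derivative (\<lambda>(h, k). a * h + b * k)) (at (p, q))"
  shows "((\<lambda>t. g (t, q)) has_field_derivative a) (at p)"
    and "((\<lambda>t. g (p, t)) has_field_derivative b) (at q)"
proof -
  have "((\<lambda>t. (t, q)) has_derivative (\<lambda>h. (h, 0))) (at p)"
    by (intro has_derivative_Pair has_derivative_ident has_derivative_const)
  from has_derivative_compose[OF this assms]
  show "((\<lambda>t. g (t, q)) has_field_derivative a) (at p)"
    by (simp add: has_field_derivative_def)
  have "((\<lambda>t. (p, t)) has_derivative (\<lambda>h. (0, h))) (at q)"
    by (intro has_derivative_Pair has_derivative_ident has_derivative_const)
  from has_derivative_compose[OF this assms]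
  show "((\<lambda>t. g (p, t)) has_field_derivative b) (at q)"
    by (simp add: has_field_derivative_def)
qed

lemma partials_eqI:
  assumes "(g has_derivative (\<lambda>(h, k). a * h + b * k)) (at z)"
  shows "partial_p g z = a" "partial_q g z = b"
  using has_derivative_partials[of g a b "fst z" "snd z"] assms
  by (auto simp: partial_p_def partial_q_def DERIV_imp_deriv)

lemma holomorphic2_on_has_derivative:
  assumes "holomorphic2_on g U" "z \<in> U"
  shows "(g has_derivative (\<lambda>(h, k). partial_p g z * h + partial_q g z * k)) (at z)"
proof -
  obtain a b where "(g has_derivative (\<lambda>(h, k). a * h + b * k)) (at z)"
    using holomorphic2_onE[OF assms] .
  with partials_eqI[OF this] show ?thesis by simp
qed

lemma holomorphic2_on_partials:
  assumes "holomorphic2_on g U" "(p, q) \<in> U"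
  shows "((\<lambda>t. g (t, q)) has_field_derivative partial_p g (p, q)) (at p)"
    and "((\<lambda>t. g (p, t)) has_field_derivative partial_q g (p, q)) (at q)"
  using has_derivative_partials[OF holomorphic2_on_has_derivative[OF assms]] .

text \<open>Cauchy's estimate in each variable separately.\<close>

lemma holomorphic2_on_partials_bounded:
  assumes hol: "holomorphic2_on g U" and U: "open U" and z0: "z0 \<in> U"
  obtains B where "eventually (\<lambda>z. norm (partial_p g z) \<le> B \<and> norm (partial_q g z) \<le> B) (nhds z0)"
proof -
  obtain r where r: "r > 0" "cball z0 r \<subseteq> U"
    using U z0 open_contains_cball by blast
  have cont: "continuous_on U g"
    using hol holomorphic2_on_isCont continuous_at_imp_continuous_on by blast
  have "compact (g ` cball z0 r)"
    by (intro compact_continuous_image continuous_on_subset[OF cont]) (use r in auto)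
  then obtain B where B: "\<And>z. z \<in> cball z0 r \<Longrightarrow> norm (g z) \<le> B"
    by (meson bounded_iff compact_imp_bounded imageI)
  \<comment> \<open>Half the radius: a closed disc of radius \<open>?s\<close> in either variable,
    centered at a point within \<open>?s\<close> of \<open>z0\<close>, stays in the compact ball on
    which \<open>g\<close> is bounded.\<close>
  let ?s = "r / 2"
  have mem: "(x, y) \<in> cball z0 r" if "dist (p, q) z0 < ?s" "norm (p - x) \<le> ?s" "norm (q - y) = 0"
    for p q x y
  proof -
    have "dist (p, q) (x, y) \<le> ?s"
      using that by (simp add: dist_prod_def dist_norm)
    then show ?thesis
      using that(1) dist_triangle[of z0 "(x, y)" "(p, q)"] by (simp add: dist_commute)
  qed
  have mem': "(x, y) \<in> cball z0 r" if "dist (p, q) z0 < ?s" "norm (p - x) = 0" "norm (q - y) \<le> ?s"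
    for p q x y
  proof -
    have "dist (p, q) (x, y) \<le> ?s"
      using that by (simp add: dist_prod_def dist_norm)
    then show ?thesis
      using that(1) dist_triangle[of z0 "(x, y)" "(p, q)"] by (simp add: dist_commute)
  qed
  have *: "norm (deriv f w) \<le> B / ?s" if "\<And>x. norm (w - x) \<le> ?s \<Longrightarrow> f field_differentiable at x"
      "\<And>x. norm (w - x) \<le> ?s \<Longrightarrow> norm (f x) \<le> B" for f :: "complex \<Rightarrow> complex" and w
  proof -
    have "f holomorphic_on cball w ?s"
      using that(1) by (auto simp: holomorphic_on_def dist_norm intro: field_differentiable_at_within)
    then have "norm ((deriv ^^ 1) f w) \<le> fact 1 * B / ?s ^ 1"
      using that(2) r
      by (intro Cauchy_inequality)
         (auto intro: holomorphic_on_subset holomorphic_on_imp_continuous_on)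
    then show ?thesis by simp
  qed
  have "norm (partial_p g z) \<le> B / ?s \<and> norm (partial_q g z) \<le> B / ?s" if "dist z z0 < ?s" for z
  proof
    obtain p q where z: "z = (p, q)" by force
    show "norm (partial_p g z) \<le> B / ?s"
      unfolding partial_p_def
    proof (rule *)
      fix x assume x: "norm (fst z - x) \<le> ?s"
      then have "(x, q) \<in> cball z0 r" using that z by (intro mem[of p q]) auto
      then have m: "(x, q) \<in> cball z0 r" "(x, q) \<in> U" using r by auto
      then show "norm (g (x, snd z)) \<le> B" using B z by auto
      show "(\<lambda>t. g (t, snd z)) field_differentiable at x"
        using holomorphic2_on_partials(1)[OF hol m(2)] z
        by (auto simp: field_differentiable_def)
    qed
    show "norm (partial_q g z) \<le> B / ?s"
      unfolding partial_q_def
    proof (rule *)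
      fix x assume x: "norm (snd z - x) \<le> ?s"
      then have "(p, x) \<in> cball z0 r" using that z by (intro mem'[of p q]) auto
      then have m: "(p, x) \<in> cball z0 r" "(p, x) \<in> U" using r by auto
      then show "norm (g (fst z, x)) \<le> B" using B z by auto
      show "(\<lambda>t. g (fst z, t)) field_differentiable at x"
        using holomorphic2_on_partials(2)[OF hol m(2)] z
        by (auto simp: field_differentiable_def)
    qed
  qed
  then show ?thesis
    using r by (intro that[of "B / ?s"]) (auto simp: eventually_nhds_metric intro!: exI[of _ ?s])
qed

text \<open>Apply the inverse function theorem to \<open>(z, w) \<mapsto> (z, f (z, w))\<close> and
  restrict the inverse to the slice where the second coordinate is 0. The derivative obtained in
  this way is only real linear; its complex linear form comes from differentiating
  \<open>f (z, \<xi> z) = 0\<close>.\<close>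

lemma holomorphic_implicit_function:
  fixes f :: "(complex \<times> complex) \<times> complex \<Rightarrow> complex"
  assumes der: "\<And>v. (f has_derivative (\<lambda>((h, k), l). fp v * h + fq v * k + fx v * l)) (at v)"
    and cont: "continuous_on UNIV fp" "continuous_on UNIV fq" "continuous_on UNIV fx"
    and zero: "f (z0, w0) = 0" and nz: "fx (z0, w0) \<noteq> 0"
  obtains V \<xi> where "open V" "z0 \<in> V" "\<xi> z0 = w0"
    "\<And>z. z \<in> V \<Longrightarrow> f (z, \<xi> z) = 0" "\<And>z. z \<in> V \<Longrightarrow> fx (z, \<xi> z) \<noteq> 0"
    "\<And>z. z \<in> V \<Longrightarrow> (\<xi> has_derivative
       (\<lambda>(h, k). - fp (z, \<xi> z) / fx (z, \<xi> z) * h + - fq (z, \<xi> z) / fx (z, \<xi> z) * k)) (at z)"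
proof -
  define D where "D v = (\<lambda>((h, k), l). fp v * h + fq v * k + fx v * l)" for v
  define F where "F v = (fst v, f v)" for v
  define F' where "F' v = Blinfun (\<lambda>u. (fst u, D v u))" for v
  have Fd: "(F has_derivative (\<lambda>u. (fst u, D v u))) (at v)" for v
    unfolding F_def D_def by (intro has_derivative_Pair has_derivative_fst has_derivative_ident der)
  then have bl: "bounded_linear (\<lambda>u. (fst u, D v u))" for v
    using has_derivative_bounded_linear by blast
  have app: "blinfun_apply (F' v) u = (fst u, D v u)" for v u
    unfolding F'_def using bounded_linear_Blinfun_apply[OF bl] by simp
  have app': "blinfun_apply (F' v) = (\<lambda>u. (fst u, D v u))" for v
    by (rule ext) (rule app)
  have contF: "continuous_on UNIV F'"
  proof (rule continuous_on_blinfun_componentwise)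
    fix i :: "(complex \<times> complex) \<times> complex"
    show "continuous_on UNIV (\<lambda>v. blinfun_apply (F' v) i)"
      unfolding app D_def case_prod_beta by (intro continuous_intros cont)
  qed
  \<comment> \<open>The explicit inverse of the derivative of \<open>F\<close> at
    \<open>(z0, w0)\<close>: solve \<open>fp h + fq k + fx l = m\<close> for
    \<open>l\<close>.\<close>
  define I where "I u = (fst u, (snd u - fp (z0, w0) * fst (fst u) - fq (z0, w0) * snd (fst u)) / fx (z0, w0))"
    for u :: "(complex \<times> complex) \<times> complex"
  have "linear I"
    by (rule linearI) (auto simp: I_def algebra_simps add_divide_distrib diff_divide_distrib scaleR_conv_of_real)
  then have blI: "bounded_linear I"
    using linear_conv_bounded_linear by blast
  have inv: "Blinfun I o\<^sub>L F' (z0, w0) = id_blinfun"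
    by (rule blinfun_eqI)
       (auto simp: bounded_linear_Blinfun_apply[OF blI] app I_def D_def nz case_prod_beta)
  obtain U' V g g' where V: "open U'" "(z0, w0) \<in> U'" "open V" "F (z0, w0) \<in> V"
    and hom: "homeomorphism U' V F g"
    and g: "\<And>y. y \<in> V \<Longrightarrow> (g has_derivative (g' y)) (at y)"
    and "\<And>y. y \<in> V \<Longrightarrow> g' y = inv (blinfun_apply (F' (g y)))"
    and bij: "\<And>y. y \<in> V \<Longrightarrow> bij (blinfun_apply (F' (g y)))"
    by (rule inverse_function_theorem[of UNIV F F' "(z0, w0)" "Blinfun I"])
       (use inv contF Fd in \<open>simp_all add: app' that\<close>)
  define W where "W = {z. (z, 0) \<in> V}"
  define \<xi> where "\<xi> z = snd (g (z, 0))" for z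
  have Fg: "F (g y) = y" if "y \<in> V" for y
    using hom that by (auto simp: homeomorphism_def)
  have gF: "g (F x) = x" if "x \<in> U'" for x
    using hom that by (auto simp: homeomorphism_def)
  have geq: "g (z, 0) = (z, \<xi> z)" if "z \<in> W" for z
    using Fg[of "(z, 0)"] that by (auto simp: W_def F_def \<xi>_def prod_eq_iff)
  have f0: "f (z, \<xi> z) = 0" if "z \<in> W" for z
    using Fg[of "(z, 0)"] that geq[OF that] by (auto simp: W_def F_def)
  have "continuous_on UNIV (\<lambda>z :: complex \<times> complex. (z, 0 :: complex))"
    by (intro continuous_intros)
  from open_vimage[OF V(3) this] have oW: "open W"
    by (simp add: W_def vimage_def)
  \<comment> \<open>The derivative of \<open>F\<close> is bijective at every point of the inverse
    image, while a zero of \<open>fx\<close> would put \<open>((0, 0), 1)\<close> into its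
    kernel.\<close>
  have fx: "fx (z, \<xi> z) \<noteq> 0" if "z \<in> W" for z
  proof
    assume a: "fx (z, \<xi> z) = 0"
    have "inj (blinfun_apply (F' (z, \<xi> z)))"
      using bij[of "(z, 0)"] that geq[OF that] by (auto simp: W_def bij_def)
    moreover have "blinfun_apply (F' (z, \<xi> z)) ((0, 0), 1) = blinfun_apply (F' (z, \<xi> z)) ((0, 0), 0)"
      by (simp add: app D_def a)
    ultimately show False using injD by fastforce
  qed
  have xd: "(\<xi> has_derivative
       (\<lambda>(h, k). - fp (z, \<xi> z) / fx (z, \<xi> z) * h + - fq (z, \<xi> z) / fx (z, \<xi> z) * k)) (at z)"
    if z: "z \<in> W" for z
  proof -
    have "((\<lambda>z. (z, 0)) has_derivative (\<lambda>h. (h, 0 :: complex))) (at z)"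
      by (intro has_derivative_Pair has_derivative_ident has_derivative_const)
    moreover have "(g has_derivative (g' (z, 0))) (at (z, 0))"
      using g z by (auto simp: W_def)
    ultimately have "((\<lambda>z. g (z, 0)) has_derivative (\<lambda>h. g' (z, 0) (h, 0))) (at z)"
      using has_derivative_compose by blast
    from has_derivative_snd[OF this]
    have 1: "(\<xi> has_derivative (\<lambda>h. snd (g' (z, 0) (h, 0)))) (at z)"
      by (simp add: \<xi>_def[abs_def])
    define X where "X h = snd (g' (z, 0) (h, 0))" for h
    have "((\<lambda>z. (z, \<xi> z)) has_derivative (\<lambda>h. (h, X h))) (at z)"
      unfolding X_def by (intro has_derivative_Pair has_derivative_ident 1)
    from has_derivative_compose[OF this der]
    have 2: "((\<lambda>z. f (z, \<xi> z)) has_derivative (\<lambda>h. D (z, \<xi> z) (h, X h))) (at z)"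
      by (simp add: D_def)
    have "((\<lambda>z. f (z, \<xi> z)) has_derivative (\<lambda>h. 0)) (at z)"
      by (rule has_derivative_transform_within_open[OF has_derivative_const[of 0] oW z])
         (use f0 in auto)
    from has_derivative_unique[OF 2 this]
    have "D (z, \<xi> z) ((h, k), X (h, k)) = 0" for h k by (rule fun_cong)
    then have "fx (z, \<xi> z) * X (h, k) = - fp (z, \<xi> z) * h - fq (z, \<xi> z) * k" for h k
      by (simp add: D_def algebra_simps eq_neg_iff_add_eq_0)
    then have "X (h, k) = - fp (z, \<xi> z) / fx (z, \<xi> z) * h + - fq (z, \<xi> z) / fx (z, \<xi> z) * k" for h k
      using fx[OF z] by (simp add: field_simps)
    then have "X = (\<lambda>(h, k). - fp (z, \<xi> z) / fx (z, \<xi> z) * h + - fq (z, \<xi> z) / fx (z, \<xi> z) * k)"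
      by auto
    with 1 show ?thesis
      by (simp add: X_def[abs_def, symmetric])
  qed
  have "z0 \<in> W" "\<xi> z0 = w0"
    using V gF[OF V(2)] zero by (auto simp: W_def F_def \<xi>_def)
  then show ?thesis
    using that[of W \<xi>] oW f0 fx xd by blast
qed

section \<open>The curvature along a tangency curve\<close>

lemma ext_deriv_cong:
  assumes U: "open U" "z \<in> U" and eq: "\<And>w. w \<in> U \<Longrightarrow> \<omega> w = \<omega>' w"
  shows "ext_deriv \<omega> z = ext_deriv \<omega>' z"
proof -
  obtain p q where z: "z = (p, q)" by force
  have ev: "eventually (\<lambda>w. \<omega> w = \<omega>' w) (nhds (p, q))"
    using U eq z eventually_nhds by blast
  have "((\<lambda>t. (t, q)) \<longlongrightarrow> (p, q)) (nhds p)" "((\<lambda>t. (p, t)) \<longlongrightarrow> (p, q)) (nhds q)"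
    by (auto intro!: tendsto_intros filterlim_ident)
  then have "eventually (\<lambda>t. \<omega> (t, q) = \<omega>' (t, q)) (nhds p)"
      "eventually (\<lambda>t. \<omega> (p, t) = \<omega>' (p, t)) (nhds q)"
    using ev by (auto simp: filterlim_iff)
  then have "deriv (\<lambda>t. snd (\<omega> (t, q))) p = deriv (\<lambda>t. snd (\<omega>' (t, q))) p"
      "deriv (\<lambda>t. fst (\<omega> (p, t))) q = deriv (\<lambda>t. fst (\<omega>' (p, t))) q"
    by (auto intro!: deriv_cong_ev elim!: eventually_mono)
  then show ?thesis by (simp add: ext_deriv_def z)
qed

lemma partials_bounded_mult_tendsto_0:
  assumes hol: "holomorphic2_on g V" and V: "open V" "z0 \<in> V" and f: "(f \<longlongrightarrow> 0) (at z0 within S)"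
  shows "((\<lambda>z. f z * partial_p g z) \<longlongrightarrow> 0) (at z0 within S)"
    and "((\<lambda>z. f z * partial_q g z) \<longlongrightarrow> 0) (at z0 within S)"
proof -
  obtain B where B: "eventually (\<lambda>z. norm (partial_p g z) \<le> B \<and> norm (partial_q g z) \<le> B) (nhds z0)"
    using holomorphic2_on_partials_bounded[OF hol V] .
  then have B': "eventually (\<lambda>z. norm (partial_p g z) \<le> B) (at z0 within S)"
      "eventually (\<lambda>z. norm (partial_q g z) \<le> B) (at z0 within S)"
    by (auto simp: eventually_at_filter elim!: eventually_mono)
  show "((\<lambda>z. f z * partial_p g z) \<longlongrightarrow> 0) (at z0 within S)"
    using lim_null_mult_right_bounded[OF f B'(1)] .
  show "((\<lambda>z. f z * partial_q g z) \<longlongrightarrow> 0) (at z0 within S)"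
    using lim_null_mult_right_bounded[OF f B'(2)] .
qed

text \<open>
  The leading polar part of the exterior derivative of \<open>\<Theta> / \<delta> (dq - x dp)\<close> along \<open>\<delta> = 0\<close>
  is \<open>- \<Theta> (\<partial>\<^sub>p \<delta> + x \<partial>\<^sub>q \<delta>) / \<delta>\<^sup>2\<close>.
\<close>

lemma closed_polar_form_residue:
  assumes V: "open V" "z0 \<in> V"
    and hol: "holomorphic2_on \<Theta> V" "holomorphic2_on \<delta> V" "holomorphic2_on x V"
      "holomorphic2_on A V" "holomorphic2_on B V"
      "holomorphic2_on (partial_p \<delta>) V" "holomorphic2_on (partial_q \<delta>) V"
    and z0: "\<delta> z0 = 0" "partial_p \<delta> z0 + x z0 * partial_q \<delta> z0 \<noteq> 0"
    and closed: "\<And>z. z \<in> V \<Longrightarrow> \<delta> z \<noteq> 0 \<Longrightarrow>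
      ext_deriv (\<lambda>z. (A z - x z * \<Theta> z / \<delta> z, B z + \<Theta> z / \<delta> z)) z = 0"
  shows "\<Theta> z0 = 0"
proof -
  define S where "S = {z \<in> V. \<delta> z \<noteq> 0}"
  define F where "F = at z0 within S"
  \<comment> \<open>Closedness multiplied by \<open>\<delta>\<^sup>2\<close>. Every term on the
    right has a factor \<open>\<delta>\<close>, and the derivatives beside it are bounded near
    \<open>z0\<close>, so the right side tends to 0.\<close>
  have key: "\<Theta> z * (partial_p \<delta> z + x z * partial_q \<delta> z) =
     \<delta> z * partial_p \<Theta> z + \<delta> z * \<Theta> z * partial_q x z + \<delta> z * x z * partial_q \<Theta> z
     + \<delta> z * \<delta> z * partial_p B z - \<delta> z * \<delta> z * partial_q A z" if "z \<in> S" for z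
  proof -
    obtain p q where z: "z = (p, q)" by force
    have zV: "(p, q) \<in> V" and nz: "\<delta> (p, q) \<noteq> 0" using that z by (auto simp: S_def)
    note d = holomorphic2_on_partials[OF _ zV]
    have "((\<lambda>t. B (t, q) + \<Theta> (t, q) / \<delta> (t, q)) has_field_derivative
       (partial_p B z + (partial_p \<Theta> z * \<delta> z - \<Theta> z * partial_p \<delta> z) / (\<delta> z * \<delta> z))) (at p)"
      using nz unfolding z by (intro DERIV_add DERIV_divide d(1) hol)
    moreover have "((\<lambda>t. A (p, t) - x (p, t) * \<Theta> (p, t) / \<delta> (p, t)) has_field_derivative
       (partial_q A z - ((partial_q x z * \<Theta> z + partial_q \<Theta> z * x z) * \<delta> z - x z * \<Theta> z * partial_q \<delta> z) / (\<delta> z * \<delta> z))) (at q)"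
      using nz unfolding z by (intro DERIV_diff DERIV_divide DERIV_mult d(2) hol)
    ultimately have "0 = partial_p B z + (partial_p \<Theta> z * \<delta> z - \<Theta> z * partial_p \<delta> z) / (\<delta> z * \<delta> z)
        - (partial_q A z - ((partial_q x z * \<Theta> z + partial_q \<Theta> z * x z) * \<delta> z - x z * \<Theta> z * partial_q \<delta> z) / (\<delta> z * \<delta> z))"
      using closed[OF zV nz] by (simp add: ext_deriv_def DERIV_imp_deriv z)
    then have "0 * (\<delta> z * \<delta> z) = (partial_p B z + (partial_p \<Theta> z * \<delta> z - \<Theta> z * partial_p \<delta> z) / (\<delta> z * \<delta> z)
        - (partial_q A z - ((partial_q x z * \<Theta> z + partial_q \<Theta> z * x z) * \<delta> z - x z * \<Theta> z * partial_q \<delta> z) / (\<delta> z * \<delta> z)))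
        * (\<delta> z * \<delta> z)" by simp
    then have "0 = partial_p B z * (\<delta> z * \<delta> z) + (partial_p \<Theta> z * \<delta> z - \<Theta> z * partial_p \<delta> z)
        - (partial_q A z * (\<delta> z * \<delta> z) - ((partial_q x z * \<Theta> z + partial_q \<Theta> z * x z) * \<delta> z - x z * \<Theta> z * partial_q \<delta> z))"
      using nz z by (simp only: ring_distribs) simp
    then show ?thesis
      by (simp add: algebra_simps)
  qed
  have lim: "(g \<longlongrightarrow> g z0) F" if "holomorphic2_on g V" for g
    using continuous_at_imp_continuous_at_within[OF holomorphic2_on_isCont[OF that V(2)]]
    unfolding F_def continuous_within .
  have l0: "(\<delta> \<longlongrightarrow> 0) F" using lim[OF hol(2)] z0 by simp
  have l1: "((\<lambda>z. \<delta> z * g z) \<longlongrightarrow> 0) F" if "holomorphic2_on g V" for g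
    using tendsto_mult[OF l0 lim[OF that]] by simp
  note b = partials_bounded_mult_tendsto_0[OF _ V, of _ _ S, folded F_def]
  have "((\<lambda>z. \<delta> z * partial_p \<Theta> z + \<delta> z * \<Theta> z * partial_q x z + \<delta> z * x z * partial_q \<Theta> z
     + \<delta> z * \<delta> z * partial_p B z - \<delta> z * \<delta> z * partial_q A z) \<longlongrightarrow> 0 + 0 + 0 + 0 - 0) F"
    by (intro tendsto_add tendsto_diff b hol l0 l1)
  moreover have "eventually (\<lambda>z. \<delta> z * partial_p \<Theta> z + \<delta> z * \<Theta> z * partial_q x z + \<delta> z * x z * partial_q \<Theta> z
     + \<delta> z * \<delta> z * partial_p B z - \<delta> z * \<delta> z * partial_q A z = \<Theta> z * (partial_p \<delta> z + x z * partial_q \<delta> z)) F"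
    using key by (auto simp: F_def eventually_at_filter)
  ultimately have r0: "((\<lambda>z. \<Theta> z * (partial_p \<delta> z + x z * partial_q \<delta> z)) \<longlongrightarrow> 0) F"
    using Lim_transform_eventually by fastforce
  have rl: "((\<lambda>z. \<Theta> z * (partial_p \<delta> z + x z * partial_q \<delta> z)) \<longlongrightarrow>
      \<Theta> z0 * (partial_p \<delta> z0 + x z0 * partial_q \<delta> z0)) F"
    by (intro tendsto_intros lim hol)
  \<comment> \<open>Limits along \<open>\<delta> \<noteq> 0\<close> are unique only if such points
    accumulate at \<open>z0\<close>. Otherwise \<open>\<delta>\<close> vanishes near
    \<open>z0\<close>, and so do both of its partial derivatives there, against
    transversality.\<close>
  have "F \<noteq> bot"
  proof
    assume "F = bot"
    then obtain W where W: "open W" "z0 \<in> W" "\<And>z. z \<in> W \<Longrightarrow> z \<noteq> z0 \<Longrightarrow> z \<notin> S"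
      unfolding F_def trivial_limit_def eventually_at_topological by blast
    have "\<delta> z = 0" if "z \<in> W \<inter> V" for z
      using W(3)[of z] that z0 by (cases "z = z0") (auto simp: S_def)
    then have "(\<delta> has_derivative (\<lambda>(h, k). 0 * h + 0 * k)) (at z0)"
      using W V by (intro has_derivative_transform_within_open[OF has_derivative_const[of 0], THEN has_derivative_eq_rhs, of "W \<inter> V"]) auto
    from partials_eqI[OF this] z0 show False by simp
  qed
  from tendsto_unique[OF this r0 rl] z0 show ?thesis by simp
qed

text \<open>The form \<open>dq - x\<^sub>i dp\<close>. With the coefficient of \<open>dq\<close>
  normalized to 1, \<open>\<delta>\<^sub>j\<^sub>k\<close> is simply
  \<open>x\<^sub>k - x\<^sub>j\<close>.\<close>

definition slope_web :: "(nat \<Rightarrow> complex \<times> complex \<Rightarrow> complex) \<Rightarrow> nat \<Rightarrow> form1" where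
  "slope_web x i z = (- x i z, 1)"

text \<open>The value of \<open>\<eta>\<^sub>i\<^sub>j\<^sub>k\<close> on the vector field \<open>\<partial>\<^sub>p + x\<^sub>i \<partial>\<^sub>q\<close> tangent to the \<open>i\<close>-th foliation.\<close>

definition eta_tangent ::
    "(nat \<Rightarrow> complex \<times> complex \<Rightarrow> complex) \<Rightarrow> nat \<Rightarrow> nat \<Rightarrow> nat \<Rightarrow> complex \<times> complex \<Rightarrow> complex" where
  "eta_tangent x i j k z =
     (partial_p (x k) z - partial_p (x j) z + x i z * (partial_q (x k) z - partial_q (x j) z)) /
       (x k z - x j z) + partial_q (x i) z"

text \<open>The factor \<open>x k z - x j z\<close> occurs in \<open>wedge_weighted_form\<close> as
  well. Once it is cancelled, each of the three equations defining \<open>eta\<close> prescribes the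
  value of the form on one of the three tangent fields.\<close>

lemma ext_deriv_weighted_form:
  assumes z: "z \<in> U" and hol: "holomorphic2_on (x i) U" "holomorphic2_on (x j) U" "holomorphic2_on (x k) U"
    and "x j z \<noteq> x k z"
  shows "ext_deriv (weighted_form (slope_web x) i j k) z = (x k z - x j z) * eta_tangent x i j k z"
proof -
  obtain p q where [simp]: "z = (p, q)" by force
  note d = holomorphic2_on_partials[OF _ z[simplified]]
  have "((\<lambda>t. x k (t, q) - x j (t, q)) has_field_derivative partial_p (x k) z - partial_p (x j) z) (at p)"
    unfolding \<open>z = (p, q)\<close> by (intro DERIV_diff d hol)
  moreover have "((\<lambda>t. - ((x k (p, t) - x j (p, t)) * x i (p, t))) has_field_derivative
     - ((partial_q (x k) z - partial_q (x j) z) * x i z + partial_q (x i) z * (x k z - x j z))) (at q)"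
    unfolding \<open>z = (p, q)\<close> by (intro DERIV_minus DERIV_mult DERIV_diff d hol)
  ultimately show ?thesis
    using assms(5)
    by (simp add: ext_deriv_def weighted_form_def slope_web_def wedge_def DERIV_imp_deriv
        eta_tangent_def algebra_simps minus_divide_left[symmetric])
       (simp add: field_simps)
qed

lemma wedge_weighted_form:
  "wedge e (weighted_form (slope_web x) i j k z) = (x k z - x j z) * (fst e + snd e * x i z)"
  by (simp add: wedge_def weighted_form_def slope_web_def algebra_simps)

text \<open>Any three forms in the plane satisfy \<open>\<delta>\<^sub>s\<^sub>t \<omega>\<^sub>r +
  \<delta>\<^sub>t\<^sub>r \<omega>\<^sub>s + \<delta>\<^sub>r\<^sub>s \<omega>\<^sub>t = 0\<close>,
  and this is the exterior derivative of that identity. It makes the three linear conditions on the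
  two coefficients of \<open>eta\<close> compatible.\<close>

lemma eta_tangent_relation:
  assumes "x r z \<noteq> x s z" "x s z \<noteq> x t z" "x r z \<noteq> x t z"
  shows "(x t z - x s z) * eta_tangent x r s t z + (x r z - x t z) * eta_tangent x s t r z
    + (x s z - x r z) * eta_tangent x t r s z = 0"
proof -
  have "(x k z - x j z) * eta_tangent x i j k z =
     partial_p (x k) z - partial_p (x j) z + x i z * (partial_q (x k) z - partial_q (x j) z)
     + (x k z - x j z) * partial_q (x i) z" if "x k z \<noteq> x j z" for i j k
    using that by (simp add: eta_tangent_def field_simps)
  note * = this[of t s r] this[of r t s] this[of s r t]
  show ?thesis
    unfolding *(1)[OF assms(2)[symmetric]] *(2)[OF assms(3)] *(3)[OF assms(1)[symmetric]]
    by (simp add: algebra_simps)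
qed

text \<open>Lagrange interpolation recovers a 1-form from its values on two tangent fields, and
  \<open>eta_tangent_relation\<close> then gives the third value. The nodes are \<open>r\<close> and
  \<open>t\<close>, so that for the triples \<open>(0, 1, t)\<close> the denominator stays nonzero
  on the curve \<open>x\<^sub>0 = x\<^sub>1\<close>.\<close>

lemma eta_slope_web:
  assumes z: "z \<in> U" and hol: "holomorphic2_on (x r) U" "holomorphic2_on (x s) U" "holomorphic2_on (x t) U"
    and ne: "x r z \<noteq> x s z" "x s z \<noteq> x t z" "x r z \<noteq> x t z"
  shows "eta (slope_web x) r s t z =
    ((x r z * eta_tangent x t r s z - x t z * eta_tangent x r s t z) / (x r z - x t z),
     (eta_tangent x r s t z - eta_tangent x t r s z) / (x r z - x t z))" (is "_ = (?\<alpha>, ?\<beta>)")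
proof -
  have iff: "ext_deriv (weighted_form (slope_web x) i j k) z = wedge e (weighted_form (slope_web x) i j k z)
      \<longleftrightarrow> fst e + snd e * x i z = eta_tangent x i j k z"
    if "holomorphic2_on (x i) U" "holomorphic2_on (x j) U" "holomorphic2_on (x k) U" "x j z \<noteq> x k z"
    for i j k e
    using that by (auto simp: ext_deriv_weighted_form[OF z] wedge_weighted_form)
  have lagrange: "(a * v - b * u) / (a - b) + (u - v) / (a - b) * a = u"
      "(a * v - b * u) / (a - b) + (u - v) / (a - b) * b = v" if "a \<noteq> b" for a b u v :: complex
  proof -
    have "(a * v - b * u) + (u - v) * a = u * (a - b)" "(a * v - b * u) + (u - v) * b = v * (a - b)"
      by (simp_all add: algebra_simps)
    with that show "(a * v - b * u) / (a - b) + (u - v) / (a - b) * a = u"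
      "(a * v - b * u) / (a - b) + (u - v) / (a - b) * b = v"
      by (simp_all add: add_divide_distrib[symmetric])
  qed
  have 1: "?\<alpha> + ?\<beta> * x r z = eta_tangent x r s t z"
    by (rule lagrange[OF ne(3)])
  have 2: "?\<alpha> + ?\<beta> * x t z = eta_tangent x t r s z"
    by (rule lagrange[OF ne(3)])
  have "(x t z - x s z) * (?\<alpha> + ?\<beta> * x r z) + (x r z - x t z) * (?\<alpha> + ?\<beta> * x s z)
      + (x s z - x r z) * (?\<alpha> + ?\<beta> * x t z) = 0"
    by (simp only: ring_distribs) (simp add: algebra_simps)
  then have 3: "?\<alpha> + ?\<beta> * x s z = eta_tangent x s t r z"
    using eta_tangent_relation[of x r z s t, OF ne] ne(3) unfolding 1 2
    by (metis add_left_cancel add_right_cancel eq_iff_diff_eq_0 mult_left_cancel)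
  show ?thesis
    unfolding eta_def
  proof (rule the_equality, goal_cases)
    case 1
    show ?case
      using \<open>?\<alpha> + ?\<beta> * x r z = _\<close> 2 3 hol ne by (simp add: iff)
  next
    case (2 e)
    then have e: "fst e + snd e * x r z = ?\<alpha> + ?\<beta> * x r z" "fst e + snd e * x t z = ?\<alpha> + ?\<beta> * x t z"
      using \<open>?\<alpha> + ?\<beta> * x r z = _\<close> \<open>?\<alpha> + ?\<beta> * x t z = _\<close> hol ne by (simp_all add: iff)
    have sub: "b = b'" if "a + b * u = a' + b' * u" "a + b * v = a' + b' * v" "u \<noteq> v" for a b a' b' u v :: complex
    proof -
      have "(b - b') * (u - v) = (a + b * u - (a' + b' * u)) - (a + b * v - (a' + b' * v))"
        by (simp add: algebra_simps)
      with that show ?thesis by simp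
    qed
    have "snd e = ?\<beta>" by (rule sub[OF e ne(3)])
    moreover from e(1) this have "fst e = ?\<alpha>" by simp
    ultimately show ?case by (simp add: prod_eq_iff)
  qed
qed

lemma holomorphic2_on_cong:
  assumes "holomorphic2_on g V" "open V" and eq: "\<And>z. z \<in> V \<Longrightarrow> f z = g z"
  shows "holomorphic2_on f V"
proof (rule holomorphic2_onI)
  fix z assume "z \<in> V"
  then show "(f has_derivative (\<lambda>(h, k). partial_p g z * h + partial_q g z * k)) (at z)"
    by (intro has_derivative_transform_within_open[OF holomorphic2_on_has_derivative[OF assms(1)]])
       (use assms(2) eq in auto)
qed

lemma holomorphic2_on_eta_tangent:
  assumes "holomorphic2_on (x i) U" "holomorphic2_on (x j) U" "holomorphic2_on (x k) U"
    "holomorphic2_on (partial_p (x j)) U" "holomorphic2_on (partial_p (x k)) U"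
    "holomorphic2_on (partial_q (x i)) U" "holomorphic2_on (partial_q (x j)) U"
    "holomorphic2_on (partial_q (x k)) U" "\<And>z. z \<in> U \<Longrightarrow> x k z \<noteq> x j z"
  shows "holomorphic2_on (eta_tangent x i j k) U"
  using assms unfolding eta_tangent_def[abs_def] by (intro holomorphic2_intros) auto

text \<open>
  Only the \<open>\<eta>\<^sub>0\<^sub>1\<^sub>t\<close> have a pole along the curve \<open>x\<^sub>0 = x\<^sub>1\<close>; the sum of their polar parts is
  \<open>\<Theta> / \<delta> (dq - x\<^sub>0 dp)\<close> with \<open>\<delta> = x\<^sub>1 - x\<^sub>0\<close> and \<open>\<Theta>\<close> the sum in the conclusion.
\<close>

lemma flat_barycenter:
  assumes V: "open V" "z0 \<in> V" and d: "d \<ge> 2"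
    and hol: "\<And>i. i < d \<Longrightarrow> holomorphic2_on (x i) V"
    and holp: "\<And>i. i < d \<Longrightarrow> holomorphic2_on (partial_p (x i)) V"
    and holq: "\<And>i. i < d \<Longrightarrow> holomorphic2_on (partial_q (x i)) V"
    and ne: "\<And>z i j. z \<in> V \<Longrightarrow> i < j \<Longrightarrow> j < d \<Longrightarrow> (i, j) \<noteq> (0, 1) \<Longrightarrow> x i z \<noteq> x j z"
    and meet: "x 0 z0 = x 1 z0"
    and transverse: "partial_p (x 1) z0 - partial_p (x 0) z0
      + x 0 z0 * (partial_q (x 1) z0 - partial_q (x 0) z0) \<noteq> 0"
    and flat: "\<And>z. z \<in> V \<Longrightarrow> x 0 z \<noteq> x 1 z \<Longrightarrow> curvature d (slope_web x) z = 0"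
  shows "(\<Sum>t = 2..<d. (partial_p (x 1) z0 - partial_p (x 0) z0
      + x t z0 * (partial_q (x 1) z0 - partial_q (x 0) z0)) / (x t z0 - x 0 z0)) = 0"
proof -
  define T where "T = {(r, s, t). r < s \<and> s < t \<and> t < d}"
  have finT: "finite T"
    by (rule finite_subset[of _ "{..<d} \<times> {..<d} \<times> {..<d}"]) (auto simp: T_def)
  define \<delta> where "\<delta> z = x 1 z - x 0 z" for z
  define \<delta>p where "\<delta>p z = partial_p (x 1) z - partial_p (x 0) z" for z
  define \<delta>q where "\<delta>q z = partial_q (x 1) z - partial_q (x 0) z" for z
  define \<Theta> where "\<Theta> t z = (\<delta>p z + x t z * \<delta>q z) / (x t z - x 0 z)" for t z
  define \<Theta>' where "\<Theta>' \<tau> z = (case \<tau> of (r, s, t) \<Rightarrow> if r = 0 \<and> s = 1 then \<Theta> t z else 0)" for \<tau> :: "nat \<times> nat \<times> nat" and z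
  \<comment> \<open>\<open>P\<close> is \<open>eta_tangent x t r s\<close> without the term that has
    a pole along \<open>x\<^sub>0 = x\<^sub>1\<close>. \<open>A\<close> and \<open>B\<close> are the
    coefficients of \<open>eta\<close> formed with \<open>P\<close> instead, hence holomorphic on
    all of \<open>V\<close>.\<close>
  define P where "P r s t z = (if r = 0 \<and> s = 1 then partial_q (x t) z else eta_tangent x t r s z)" for r s t :: nat and z
  define A where "A \<tau> z = (case \<tau> of (r, s, t) \<Rightarrow>
     (x r z * P r s t z - x t z * eta_tangent x r s t z) / (x r z - x t z))" for \<tau> z
  define B where "B \<tau> z = (case \<tau> of (r, s, t) \<Rightarrow>
     (eta_tangent x r s t z - P r s t z) / (x r z - x t z))" for \<tau> z
  have ne01: "i < j \<Longrightarrow> j < d \<Longrightarrow> j \<noteq> 1 \<Longrightarrow> z \<in> V \<Longrightarrow> x i z \<noteq> x j z" for i j z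
    using ne by auto
  have hol\<delta>: "holomorphic2_on \<delta> V" "holomorphic2_on \<delta>p V" "holomorphic2_on \<delta>q V"
    unfolding \<delta>_def[abs_def] \<delta>p_def[abs_def] \<delta>q_def[abs_def]
    using d by (intro holomorphic2_intros hol holp holq; simp)+
  have hol\<Theta>: "holomorphic2_on (\<Theta> t) V" if "1 < t" "t < d" for t
    unfolding \<Theta>_def[abs_def] using that ne01[of 0 t]
    by (intro holomorphic2_intros hol hol\<delta>) (auto, metis)
  have hol\<Theta>': "holomorphic2_on (\<Theta>' \<tau>) V" if "\<tau> \<in> T" for \<tau>
  proof -
    obtain r s t where \<tau>: "\<tau> = (r, s, t)" by (cases \<tau>)
    show ?thesis
      using that hol\<Theta>[of t] holomorphic2_on_const[of 0 V]
      by (cases "r = 0 \<and> s = 1") (auto simp: \<Theta>'_def[abs_def] T_def \<tau>)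
  qed
  have hole: "holomorphic2_on (eta_tangent x r s t) V" if "(r, s, t) \<in> T" for r s t
    using that ne01[of s t] by (intro holomorphic2_on_eta_tangent hol holp holq) (force simp: T_def)+
  have holP: "holomorphic2_on (P r s t) V" if "(r, s, t) \<in> T" for r s t
  proof (cases "r = 0 \<and> s = 1")
    case True
    then show ?thesis using that holq by (auto simp: P_def[abs_def] T_def)
  next
    case False
    moreover have "holomorphic2_on (eta_tangent x t r s) V"
      using that False ne[of _ r s] by (intro holomorphic2_on_eta_tangent hol holp holq) (force simp: T_def)+
    ultimately show ?thesis by (auto simp: P_def[abs_def])
  qed
  have holA: "holomorphic2_on (A \<tau>) V" and holB: "holomorphic2_on (B \<tau>) V" if T: "\<tau> \<in> T" for \<tau>
  proof -
    obtain r s t where [simp]: "\<tau> = (r, s, t)" by (cases \<tau>)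
    have *: "r < d" "t < d" "\<And>z. z \<in> V \<Longrightarrow> x r z - x t z \<noteq> 0"
      using T ne01[of r t] by (auto simp: T_def)
    show "holomorphic2_on (A \<tau>) V" "holomorphic2_on (B \<tau>) V"
      using T unfolding A_def[abs_def] B_def[abs_def]
      by (auto intro!: holomorphic2_intros hole holP hol *)
  qed
  have eta: "eta (slope_web x) r s t z = (A \<tau> z - x 0 z * \<Theta>' \<tau> z / \<delta> z, B \<tau> z + \<Theta>' \<tau> z / \<delta> z)"
    if z: "z \<in> V" "\<delta> z \<noteq> 0" and T: "\<tau> \<in> T" and \<tau>: "\<tau> = (r, s, t)" for r s t \<tau> z
  proof -
    have lt: "r < s" "s < t" "t < d" using T \<tau> by (auto simp: T_def)
    have nes: "x r z \<noteq> x s z" "x s z \<noteq> x t z" "x r z \<noteq> x t z"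
      using lt z ne[of z r s] ne01[of s t z] ne01[of r t z]
      by (cases "(r, s) = (0, 1)"; force simp: \<delta>_def)+
    note e = eta_slope_web[OF z(1) hol hol hol nes]
    show ?thesis
    proof (cases "r = 0 \<and> s = 1")
      case False
      then have "\<Theta>' \<tau> z = 0" "P r s t z = eta_tangent x t r s z"
        by (auto simp: \<Theta>'_def P_def \<tau>)
      then show ?thesis using e lt by (simp add: A_def B_def \<tau>)
    next
      case True
      define u where "u = x t z - x 0 z"
      have u: "u \<noteq> 0" "x 0 z - x t z = - u" using nes True by (auto simp: u_def)
      define v where "v = (\<delta>p z + x t z * \<delta>q z) / \<delta> z"
      have 1: "eta_tangent x t 0 1 z = v + P r s t z"
        using True by (simp add: eta_tangent_def v_def \<delta>p_def \<delta>q_def \<delta>_def P_def)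
      have 2: "\<Theta>' \<tau> z / \<delta> z = v / u"
        using True by (simp add: \<Theta>'_def \<Theta>_def v_def u_def \<tau>)
      have "eta (slope_web x) r s t z =
         ((x 0 z * (v + P r s t z) - x t z * eta_tangent x r s t z) / (- u),
          (eta_tangent x r s t z - (v + P r s t z)) / (- u))"
        using e lt True 1 u(2) by simp
      also have "\<dots> = (A \<tau> z - x 0 z * (v / u), B \<tau> z + v / u)"
        using True u by (simp add: A_def B_def \<tau>) (simp add: field_simps)
      finally show ?thesis by (simp add: 2[symmetric])
    qed
  qed
  have sum: "(\<Sum>(r, s, t) \<in> T. eta (slope_web x) r s t z) =
     ((\<Sum>\<tau>\<in>T. A \<tau> z) - x 0 z * (\<Sum>\<tau>\<in>T. \<Theta>' \<tau> z) / \<delta> z, (\<Sum>\<tau>\<in>T. B \<tau> z) + (\<Sum>\<tau>\<in>T. \<Theta>' \<tau> z) / \<delta> z)"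
    if z: "z \<in> V" "\<delta> z \<noteq> 0" for z
  proof -
    have "(\<Sum>(r, s, t) \<in> T. eta (slope_web x) r s t z) =
      (\<Sum>\<tau>\<in>T. (A \<tau> z - x 0 z * \<Theta>' \<tau> z / \<delta> z, B \<tau> z + \<Theta>' \<tau> z / \<delta> z))"
      using eta[OF z] by (intro sum.cong) auto
    then show ?thesis
      by (simp add: prod_eq_iff fst_sum snd_sum sum_subtractf sum.distrib sum_distrib_left sum_divide_distrib)
  qed
  have \<delta>_der: "(\<delta> has_derivative (\<lambda>(h, k). \<delta>p z * h + \<delta>q z * k)) (at z)" if "z \<in> V" for z
    unfolding \<delta>_def[abs_def] \<delta>p_def \<delta>q_def
    by (rule has_derivative_eq_rhs[OF has_derivative_diff[OF
          holomorphic2_on_has_derivative[OF hol that] holomorphic2_on_has_derivative[OF hol that]]])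
       (use d in \<open>auto simp: algebra_simps\<close>)
  note \<delta>_partials = partials_eqI[OF \<delta>_der]
  have U: "open {z \<in> V. \<delta> z \<noteq> 0}"
  proof -
    have "continuous_on V \<delta>"
      using holomorphic2_on_isCont[OF hol\<delta>(1)] continuous_at_imp_continuous_on by blast
    from continuous_open_preimage[OF this V(1), of "- {0}"] show ?thesis
      by (simp add: open_Compl Int_def vimage_def)
  qed
  have "(\<Sum>\<tau>\<in>T. \<Theta>' \<tau> z0) = 0"
  proof (rule closed_polar_form_residue[OF V, of "\<lambda>z. \<Sum>\<tau>\<in>T. \<Theta>' \<tau> z" \<delta> "x 0" "\<lambda>z. \<Sum>\<tau>\<in>T. A \<tau> z" "\<lambda>z. \<Sum>\<tau>\<in>T. B \<tau> z"])
    fix z assume z: "z \<in> V" "\<delta> z \<noteq> 0"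
    have "curvature d (slope_web x) z = 0"
      using flat z by (auto simp: \<delta>_def)
    moreover have "curvature d (slope_web x) z = ext_deriv (\<lambda>z. ((\<Sum>\<tau>\<in>T. A \<tau> z) - x 0 z * (\<Sum>\<tau>\<in>T. \<Theta>' \<tau> z) / \<delta> z,
          (\<Sum>\<tau>\<in>T. B \<tau> z) + (\<Sum>\<tau>\<in>T. \<Theta>' \<tau> z) / \<delta> z)) z"
      unfolding curvature_def
      by (rule ext_deriv_cong[OF U]) (use z sum in \<open>auto simp: T_def\<close>)
    ultimately show "ext_deriv (\<lambda>z. ((\<Sum>\<tau>\<in>T. A \<tau> z) - x 0 z * (\<Sum>\<tau>\<in>T. \<Theta>' \<tau> z) / \<delta> z,
          (\<Sum>\<tau>\<in>T. B \<tau> z) + (\<Sum>\<tau>\<in>T. \<Theta>' \<tau> z) / \<delta> z)) z = 0" by simp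
  next
    show "holomorphic2_on (partial_p \<delta>) V" "holomorphic2_on (partial_q \<delta>) V"
      by (rule holomorphic2_on_cong[OF hol\<delta>(2) V(1)], simp add: \<delta>_partials)
         (rule holomorphic2_on_cong[OF hol\<delta>(3) V(1)], simp add: \<delta>_partials)
    show "\<delta> z0 = 0" by (simp add: \<delta>_def meet)
    show "partial_p \<delta> z0 + x 0 z0 * partial_q \<delta> z0 \<noteq> 0"
      using transverse V by (simp add: \<delta>_partials \<delta>p_def \<delta>q_def)
  qed (use hol\<Theta>' holA holB hol\<delta>(1) hol d in \<open>auto intro: holomorphic2_on_sum\<close>)
  also have "(\<Sum>\<tau>\<in>T. \<Theta>' \<tau> z0) = (\<Sum>\<tau>\<in>(\<lambda>t. (0, 1, t)) ` {2..<d}. \<Theta>' \<tau> z0)"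
    by (rule sum.mono_neutral_right[OF finT]) (auto simp: T_def \<Theta>'_def image_iff)
  also have "\<dots> = (\<Sum>t = 2..<d. \<Theta> t z0)"
    by (subst sum.reindex) (auto simp: inj_on_def \<Theta>'_def)
  finally show ?thesis by (simp add: \<Theta>_def \<delta>p_def \<delta>q_def)
qed

section \<open>The dual web of the Fermat foliation\<close>

text \<open>
  On the line \<open>y = p x - q\<close> the Fermat form of degree \<open>n\<close> restricts to
  \<open>((p x - q)^n - p x^n + q) dx\<close>.
\<close>

definition tangency_poly :: "nat \<Rightarrow> complex \<Rightarrow> complex \<Rightarrow> complex poly" where
  "tangency_poly n p q = [:-q, p:] ^ n - monom p n + [:q:]"

lemma poly_tangency_poly: "poly (tangency_poly n p q) w = (p * w - q) ^ n - p * w ^ n + q"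
  by (simp add: tangency_poly_def poly_monom algebra_simps)

lemma poly_pderiv_tangency_poly:
  "poly (pderiv (tangency_poly n p q)) w = of_nat n * p * ((p * w - q) ^ (n - 1) - w ^ (n - 1))"
  by (simp add: tangency_poly_def pderiv_add pderiv_diff pderiv_power pderiv_monom poly_monom
      pderiv_pCons algebra_simps)

lemma poly_pderiv2_tangency_poly:
  "poly (pderiv (pderiv (tangency_poly n p q))) w =
     of_nat n * of_nat (n - 1) * p * (p * (p * w - q) ^ (n - 2) - w ^ (n - 2))"
  by (simp add: tangency_poly_def pderiv_add pderiv_diff pderiv_power pderiv_monom poly_monom
      pderiv_pCons pderiv_smult pderiv_mult algebra_simps numeral_2_eq_2)

text \<open>\<open>p ^ n = p\<close> means that the point at infinity \<open>(1 : p : 0)\<close> of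
  the line is singular, so that a tangency has escaped from the chart. Otherwise all
  \<open>n\<close> tangencies, counted with multiplicity, are affine.\<close>

lemma lead_coeff_tangency_poly:
  assumes "n \<ge> 2" "p ^ n \<noteq> p"
  shows "degree (tangency_poly n p q) = n" "lead_coeff (tangency_poly n p q) = p ^ n - p"
proof -
  have c: "coeff (tangency_poly n p q) n = p ^ n - p"
    using assms by (simp add: tangency_poly_def coeff_linear_poly_power coeff_pCons split: nat.split)
  have "degree (tangency_poly n p q) \<le> n"
    unfolding tangency_poly_def
  proof (intro degree_add_le degree_diff_le)
    show "degree ([:- q, p:] ^ n) \<le> n"
      using degree_power_le[of "[:-q, p:]" n] by (auto intro: order_trans split: if_splits)
  qed (auto simp: degree_monom_le)
  moreover have "degree (tangency_poly n p q) \<ge> n"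
    using c assms by (intro le_degree) simp
  ultimately show "degree (tangency_poly n p q) = n" by simp
  with c show "lead_coeff (tangency_poly n p q) = p ^ n - p" by simp
qed

text \<open>At a multiple root \<open>w\<close>, with \<open>u = p w - q\<close>, the derivative
  gives \<open>u^(n - 1) = w^(n - 1)\<close>, and the equation becomes
  \<open>(u - p w) (w^(n - 1) - 1) = 0\<close>. Since \<open>u - p w = - q\<close> is nonzero,
  \<open>(w, u)\<close> is one of the radial singularities that \<open>sing\<close> keeps off the
  line \<open>y = p x - q\<close>.\<close>

lemma tangency_poly_simple_root:
  assumes n: "n \<ge> 2" and p: "p ^ n \<noteq> p" and q: "q \<noteq> 0"
    and sing: "\<And>\<xi> \<zeta>. \<xi> ^ (n - 1) = 1 \<Longrightarrow> \<zeta> ^ (n - 1) = 1 \<Longrightarrow> p * \<xi> - q \<noteq> \<zeta>"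
    and root: "poly (tangency_poly n p q) w = 0"
  shows "poly (pderiv (tangency_poly n p q)) w \<noteq> 0"
proof
  assume "poly (pderiv (tangency_poly n p q)) w = 0"
  moreover have "p \<noteq> 0" using p n by (auto simp: power_0_left)
  ultimately have e: "(p * w - q) ^ (n - 1) = w ^ (n - 1)"
    using n by (simp add: poly_pderiv_tangency_poly)
  define u where "u = p * w - q"
  have n': "n = Suc (n - 1)" using n by simp
  have pw: "z ^ n = z * z ^ (n - 1)" for z :: complex
    by (subst n') (simp only: power_Suc)
  have "w \<noteq> 0"
    using e q n by (auto simp: power_0_left)
  have "u * w ^ (n - 1) - p * (w * w ^ (n - 1)) + (p * w - u) = 0"
    using root e unfolding poly_tangency_poly pw by (simp add: u_def)
  then have "(u - p * w) * (w ^ (n - 1) - 1) = 0"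
    by (simp add: algebra_simps)
  then consider "u = p * w" | "w ^ (n - 1) = 1" by auto
  then show False
  proof cases
    case 1
    then show ?thesis using q by (simp add: u_def)
  next
    case 2
    then show ?thesis using sing[of w u] e by (simp add: u_def)
  qed
qed

section \<open>Numbering the roots, summing over the unknown ones, and following them
  holomorphically\<close>

lemma prod_roots_unique:
  fixes P :: "complex poly"
  assumes root: "\<And>i. i \<in> I \<Longrightarrow> poly P (r i) = 0" and inj: "inj_on r I" and I: "finite I" "card I = degree P"
    and P: "P \<noteq> 0"
  shows "P = smult (lead_coeff P) (\<Prod>i\<in>I. [:- r i, 1:])"
proof -
  have "(\<Prod>i\<in>I. [:- r i, 1:]) dvd P"
    using I(1) root inj P
  proof (induction I arbitrary: P rule: finite_induct)
    case (insert j I)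
    then obtain Q where Q: "P = [:- r j, 1:] * Q"
      by (metis dvdE insertI1 poly_eq_0_iff_dvd)
    have "poly Q (r i) = 0" if "i \<in> I" for i
      using insert.prems(1)[of i] insert.prems(2) insert.hyps that
      by (auto simp: Q inj_on_def algebra_simps)
    then have "(\<Prod>i\<in>I. [:- r i, 1:]) dvd Q"
      using insert.prems Q by (intro insert.IH) auto
    then show ?case using insert.hyps by (simp add: Q mult_dvd_mono del: mult_pCons_left)
  qed simp
  then obtain Q where Q: "P = (\<Prod>i\<in>I. [:- r i, 1:]) * Q" by (rule dvdE)
  have "degree P = degree (\<Prod>i\<in>I. [:- r i, 1:]) + degree Q"
    unfolding Q using P Q by (intro degree_mult_eq) auto
  moreover have "degree (\<Prod>i\<in>I. [:- r i, 1:]) = card I"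
    by (subst degree_prod_eq_sum_degree) auto
  ultimately have "degree Q = 0" using I by simp
  then obtain k where k: "Q = [:k:]" by (auto elim: degree_eq_zeroE)
  have "lead_coeff (\<Prod>i\<in>I. [:- r i, 1:]) = 1"
    unfolding lead_coeff_prod by simp
  moreover have "lead_coeff P = lead_coeff (\<Prod>i\<in>I. [:- r i, 1:]) * lead_coeff Q"
    unfolding Q by (rule lead_coeff_mult)
  moreover have "lead_coeff Q = k" by (simp add: k)
  ultimately have L: "lead_coeff P = k" by simp
  show ?thesis
    unfolding L using Q by (simp add: k)
qed

text \<open>Write \<open>P = c (X - r\<^sub>j) H\<close>. Then
  \<open>P'(r\<^sub>j) = c H(r\<^sub>j)\<close> and
  \<open>P''(r\<^sub>j) = 2 c H'(r\<^sub>j)\<close>, and the sum is minus the logarithmic derivative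
  of \<open>H\<close> at \<open>r\<^sub>j\<close>. This eliminates the roots about which nothing
  explicit is known.\<close>

lemma sum_inverse_root_differences:
  fixes P :: "complex poly"
  assumes P: "P = smult c (\<Prod>i\<in>I. [:- r i, 1:])" and I: "finite I" "j \<in> I"
    and ne: "\<And>i. i \<in> I - {j} \<Longrightarrow> r i \<noteq> r j"
  shows "poly (pderiv (pderiv P)) (r j) = - 2 * poly (pderiv P) (r j) * (\<Sum>i\<in>I - {j}. 1 / (r i - r j))"
proof -
  define H where "H = (\<Prod>i\<in>I - {j}. [:- r i, 1:])"
  have P': "P = smult c ([:- r j, 1:] * H)"
    unfolding P H_def using prod.remove[OF I] by metis
  have 1: "poly (pderiv P) (r j) = c * poly H (r j)"
    unfolding P' by (simp add: pderiv_smult pderiv_mult pderiv_pCons del: mult_pCons_left)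
  have 2: "poly (pderiv (pderiv P)) (r j) = 2 * c * poly (pderiv H) (r j)"
    unfolding P' by (simp add: pderiv_smult pderiv_mult pderiv_add pderiv_pCons del: mult_pCons_left)
  have "poly (pderiv H) (r j) = (\<Sum>i\<in>I - {j}. \<Prod>k\<in>I - {j} - {i}. r j - r k)"
    unfolding H_def by (simp add: pderiv_prod poly_sum poly_prod pderiv_pCons)
  also have "\<dots> = (\<Sum>i\<in>I - {j}. poly H (r j) * (- (1 / (r i - r j))))"
  proof (rule sum.cong[OF refl])
    fix i assume i: "i \<in> I - {j}"
    have "poly H (r j) = (r j - r i) * (\<Prod>k\<in>I - {j} - {i}. r j - r k)"
      unfolding H_def using prod.remove[OF _ i, of "\<lambda>k. r j - r k"] I by (simp add: poly_prod)
    then show "(\<Prod>k\<in>I - {j} - {i}. r j - r k) = poly H (r j) * (- (1 / (r i - r j)))"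
      using ne[OF i] by (simp add: field_simps)
  qed
  also have "\<dots> = - poly H (r j) * (\<Sum>i\<in>I - {j}. 1 / (r i - r j))"
    by (simp add: sum_distrib_left sum_negf)
  finally show ?thesis unfolding 1 2 by simp
qed

text \<open>Since all roots are simple, there are \<open>n\<close> distinct ones. The known tangency
  \<open>w\<close> gets index 1 because index 0 is reserved for the slope contributed by the
  line.\<close>

lemma tangency_poly_roots_enum:
  assumes n: "n \<ge> 2" and p: "p ^ n \<noteq> p" and q: "q \<noteq> 0"
    and sing: "\<And>\<xi> \<zeta>. \<xi> ^ (n - 1) = 1 \<Longrightarrow> \<zeta> ^ (n - 1) = 1 \<Longrightarrow> p * \<xi> - q \<noteq> \<zeta>"
    and root: "poly (tangency_poly n p q) w = 0"
  obtains r where "r 1 = w" "inj_on r {1..n}" "\<And>i. i \<in> {1..n} \<Longrightarrow> poly (tangency_poly n p q) (r i) = 0"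
proof -
  define P where "P = tangency_poly n p q"
  have P: "degree P = n" "P \<noteq> 0" "rsquarefree P"
    using lead_coeff_tangency_poly[OF n p, of q] tangency_poly_simple_root[OF n p q sing] p
    by (auto simp: P_def rsquarefree_roots)
  define R where "R = {z. poly P z = 0}"
  have "P = smult (lead_coeff P) (\<Prod>z\<in>R. [:- z, 1:])"
    unfolding R_def using complex_poly_decompose_rsquarefree[OF P(3)] by simp
  then have "degree P = degree (\<Prod>z\<in>R. [:- z, 1:])"
    using P by (metis degree_smult_eq leading_coeff_0_iff)
  also have "\<dots> = card R"
    by (subst degree_prod_eq_sum_degree) auto
  finally have cR: "card R = n" using P by simp
  have fR: "finite R" unfolding R_def by (rule poly_roots_finite[OF P(2)])
  have wR: "w \<in> R" using root by (simp add: R_def P_def)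
  have "card {2..n} = card (R - {w})" using cR fR wR n by (simp add: card_Diff_singleton)
  then obtain h where h: "bij_betw h {2..n} (R - {w})"
    using finite_same_card_bij[of "{2..n}" "R - {w}"] fR by auto
  have I: "{1..n} = insert 1 {2..n}" using n by auto
  have hR: "h i \<in> R - {w}" if "i \<in> {2..n}" for i using h that by (auto simp: bij_betw_def)
  show ?thesis
  proof (rule that[of "h(1 := w)"])
    show "inj_on (h(1 := w)) {1..n}"
      using h hR unfolding I bij_betw_def inj_on_def by (auto split: if_splits)
    show "poly (tangency_poly n p q) ((h(1 := w)) i) = 0" if "i \<in> {1..n}" for i
      using that wR hR[of i] by (auto simp: R_def P_def)
  qed simp
qed

text \<open>The implicit function theorem at a simple root; the numerators come from the partial
  derivatives of \<open>(p x - q)^n - p x^n + q\<close> in \<open>p\<close> and in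
  \<open>q\<close>.\<close>

lemma tangency_root_implicit:
  assumes "poly (tangency_poly n p q) w = 0" "poly (pderiv (tangency_poly n p q)) w \<noteq> 0"
  obtains V \<xi> where "open V" "(p, q) \<in> V" "\<xi> (p, q) = w"
    "\<And>z. z \<in> V \<Longrightarrow> poly (tangency_poly n (fst z) (snd z)) (\<xi> z) = 0"
    "\<And>z. z \<in> V \<Longrightarrow> poly (pderiv (tangency_poly n (fst z) (snd z))) (\<xi> z) \<noteq> 0"
    "\<And>z. z \<in> V \<Longrightarrow> (\<xi> has_derivative (\<lambda>(h, k).
       - (of_nat n * \<xi> z * (fst z * \<xi> z - snd z) ^ (n - 1) - \<xi> z ^ n) /
          poly (pderiv (tangency_poly n (fst z) (snd z))) (\<xi> z) * h
       + - (1 - of_nat n * (fst z * \<xi> z - snd z) ^ (n - 1)) /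
          poly (pderiv (tangency_poly n (fst z) (snd z))) (\<xi> z) * k)) (at z)"
proof -
  define f where "f v = (fst (fst v) * snd v - snd (fst v)) ^ n - fst (fst v) * snd v ^ n + snd (fst v)"
    for v :: "(complex \<times> complex) \<times> complex"
  define fp where "fp v = of_nat n * snd v * (fst (fst v) * snd v - snd (fst v)) ^ (n - 1) - snd v ^ n"
    for v :: "(complex \<times> complex) \<times> complex"
  define fq where "fq v = 1 - of_nat n * (fst (fst v) * snd v - snd (fst v)) ^ (n - 1)"
    for v :: "(complex \<times> complex) \<times> complex"
  define fx where "fx v = of_nat n * fst (fst v) * ((fst (fst v) * snd v - snd (fst v)) ^ (n - 1) - snd v ^ (n - 1))"
    for v :: "(complex \<times> complex) \<times> complex"
  have der: "(f has_derivative (\<lambda>((h, k), l). fp v * h + fq v * k + fx v * l)) (at v)" for v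
    unfolding f_def[abs_def]
    by (rule has_derivative_eq_rhs, (rule derivative_intros)+)
       (auto simp: fp_def fq_def fx_def algebra_simps)
  have cont: "continuous_on UNIV fp" "continuous_on UNIV fq" "continuous_on UNIV fx"
    unfolding fp_def[abs_def] fq_def[abs_def] fx_def[abs_def] by (intro continuous_intros)+
  have "f ((p, q), w) = 0" "fx ((p, q), w) \<noteq> 0"
    using assms by (simp_all add: f_def fx_def poly_tangency_poly poly_pderiv_tangency_poly)
  then obtain V \<xi> where V: "open V" "(p, q) \<in> V" "\<xi> (p, q) = w"
    and \<xi>: "\<And>z. z \<in> V \<Longrightarrow> f (z, \<xi> z) = 0" "\<And>z. z \<in> V \<Longrightarrow> fx (z, \<xi> z) \<noteq> 0"
      "\<And>z. z \<in> V \<Longrightarrow> (\<xi> has_derivative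
       (\<lambda>(h, k). - fp (z, \<xi> z) / fx (z, \<xi> z) * h + - fq (z, \<xi> z) / fx (z, \<xi> z) * k)) (at z)"
    by (rule holomorphic_implicit_function[OF der cont]) blast
  have f: "poly (tangency_poly n (fst z) (snd z)) u = f (z, u)"
     "poly (pderiv (tangency_poly n (fst z) (snd z))) u = fx (z, u)" for z u
    by (simp_all add: poly_tangency_poly poly_pderiv_tangency_poly f_def fx_def)
  show ?thesis
    by (rule that[of V \<xi>]) (use V \<xi> in \<open>simp_all add: f fp_def fq_def\<close>)
qed

lemma legendre_fermat:
  "legendre (vector [a, b, c]) (fermat_form n) (p, q) w =
     ((a + b * p) * w + (c - b * q)) * poly (tangency_poly n p q) w"
  by (simp add: legendre_def fermat_form_def pairing_def sum_3 poly_tangency_poly Let_def algebra_simps)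

text \<open>
  The barycenter condition on the curve of tangents to the foliation at the points of the line,
  written at the tangent \<open>y = p x - q\<close> at the point with abscissa \<open>w\<close>.
\<close>

lemma flat_tangency_condition:
  fixes a b c p q w :: complex
  assumes n: "n \<ge> 2" and flat: "flat_web (Suc n) (legendre (vector [a, b, c]) (fermat_form n))"
    and p: "p ^ n \<noteq> p" and q: "q \<noteq> 0"
    and sing: "\<And>\<xi> \<zeta>. \<xi> ^ (n - 1) = 1 \<Longrightarrow> \<zeta> ^ (n - 1) = 1 \<Longrightarrow> p * \<xi> - q \<noteq> \<zeta>"
    and root: "poly (tangency_poly n p q) w = 0"
    and on: "(a + b * p) * w + (c - b * q) = 0" and tr: "a + b * p \<noteq> 0" and w: "w ^ n \<noteq> w"
  defines "g \<equiv> poly (pderiv (tangency_poly n p q)) w"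
  shows "(w - w ^ n) * poly (pderiv (pderiv (tangency_poly n p q))) w * (a + b * p) =
    2 * of_nat (n - 1) * g * ((1 - of_nat n * (p * w - q) ^ (n - 1)) * (a + b * p) + b * g)"
proof -
  define P where "P z = tangency_poly n (fst z) (snd z)" for z
  define z0 where "z0 = (p, q)"
  obtain r where r: "r 1 = w" "inj_on r {1..n}" "\<And>i. i \<in> {1..n} \<Longrightarrow> poly (P z0) (r i) = 0"
    using tangency_poly_roots_enum[OF n p q sing root] by (auto simp: P_def z0_def)
  define Dp where "Dp u z = - (of_nat n * u * (fst z * u - snd z) ^ (n - 1) - u ^ n) / poly (pderiv (P z)) u"
    for u z
  define Dq where "Dq u z = - (1 - of_nat n * (fst z * u - snd z) ^ (n - 1)) / poly (pderiv (P z)) u"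
    for u z
  define Q where "Q i V \<xi> \<longleftrightarrow> open V \<and> z0 \<in> V \<and> \<xi> z0 = r i \<and> (\<forall>z\<in>V. poly (P z) (\<xi> z) = 0 \<and>
      poly (pderiv (P z)) (\<xi> z) \<noteq> 0 \<and>
      (\<xi> has_derivative (\<lambda>(h, k). Dp (\<xi> z) z * h + Dq (\<xi> z) z * k)) (at z))" for i V \<xi>
  have "\<exists>V \<xi>. Q i V \<xi>" if i: "i \<in> {1..n}" for i
  proof -
    have 1: "poly (tangency_poly n p q) (r i) = 0" using r(3)[OF i] by (simp add: P_def z0_def)
    then have "poly (pderiv (tangency_poly n p q)) (r i) \<noteq> 0"
      using tangency_poly_simple_root[OF n p q sing] by blast
    from 1 this show ?thesis
    proof (rule tangency_root_implicit)
      fix V \<xi>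
      assume *: "open V" "(p, q) \<in> V" "\<xi> (p, q) = r i"
        "\<And>z. z \<in> V \<Longrightarrow> poly (tangency_poly n (fst z) (snd z)) (\<xi> z) = 0"
        "\<And>z. z \<in> V \<Longrightarrow> poly (pderiv (tangency_poly n (fst z) (snd z))) (\<xi> z) \<noteq> 0"
        "\<And>z. z \<in> V \<Longrightarrow> (\<xi> has_derivative (\<lambda>(h, k).
          - (of_nat n * \<xi> z * (fst z * \<xi> z - snd z) ^ (n - 1) - \<xi> z ^ n) /
            poly (pderiv (tangency_poly n (fst z) (snd z))) (\<xi> z) * h
          + - (1 - of_nat n * (fst z * \<xi> z - snd z) ^ (n - 1)) /
            poly (pderiv (tangency_poly n (fst z) (snd z))) (\<xi> z) * k)) (at z)"
      show ?thesis
        unfolding Q_def z0_def P_def Dp_def Dq_def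
        by (intro exI[of _ V] exI[of _ \<xi>] conjI ballI; rule *; assumption?)
    qed
  qed
  then obtain V \<xi> where "\<And>i. i \<in> {1..n} \<Longrightarrow> Q i (V i) (\<xi> i)"
    by metis
  then have V: "\<And>i. i \<in> {1..n} \<Longrightarrow> open (V i)" "\<And>i. i \<in> {1..n} \<Longrightarrow> z0 \<in> V i"
    and \<xi>0: "\<And>i. i \<in> {1..n} \<Longrightarrow> \<xi> i z0 = r i"
    and \<xi>: "\<And>i z. i \<in> {1..n} \<Longrightarrow> z \<in> V i \<Longrightarrow> poly (P z) (\<xi> i z) = 0"
       "\<And>i z. i \<in> {1..n} \<Longrightarrow> z \<in> V i \<Longrightarrow> poly (pderiv (P z)) (\<xi> i z) \<noteq> 0"
       "\<And>i z. i \<in> {1..n} \<Longrightarrow> z \<in> V i \<Longrightarrow>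
          (\<xi> i has_derivative (\<lambda>(h, k). Dp (\<xi> i z) z * h + Dq (\<xi> i z) z * k)) (at z)"
    unfolding Q_def by blast+
  \<comment> \<open>Slope 0 is the solution \<open>x\<close> of
    \<open>(a + b p) x + (c - b q) = 0\<close>, the equation of the line restricted to
    \<open>y = p x - q\<close>.\<close>
  define x where "x i z = (if i = 0 then (b * snd z - c) / (a + b * fst z) else \<xi> i z)" for i z
  have x0z0: "x 0 z0 = w"
    using on tr by (simp add: x_def z0_def field_simps)
  have xz0: "x i z0 = r i" if "i \<in> {1..n}" for i
    using \<xi>0[OF that] that by (simp add: x_def)
  \<comment> \<open>Open conditions that hold at \<open>z0\<close>. As \<open>j\<close> starts at 2,
    the pair \<open>(0, 1)\<close> is the only one exempted: these two slopes coincide at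
    \<open>z0\<close>.\<close>
  define good where "good z \<longleftrightarrow> (\<forall>i\<in>{1..n}. z \<in> V i) \<and> fst z ^ n - fst z \<noteq> 0 \<and> a + b * fst z \<noteq> 0 \<and>
    (\<forall>j\<in>{2..n}. \<forall>i\<in>{..<j}. x i z - x j z \<noteq> 0)" for z
  have cont\<xi>: "(\<xi> i \<longlongrightarrow> \<xi> i z0) (nhds z0)" if "i \<in> {1..n}" for i
    using has_derivative_continuous[OF \<xi>(3)[OF that V(2)[OF that]]]
    by (simp add: isCont_def tendsto_at_iff_tendsto_nhds)
  have tfs: "(fst \<longlongrightarrow> p) (nhds (p, q))" "(snd \<longlongrightarrow> q) (nhds (p, q))"
    using tendsto_fst[OF filterlim_ident, of "(p, q)"] tendsto_snd[OF filterlim_ident, of "(p, q)"]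
    by (auto simp: id_def)
  have contx: "(x i \<longlongrightarrow> x i z0) (nhds z0)" if "i \<le> n" for i
  proof (cases "i = 0")
    case True
    then show ?thesis
      unfolding x_def[abs_def] using tr
      by (auto simp: z0_def intro!: tendsto_intros tfs)
  next
    case False
    with that show ?thesis using cont\<xi>[of i] by (simp add: x_def[abs_def])
  qed
  have ne0: "x i z0 - x j z0 \<noteq> 0" if "j \<in> {2..n}" "i \<in> {..<j}" for i j
  proof -
    define k where "k = (if i = 0 then 1 else i)"
    have k: "k \<in> {1..n}" "j \<in> {1..n}" "k \<noteq> j" using that by (auto simp: k_def)
    have "x i z0 = r k" using x0z0 r(1) xz0[OF k(1)] by (cases "i = 0") (auto simp: k_def)
    then show ?thesis using xz0[OF k(2)] inj_onD[OF r(2) _ k(1,2)] k(3) by auto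
  qed
  have nz: "eventually (\<lambda>z. f z \<noteq> 0) (nhds z0)" if "(f \<longlongrightarrow> f z0) (nhds z0)" "f z0 \<noteq> 0"
    for f :: "complex \<times> complex \<Rightarrow> complex"
    using tendsto_imp_eventually_ne[OF that] .
  have "eventually good (nhds z0)"
    unfolding good_def
  proof (intro eventually_conj eventually_ball_finite ballI finite_atLeastAtMost finite_lessThan)
    show "eventually (\<lambda>z. z \<in> V i) (nhds z0)" if "i \<in> {1..n}" for i
      using V[OF that] by (rule eventually_nhds_in_open)
    show "eventually (\<lambda>z. fst z ^ n - fst z \<noteq> 0) (nhds z0)"
      by (rule nz) (use p in \<open>simp_all add: z0_def tendsto_intros tfs\<close>)
    show "eventually (\<lambda>z. a + b * fst z \<noteq> 0) (nhds z0)"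
      by (rule nz) (use tr in \<open>simp_all add: z0_def tendsto_intros tfs\<close>)
    show "eventually (\<lambda>z. x i z - x j z \<noteq> 0) (nhds z0)" if "j \<in> {2..n}" "i \<in> {..<j}" for i j
      using that by (intro nz ne0 tendsto_diff contx) auto
  qed
  then obtain W where W: "open W" "z0 \<in> W" "\<And>z. z \<in> W \<Longrightarrow> good z"
    unfolding eventually_nhds by blast
  have WV: "z \<in> V i" if "z \<in> W" "i \<in> {1..n}" for z i
    using W(3)[OF that(1)] that by (auto simp: good_def)
  have W1: "fst z ^ n \<noteq> fst z" "a + b * fst z \<noteq> 0" if "z \<in> W" for z
    using W(3)[OF that] by (auto simp: good_def)
  have ne: "x i z \<noteq> x j z" if "z \<in> W" "i < j" "j < Suc n" "(i, j) \<noteq> (0, 1)" for z i j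
  proof -
    have "j \<in> {2..n}" using that by auto
    with W(3)[OF that(1)] that show ?thesis by (auto simp: good_def)
  qed
  have x0_der: "(x 0 has_derivative (\<lambda>(h, k). - b * x 0 z / (a + b * fst z) * h + b / (a + b * fst z) * k)) (at z)"
    if "z \<in> W" for z
  proof -
    define m where "m = a + b * fst z"
    have m: "m \<noteq> 0" "b * snd z - c = x 0 z * m"
      using W1(2)[OF that] by (simp_all add: m_def x_def)
    have "((\<lambda>z. b * snd z - c) has_derivative (\<lambda>h. b * snd h)) (at z)"
         "((\<lambda>z. a + b * fst z) has_derivative (\<lambda>h. b * fst h)) (at z)"
      by (rule has_derivative_eq_rhs, (rule derivative_intros)+, simp)+
    from has_derivative_divide'[OF this W1(2)[OF that], folded m_def, unfolded m(2)]
    have "((\<lambda>z. (b * snd z - c) / (a + b * fst z)) has_derivative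
      (\<lambda>h. (b * snd h * m - x 0 z * m * (b * fst h)) / (m * m))) (at z)" .
    moreover have "(\<lambda>h. (b * snd h * m - x 0 z * m * (b * fst h)) / (m * m)) =
      (\<lambda>(h, k). - b * x 0 z / (a + b * fst z) * h + b / (a + b * fst z) * k)"
      using m(1) unfolding m_def[symmetric] by (auto simp: field_simps)
    ultimately have "((\<lambda>z. (b * snd z - c) / (a + b * fst z)) has_derivative
      (\<lambda>(h, k). - b * x 0 z / (a + b * fst z) * h + b / (a + b * fst z) * k)) (at z)"
      by simp
    then show ?thesis by (simp add: x_def[abs_def])
  qed
  have xi_der: "(x i has_derivative (\<lambda>(h, k). Dp (x i z) z * h + Dq (x i z) z * k)) (at z)"
    if "z \<in> W" "i \<in> {1..n}" for z i
    using \<xi>(3)[OF that(2) WV[OF that]] that by (simp add: x_def[abs_def])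
  have hol: "holomorphic2_on (x i) W" if "i < Suc n" for i
  proof (cases "i = 0")
    case True
    have "holomorphic2_on (x 0) W" by (rule holomorphic2_onI[OF x0_der])
    with True show ?thesis by simp
  next
    case False with that show ?thesis
      by (intro holomorphic2_onI[of _ _ "\<lambda>z. Dp (x i z) z" "\<lambda>z. Dq (x i z) z"] xi_der) auto
  qed
  have holp: "holomorphic2_on (partial_p (x i)) W" and holq: "holomorphic2_on (partial_q (x i)) W"
    if "i < Suc n" for i
  proof -
    have "holomorphic2_on (partial_p (x i)) W \<and> holomorphic2_on (partial_q (x i)) W"
    proof (cases "i = 0")
      case True
      have "holomorphic2_on (\<lambda>z. - b * x 0 z / (a + b * fst z)) W" "holomorphic2_on (\<lambda>z. b / (a + b * fst z)) W"
        using W1 by (intro holomorphic2_intros hol; simp)+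
      then show ?thesis
        using True holomorphic2_on_cong[OF _ W(1)] partials_eqI[OF x0_der] by auto
    next
      case False
      then have i: "i \<in> {1..n}" using that by auto
      have "poly (pderiv (P z)) (x i z) \<noteq> 0" if "z \<in> W" for z
        using \<xi>(2)[OF i WV[OF that i]] i by (simp add: x_def)
      then have "holomorphic2_on (\<lambda>z. Dp (x i z) z) W" "holomorphic2_on (\<lambda>z. Dq (x i z) z) W"
        unfolding Dp_def Dq_def P_def poly_pderiv_tangency_poly
        using hol[OF \<open>i < Suc n\<close>] by (intro holomorphic2_intros; simp)+
      then show ?thesis
        using holomorphic2_on_cong[OF _ W(1)] partials_eqI[OF xi_der[OF _ i]] by auto
    qed
    then show "holomorphic2_on (partial_p (x i)) W" "holomorphic2_on (partial_q (x i)) W" by auto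
  qed
  have factor: "P z = smult (fst z ^ n - fst z) (\<Prod>i\<in>{1..n}. [:- x i z, 1:])" if z: "z \<in> W" for z
  proof -
    note L = lead_coeff_tangency_poly[OF n W1(1)[OF z], of "snd z", folded P_def]
    have "P z = smult (lead_coeff (P z)) (\<Prod>i\<in>{1..n}. [:- x i z, 1:])"
    proof (rule prod_roots_unique)
      show "poly (P z) (x i z) = 0" if "i \<in> {1..n}" for i
        using \<xi>(1)[OF that WV[OF z that]] that by (simp add: x_def)
      show "inj_on (\<lambda>i. x i z) {1..n}"
        using ne[OF z] by (intro linorder_inj_onI) auto
      show "P z \<noteq> 0" using L W1(1)[OF z] by auto
    qed (simp_all add: L)
    then show ?thesis by (simp only: L(2))
  qed
  \<comment> \<open>Flatness speaks only of decomposed webs, so it is applied on the complement of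
    the curve \<open>x\<^sub>0 = x\<^sub>1\<close> in \<open>W\<close>.\<close>
  have curv: "curvature (Suc n) (slope_web x) z = 0" if z: "z \<in> W" "x 0 z \<noteq> x 1 z" for z
  proof -
    define U where "U = {z \<in> W. x 0 z - x 1 z \<noteq> 0}"
    have "open U"
    proof -
      have "holomorphic2_on (\<lambda>z. x 0 z - x 1 z) W"
        using n by (intro holomorphic2_intros hol) auto
      then have "continuous_on W (\<lambda>z. x 0 z - x 1 z)"
        using holomorphic2_on_isCont continuous_at_imp_continuous_on by blast
      from continuous_open_preimage[OF this W(1), of "- {0}"] show ?thesis
        by (simp add: U_def Int_def open_Compl)
    qed
    have UW: "U \<subseteq> W" by (auto simp: U_def)
    have dec: "local_decomposition (Suc n) (legendre (vector [a, b, c]) (fermat_form n)) U (slope_web x)"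
      unfolding local_decomposition_def slope_web_def fst_conv snd_conv
    proof (intro conjI ballI allI impI \<open>open U\<close>)
      show "holomorphic2_on (\<lambda>z. - x i z) U" if "i < Suc n" for i
        using hol[OF that] UW by (intro holomorphic2_on_minus) (rule holomorphic2_on_subset)
      show "holomorphic2_on (\<lambda>z. 1) U" by (rule holomorphic2_on_const)
      show "wedge (- x i z, 1) (- x j z, 1) \<noteq> 0"
        if "z \<in> U" "i < Suc n" "j < Suc n" "i \<noteq> j" for z i j
      proof -
        have "x i z \<noteq> x j z" if "i < j" "j < Suc n" for i j
          using ne[of z i j] that \<open>z \<in> U\<close> by (cases "(i, j) = (0, 1)") (auto simp: U_def)
        then have "x i z \<noteq> x j z" using that by (metis nat_neq_iff)
        then show ?thesis by (simp add: wedge_def)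
      qed
      show "\<exists>k. k \<noteq> 0 \<and> (\<forall>u. legendre (vector [a, b, c]) (fermat_form n) z u = k * (\<Prod>i<Suc n. - x i z + 1 * u))"
        if "z \<in> U" for z
      proof (intro exI conjI allI)
        have z: "z \<in> W" using that UW by blast
        show "(a + b * fst z) * (fst z ^ n - fst z) \<noteq> 0" using W1[OF z] by simp
        fix u
        have "legendre (vector [a, b, c]) (fermat_form n) (fst z, snd z) u =
          ((a + b * fst z) * u + (c - b * snd z)) * poly (P z) u"
          unfolding legendre_fermat P_def ..
        also have "poly (P z) u = (fst z ^ n - fst z) * (\<Prod>i<n. - x (Suc i) z + u)"
          by (subst factor[OF z])
             (simp add: poly_prod prod.atLeast1_atMost_eq)
        also have "(a + b * fst z) * u + (c - b * snd z) = (a + b * fst z) * (- x 0 z + u)"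
          using W1(2)[OF z] by (simp add: x_def field_simps)
        finally show "legendre (vector [a, b, c]) (fermat_form n) z u =
          (a + b * fst z) * (fst z ^ n - fst z) * (\<Prod>i<Suc n. - x i z + 1 * u)"
          by (simp add: prod.lessThan_Suc_shift del: prod.lessThan_Suc)
      qed
    qed
    then show ?thesis
      using flat z unfolding flat_web_def by (auto simp: U_def)
  qed
  have one: "1 \<in> {1..n}" using n by simp
  have x1z0: "x 1 z0 = w" using xz0[OF one] r(1) by simp
  note d0 = partials_eqI[OF x0_der[OF W(2)]] and d1 = partials_eqI[OF xi_der[OF W(2) one]]
  have g: "g \<noteq> 0" using tangency_poly_simple_root[OF n p q sing root] by (simp add: g_def)
  define s where "s = (\<Sum>t = 2..<Suc n. 1 / (x t z0 - w))"
  define \<delta>q where "\<delta>q = partial_q (x 1) z0 - partial_q (x 0) z0"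
  define X where "X = partial_p (x 1) z0 - partial_p (x 0) z0 + w * \<delta>q"
  have \<delta>q: "\<delta>q = - (1 - of_nat n * (p * w - q) ^ (n - 1)) / g - b / (a + b * p)"
    unfolding \<delta>q_def d0 d1 x1z0 by (simp add: Dq_def z0_def P_def g_def)
  \<comment> \<open>\<open>X\<close> is the derivative of \<open>x\<^sub>1 - x\<^sub>0\<close> along
    \<open>\<partial>\<^sub>p + w \<partial>\<^sub>q\<close>. The slope \<open>x\<^sub>0\<close> is
    constant along the leaves of its own pencil and contributes nothing; for
    \<open>x\<^sub>1\<close> the terms with \<open>(p w - q)^(n - 1)\<close> cancel, which leaves
    the numerator \<open>w - w^n\<close>.\<close>
  have X: "X = - (w - w ^ n) / g"
  proof -
    have "X = Dp w z0 + w * Dq w z0"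
      unfolding X_def \<delta>q_def d0 d1 x1z0 x0z0 by (simp add: algebra_simps)
    also have "\<dots> = (- (of_nat n * w * (p * w - q) ^ (n - 1) - w ^ n) + w * (- (1 - of_nat n * (p * w - q) ^ (n - 1)))) / g"
      by (simp only: Dp_def Dq_def z0_def P_def g_def fst_conv snd_conv times_divide_eq_right add_divide_distrib)
    finally show ?thesis by (simp add: algebra_simps)
  qed
  have "(\<Sum>t = 2..<Suc n. (partial_p (x 1) z0 - partial_p (x 0) z0
      + x t z0 * (partial_q (x 1) z0 - partial_q (x 0) z0)) / (x t z0 - x 0 z0)) = 0"
  proof (rule flat_barycenter[OF W(1,2) _ hol holp holq ne _ _ curv])
    show "partial_p (x 1) z0 - partial_p (x 0) z0 + x 0 z0 * (partial_q (x 1) z0 - partial_q (x 0) z0) \<noteq> 0"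
      using X w g unfolding X_def \<delta>q_def x0z0 by simp
  qed (use n x0z0 x1z0 in auto)
  \<comment> \<open>Split \<open>x\<^sub>t = w + (x\<^sub>t - w)\<close> in the numerator: the part
    with \<open>w\<close> gives \<open>X\<close>, and the rest cancels the denominator.\<close>
  also have "(\<Sum>t = 2..<Suc n. (partial_p (x 1) z0 - partial_p (x 0) z0
      + x t z0 * (partial_q (x 1) z0 - partial_q (x 0) z0)) / (x t z0 - x 0 z0)) =
     (\<Sum>t = 2..<Suc n. X * (1 / (x t z0 - w)) + \<delta>q)"
  proof (rule sum.cong[OF refl])
    fix t assume "t \<in> {2..<Suc n}"
    then have "x t z0 - w \<noteq> 0" using ne0[of t 0] x0z0 by auto
    then show "(partial_p (x 1) z0 - partial_p (x 0) z0
      + x t z0 * (partial_q (x 1) z0 - partial_q (x 0) z0)) / (x t z0 - x 0 z0) = X * (1 / (x t z0 - w)) + \<delta>q"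
      unfolding X_def \<delta>q_def[symmetric] x0z0 by (simp add: field_simps)
  qed
  also have "\<dots> = X * s + of_nat (n - 1) * \<delta>q"
    by (simp add: sum.distrib s_def sum_distrib_left del: sum.op_ivl_Suc)
  finally have bary: "X * s + of_nat (n - 1) * \<delta>q = 0" .
  have "{1..n} - {1} = {2..<Suc n}" by auto
  moreover have "poly (pderiv (pderiv (P z0))) (x 1 z0) =
      - 2 * poly (pderiv (P z0)) (x 1 z0) * (\<Sum>i\<in>{1..n} - {1}. 1 / (x i z0 - x 1 z0))"
  proof (rule sum_inverse_root_differences[OF factor[OF W(2)] finite_atLeastAtMost one])
    fix i assume "i \<in> {1..n} - {1}"
    then show "x i z0 \<noteq> x 1 z0" using ne0[of i 1] by auto
  qed
  ultimately have g2: "poly (pderiv (pderiv (tangency_poly n p q))) w = - 2 * g * s"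
    by (simp only: x1z0 s_def P_def g_def) (simp only: z0_def fst_conv snd_conv)
  have clear_denominators: "u * (- 2 * g * s) * m = 2 * N * g * (k * m + b * g)"
    if "- u / g * s + N * (- k / g - b / m) = 0" "g \<noteq> 0" "m \<noteq> 0" for u g s N k m b :: complex
  proof -
    have "(- u / g * s + N * (- k / g - b / m)) * (g * m) = - (u * s * m + N * (k * m + b * g))"
      using that(2,3) by (simp add: field_simps)
    then have "u * s * m + N * (k * m + b * g) = 0"
      unfolding that(1) by (simp only: mult_zero_left neg_0_equal_iff_equal)
    then have "u * s * m = - (N * (k * m + b * g))"
      by (simp only: eq_neg_iff_add_eq_0)
    then have "- 2 * g * (u * s * m) = - 2 * g * - (N * (k * m + b * g))"
      by (simp only:)
    then show ?thesis by (simp add: mult_ac)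
  qed
  show ?thesis
    unfolding g2 by (rule clear_denominators[OF bary[unfolded X \<delta>q] g tr])
qed

section \<open>The condition on the line\<close>

text \<open>The tangent to the foliation at \<open>(x, y)\<close> has slope
  \<open>(y - y^n) / (x - x^n)\<close>. The hypotheses are those of
  \<open>flat_tangency_condition\<close> for this tangent, cleared of the denominator, so that they
  become polynomial in \<open>x\<close> and \<open>y\<close>.\<close>

lemma flat_line_condition_at:
  fixes a b c x y :: complex
  assumes n: "n \<ge> 2" and flat: "flat_web (Suc n) (legendre (vector [a, b, c]) (fermat_form n))"
    and on: "a * x + b * y + c = 0" and x: "x - x ^ n \<noteq> 0" and y: "y - y ^ n \<noteq> 0"
    and q: "(y - y ^ n) * x - y * (x - x ^ n) \<noteq> 0"
    and tr: "a * (x - x ^ n) + b * (y - y ^ n) \<noteq> 0"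
    and inf: "\<And>\<rho>. \<rho> ^ (n - 1) = 1 \<Longrightarrow> (y - y ^ n) - \<rho> * (x - x ^ n) \<noteq> 0"
    and sing: "\<And>\<xi> \<zeta>. \<xi> ^ (n - 1) = 1 \<Longrightarrow> \<zeta> ^ (n - 1) = 1 \<Longrightarrow>
      (\<xi> - x) * (y - y ^ n) - (\<zeta> - y) * (x - x ^ n) \<noteq> 0"
  defines "X \<equiv> x ^ (n - 1)" and "Y \<equiv> y ^ (n - 1)"
  shows "a * x * (1 - X) * (2 * of_nat n * Y - 1 - X - Y) + b * y * (1 - Y) * (2 * of_nat n * X - 1 - X - Y) = 0"
proof -
  define u v where "u = x - x ^ n" and "v = y - y ^ n"
  define p q where "p = v / u" and "q = p * x - y"
  have u: "u \<noteq> 0" "v \<noteq> 0" using x y by (simp_all add: u_def v_def)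
  have pu: "p * u = v" using u by (simp add: p_def)
  have p0: "p \<noteq> 0" using u by (simp add: p_def)
  have uX: "u = x * (1 - X)" "v = y * (1 - Y)"
    using n by (auto simp: u_def v_def X_def Y_def algebra_simps power_eq_if)
  have n1: "of_nat n \<noteq> (0 :: complex)" "of_nat (n - 1) \<noteq> (0 :: complex)" using n by auto
  have p: "p ^ n \<noteq> p"
  proof
    assume "p ^ n = p"
    moreover have "p ^ n = p * p ^ (n - 1)" using n by (cases n) auto
    ultimately have "p ^ (n - 1) = 1" using p0 by simp
    from inf[OF this] pu show False by (simp add: u_def v_def)
  qed
  have "q * u = v * x - y * u" by (simp add: q_def algebra_simps flip: pu)
  then have q0: "q \<noteq> 0" using q by (auto simp: u_def v_def)
  have "(a + b * p) * u = a * u + b * v" by (simp add: algebra_simps flip: pu)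
  then have t0: "a + b * p \<noteq> 0" using tr by (auto simp: u_def v_def)
  have yq: "p * x - q = y" by (simp add: q_def)
  have s0: "p * \<xi> - q \<noteq> \<zeta>" if "\<xi> ^ (n - 1) = 1" "\<zeta> ^ (n - 1) = 1" for \<xi> \<zeta>
  proof
    assume "p * \<xi> - q = \<zeta>"
    moreover have "(\<xi> - x) * (p * u) = (p * \<xi> - q - y) * u" by (simp add: q_def algebra_simps)
    ultimately have "(\<xi> - x) * v - (\<zeta> - y) * u = 0" unfolding pu by simp
    with sing[OF that] show False by (simp only: u_def v_def)
  qed
  have root: "poly (tangency_poly n p q) x = 0"
  proof -
    have "poly (tangency_poly n p q) x = p * u - v"
      by (simp add: poly_tangency_poly yq) (simp add: q_def u_def v_def algebra_simps)
    then show ?thesis by (simp add: pu)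
  qed
  have on': "(a + b * p) * x + (c - b * q) = 0"
    using on by (simp add: q_def algebra_simps)
  define g where "g = poly (pderiv (tangency_poly n p q)) x"
  have g: "g = of_nat n * p * (Y - X)"
    by (simp add: g_def poly_pderiv_tangency_poly yq X_def Y_def)
  have g0: "g \<noteq> 0"
    unfolding g_def using tangency_poly_simple_root[OF n p q0 s0 root] .
  \<comment> \<open>Up to the factor \<open>n p\<close>, \<open>Y - X\<close> is the derivative of
    the tangency polynomial at the simple root \<open>x\<close>. It turns out to divide both sides
    of the condition below.\<close>
  then have YX: "Y - X \<noteq> 0" by (auto simp: g)
  define x2 y2 where "x2 = x ^ (n - 2)" and "y2 = y ^ (n - 2)"
  have x2: "x * x2 = X" "y * y2 = Y"
  proof -
    obtain k where "n = Suc (Suc k)" using n by (metis add_2_eq_Suc le_Suc_ex)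
    then show "x * x2 = X" "y * y2 = Y" by (simp_all add: x2_def y2_def X_def Y_def)
  qed
  have "u * (of_nat n * of_nat (n - 1) * p * (p * y2 - x2)) * (a + b * p) =
    2 * of_nat (n - 1) * g * ((1 - of_nat n * Y) * (a + b * p) + b * g)"
    using flat_tangency_condition[OF n flat p q0 s0 root on' t0] u(1)
    unfolding poly_pderiv2_tangency_poly yq g_def[symmetric] u_def x2_def y2_def Y_def by simp
  then have "of_nat n * of_nat (n - 1) * p * (u * (p * y2 - x2) * (a + b * p)) =
    of_nat n * of_nat (n - 1) * p * (2 * (Y - X) * ((1 - of_nat n * Y) * (a + b * p) + b * g))"
    by (simp only: g mult_ac)
  then have "(u * (p * y2 - x2)) * (a + b * p) = 2 * (Y - X) * ((1 - of_nat n * Y) * (a + b * p) + b * g)"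
    using n1 p0 by (simp only: mult_cancel_left) auto
  also have "u * (p * y2 - x2) = v * y2 - u * x2"
    by (simp add: algebra_simps flip: pu)
  also have "\<dots> = (1 - Y) * (y * y2) - (1 - X) * (x * x2)"
    by (simp add: uX algebra_simps)
  also have "\<dots> = (Y - X) * (1 - X - Y)"
    unfolding x2 by (simp add: algebra_simps)
  finally have "(Y - X) * ((1 - X - Y) * (a + b * p)) = (Y - X) * (2 * ((1 - of_nat n * Y) * (a + b * p) + b * g))"
    by (simp only: mult_ac)
  then have "(1 - X - Y) * (a + b * p) = 2 * ((1 - of_nat n * Y) * (a + b * p) + b * g)"
    using YX by (simp only: mult_cancel_left) auto
  then have "(1 - X - Y) * (a + b * p) * u = 2 * ((1 - of_nat n * Y) * (a + b * p) + b * g) * u"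
    by simp
  then have "(1 - X - Y) * (a * u + b * (p * u)) =
      2 * ((1 - of_nat n * Y) * (a * u + b * (p * u)) + b * of_nat n * (p * u) * (Y - X))"
    by (simp add: g algebra_simps)
  then have "(1 - X - Y) * (a * u + b * v) =
      2 * ((1 - of_nat n * Y) * (a * u + b * v) + b * of_nat n * v * (Y - X))"
    unfolding pu .
  then show ?thesis
    unfolding uX by (simp add: algebra_simps)
qed

lemma poly_eq_0_if_zero_off_finite:
  fixes P :: "complex poly"
  assumes "finite S" "\<And>t. t \<notin> S \<Longrightarrow> poly P t = 0"
  shows "P = 0"
proof (rule ccontr)
  assume "P \<noteq> 0"
  then have "finite {t. poly P t = 0}" by (rule poly_roots_finite)
  moreover have "UNIV = {t. poly P t = 0} \<union> S" using assms by auto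
  ultimately have "finite (UNIV :: complex set)" using assms(1) by (metis finite_Un)
  then show False by (simp add: infinite_UNIV_char_0)
qed

text \<open>If \<open>(x', y', 1)\<close> is an affine point of the line, its point at infinity
  \<open>(x, y, 0)\<close> is the limit of \<open>(x + t x', y + t y', t)\<close>, which stays on
  the line. Identities along the line thus need to be checked for nonzero \<open>z\<close>
  only.\<close>

lemma line_limit_at_infinity:
  fixes f :: "complex \<Rightarrow> complex \<Rightarrow> complex \<Rightarrow> complex"
  assumes ab: "a \<noteq> 0 \<or> b \<noteq> 0"
    and cont: "\<And>x y x' y'. isCont (\<lambda>t. f (x + t * x') (y + t * y') t) 0"
    and zero: "\<And>x y z. z \<noteq> 0 \<Longrightarrow> a * x + b * y + c * z = 0 \<Longrightarrow> f x y z = 0"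
    and on: "a * x + b * y + c * z = 0"
  shows "f x y z = 0"
proof (cases "z = 0")
  case True
  obtain x' y' where xy': "a * x' + b * y' + c = 0"
  proof (cases "a = 0")
    case True
    with ab that[of 0 "- c / b"] show ?thesis by simp
  next
    case False
    with that[of "- c / a" 0] show ?thesis by simp
  qed
  have "f (x + t * x') (y + t * y') t = 0" if "t \<noteq> 0" for t
  proof (rule zero[OF that])
    have "a * (x + t * x') + b * (y + t * y') + c * t = (a * x + b * y) + t * (a * x' + b * y' + c)"
      by (simp add: algebra_simps)
    then show "a * (x + t * x') + b * (y + t * y') + c * t = 0" using on True xy' by simp
  qed
  then have "((\<lambda>t. f (x + t * x') (y + t * y') t) \<longlongrightarrow> 0) (at 0)"
    by (intro tendsto_eventually) (auto simp: eventually_at_filter)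
  moreover have "((\<lambda>t. f (x + t * x') (y + t * y') t) \<longlongrightarrow> f x y 0) (at 0)"
    using cont[of x x' y y'] by (simp add: isCont_def)
  ultimately show ?thesis using True LIM_unique by metis
qed (use zero on in auto)

text \<open>
  The conclusion of \<open>flat_line_condition_at\<close> in homogeneous coordinates; eliminating \<open>b y\<close> by the
  equation of the line makes it cyclically symmetric.
\<close>

definition barycenter_condition :: "nat \<Rightarrow> complex \<Rightarrow> complex \<Rightarrow> complex \<Rightarrow> bool" where
  "barycenter_condition n a b c \<longleftrightarrow> (\<forall>x y z. a * x + b * y + c * z = 0 \<longrightarrow>
     (let X = x ^ (n - 1); Y = y ^ (n - 1); Z = z ^ (n - 1); T = X + Y + Z
      in a * x * (Y - X) * (2 * of_nat n * Z - T) = c * z * (Z - Y) * (2 * of_nat n * X - T)))"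

text \<open>Once \<open>b x\<close> is eliminated, what remains is the identity \<open>(Y - X) (N Z
  - T) + (Z - Y) (N X - T) + (X - Z) (N Y - T) = 0\<close>. The rotation carries results about the
  point of the line on \<open>y = 0\<close> over to the other two axes.\<close>

lemma barycenter_condition_rotate:
  assumes "barycenter_condition n a b c"
  shows "barycenter_condition n b c a"
  unfolding barycenter_condition_def Let_def
proof (intro allI impI)
  fix x y z :: complex
  assume on: "b * x + c * y + a * z = 0"
  define X Y Z N where "X = x ^ (n - 1)" and "Y = y ^ (n - 1)" and "Z = z ^ (n - 1)"
    and "N = (2 * of_nat n :: complex)"
  have "a * z + b * x + c * y = 0" using on by (simp add: algebra_simps)
  then have 1: "a * z * (X - Z) * (N * Y - (Z + X + Y)) = c * y * (Y - X) * (N * Z - (Z + X + Y))"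
    using assms unfolding barycenter_condition_def Let_def X_def Y_def Z_def N_def by blast
  have bx: "b * x = - (c * y) - a * z" using on by (simp add: algebra_simps eq_neg_iff_add_eq_0)
  have "b * x * (Y - X) * (N * Z - (X + Y + Z)) = - (c * y * (Y - X) * (N * Z - (Z + X + Y)))
      - a * z * (Y - X) * (N * Z - (X + Y + Z))"
    unfolding bx by (simp add: algebra_simps)
  also have "\<dots> = a * z * (Z - Y) * (N * X - (X + Y + Z))"
    unfolding 1[symmetric] by (simp add: algebra_simps)
  finally show "b * x * (y ^ (n - 1) - x ^ (n - 1)) * (2 * of_nat n * z ^ (n - 1) - (x ^ (n - 1) + y ^ (n - 1) + z ^ (n - 1))) =
      a * z * (z ^ (n - 1) - y ^ (n - 1)) * (2 * of_nat n * x ^ (n - 1) - (x ^ (n - 1) + y ^ (n - 1) + z ^ (n - 1)))"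
    unfolding X_def Y_def Z_def N_def .
qed

section \<open>Criteria for a line to be invariant\<close>

lemma fermat_form_pairing:
  "pairing (fermat_form n m) v =
     (m$2 ^ n * m$3 - m$3 ^ n * m$2) * v$1 + (m$3 ^ n * m$1 - m$1 ^ n * m$3) * v$2
     + (m$1 ^ n * m$2 - m$2 ^ n * m$1) * v$3"
  by (simp add: pairing_def fermat_form_def sum_3 Let_def)

lemma on_line_vector: "on_line (vector [a, b, c]) v \<longleftrightarrow> a * v$1 + b * v$2 + c * v$3 = 0"
  by (simp add: on_line_def pairing_def sum_3)

text \<open>Both \<open>(x, y)\<close> and \<open>(x', y')\<close> are multiples of
  \<open>(u, v)\<close>, and \<open>u^n v = v^n u\<close> says that \<open>(u : v : 0)\<close> is
  singular. These are the cancellations behind the invariance of a line joining a vertex of the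
  coordinate triangle to a singularity on the opposite side.\<close>

lemma proportional_fixed:
  fixes u v :: complex
  assumes uv: "u \<noteq> 0 \<or> v \<noteq> 0" and uv_n: "u ^ n * v = v ^ n * u" and n: "n \<ge> 1"
    and xy: "x * v = y * u" "x' * v = y' * u"
  shows "x ^ n * y = y ^ n * x" "x * y' = y * x'" "y ^ n * x' = x ^ n * y'"
proof -
  obtain s s' where s: "x = s * u" "y = s * v" "x' = s' * u" "y' = s' * v"
  proof (cases "u = 0")
    case True
    with uv xy have "x = 0" "x' = 0" "v \<noteq> 0" by auto
    with True that[of "y / v" "y' / v"] show ?thesis by simp
  next
    case False
    with xy that[of "x / u" "x' / u"] show ?thesis by (simp add: field_simps)
  qed
  show "x ^ n * y = y ^ n * x" "x * y' = y * x'" "y ^ n * x' = x ^ n * y'"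
    unfolding s power_mult_distrib using uv_n by (simp_all add: algebra_simps)
qed

lemma fermat_pairing_algebra:
  fixes A1 A2 A3 m1 m2 m3 v1 v2 v3 :: complex
  assumes "A1 * m2 = A2 * m1" "m1 * v2 = m2 * v1" "A2 * v1 = A1 * v2"
  shows "(A2 * m3 - A3 * m2) * v1 + (A3 * m1 - A1 * m3) * v2 + (A1 * m2 - A2 * m1) * v3 = 0"
proof -
  have "(A2 * m3 - A3 * m2) * v1 + (A3 * m1 - A1 * m3) * v2 + (A1 * m2 - A2 * m1) * v3 =
    m3 * (A2 * v1 - A1 * v2) + A3 * (m1 * v2 - m2 * v1) + (A1 * m2 - A2 * m1) * v3"
    by (simp add: algebra_simps)
  with assms show ?thesis by simp
qed

text \<open>
  The line \<open>a x + b y = 0\<close> meets \<open>z = 0\<close> in \<open>(b : - a : 0)\<close>; the second hypothesis says that this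
  point is singular.
\<close>

lemma invariant_line_z:
  assumes "a \<noteq> 0 \<or> b \<noteq> 0" "b ^ n * (- a) = (- a) ^ n * b" "n \<ge> 1"
  shows "invariant_line (fermat_form n) (vector [a, b, 0])"
  unfolding invariant_line_def on_line_vector fermat_form_pairing
proof (intro allI impI, elim conjE)
  fix m v :: "complex^3"
  assume m: "a * m$1 + b * m$2 + 0 * m$3 = 0" "a * v$1 + b * v$2 + 0 * v$3 = 0"
  have "b \<noteq> 0 \<or> - a \<noteq> 0" using assms by auto
  moreover have "m$1 * (- a) = m$2 * b" "v$1 * (- a) = v$2 * b"
    using m by (simp_all add: algebra_simps neg_eq_iff_add_eq_0)
  ultimately have "m$1 ^ n * m$2 = m$2 ^ n * m$1" "m$1 * v$2 = m$2 * v$1" "m$2 ^ n * v$1 = m$1 ^ n * v$2"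
    using proportional_fixed[of b "- a" n "m$1" "m$2" "v$1" "v$2"] assms by blast+
  then show "(m$2 ^ n * m$3 - m$3 ^ n * m$2) * v$1 + (m$3 ^ n * m$1 - m$1 ^ n * m$3) * v$2
     + (m$1 ^ n * m$2 - m$2 ^ n * m$1) * v$3 = 0"
    by (rule fermat_pairing_algebra)
qed

lemma invariant_line_y:
  assumes "a \<noteq> 0 \<or> c \<noteq> 0" "a ^ n * (- c) = (- c) ^ n * a" "n \<ge> 1"
  shows "invariant_line (fermat_form n) (vector [a, 0, c])"
  unfolding invariant_line_def on_line_vector fermat_form_pairing
proof (intro allI impI, elim conjE)
  fix m v :: "complex^3"
  assume m: "a * m$1 + 0 * m$2 + c * m$3 = 0" "a * v$1 + 0 * v$2 + c * v$3 = 0"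
  have "a \<noteq> 0 \<or> - c \<noteq> 0" using assms by auto
  moreover have "m$3 * (- c) = m$1 * a" "v$3 * (- c) = v$1 * a"
    using m by (simp_all add: algebra_simps neg_eq_iff_add_eq_0)
  ultimately have "m$3 ^ n * m$1 = m$1 ^ n * m$3" "m$3 * v$1 = m$1 * v$3" "m$1 ^ n * v$3 = m$3 ^ n * v$1"
    using proportional_fixed[of a "- c" n "m$3" "m$1" "v$3" "v$1"] assms by blast+
  then show "(m$2 ^ n * m$3 - m$3 ^ n * m$2) * v$1 + (m$3 ^ n * m$1 - m$1 ^ n * m$3) * v$2
     + (m$1 ^ n * m$2 - m$2 ^ n * m$1) * v$3 = 0"
    using fermat_pairing_algebra[of "m$3 ^ n" "m$1" "m$1 ^ n" "m$3" "v$1" "v$3" "m$2" "m$2 ^ n" "v$2"]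
    by (simp add: algebra_simps)
qed

lemma invariant_line_x:
  assumes "b \<noteq> 0 \<or> c \<noteq> 0" "c ^ n * (- b) = (- b) ^ n * c" "n \<ge> 1"
  shows "invariant_line (fermat_form n) (vector [0, b, c])"
  unfolding invariant_line_def on_line_vector fermat_form_pairing
proof (intro allI impI, elim conjE)
  fix m v :: "complex^3"
  assume m: "0 * m$1 + b * m$2 + c * m$3 = 0" "0 * v$1 + b * v$2 + c * v$3 = 0"
  have "c \<noteq> 0 \<or> - b \<noteq> 0" using assms by auto
  moreover have "m$2 * (- b) = m$3 * c" "v$2 * (- b) = v$3 * c"
    using m by (simp_all add: algebra_simps neg_eq_iff_add_eq_0)
  ultimately have "m$2 ^ n * m$3 = m$3 ^ n * m$2" "m$2 * v$3 = m$3 * v$2" "m$3 ^ n * v$2 = m$2 ^ n * v$3"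
    using proportional_fixed[of c "- b" n "m$2" "m$3" "v$2" "v$3"] assms by blast+
  then show "(m$2 ^ n * m$3 - m$3 ^ n * m$2) * v$1 + (m$3 ^ n * m$1 - m$1 ^ n * m$3) * v$2
     + (m$1 ^ n * m$2 - m$2 ^ n * m$1) * v$3 = 0"
    using fermat_pairing_algebra[of "m$2 ^ n" "m$3" "m$3 ^ n" "m$2" "v$3" "v$2" "m$1" "m$1 ^ n" "v$1"]
    by (simp add: algebra_simps)
qed

text \<open>In the chart the foliation is spanned by
  \<open>(x - x^n) \<partial>\<^sub>x + (y - y^n) \<partial>\<^sub>y\<close>, so
  \<open>tangent\<close> is tangency at all affine points of the line; the point at infinity follows
  by continuity.\<close>

lemma invariant_line_tangent:
  assumes ab: "a \<noteq> 0 \<or> b \<noteq> 0"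
    and tangent: "\<And>x y. a * x + b * y + c = 0 \<Longrightarrow> a * (x - x ^ n) + b * (y - y ^ n) = 0"
    and n: "n \<ge> 1"
  shows "invariant_line (fermat_form n) (vector [a, b, c])"
  unfolding invariant_line_def on_line_vector fermat_form_pairing
proof (intro allI impI, elim conjE)
  fix m v :: "complex^3"
  assume m: "a * m$1 + b * m$2 + c * m$3 = 0" and v: "a * v$1 + b * v$2 + c * v$3 = 0"
  define f where "f x y z = (y ^ n * z - z ^ n * y) * v$1 + (z ^ n * x - x ^ n * z) * v$2
     + (x ^ n * y - y ^ n * x) * v$3" for x y z
  have "f (m$1) (m$2) (m$3) = 0"
  proof (rule line_limit_at_infinity[OF ab _ _ m])
    show "isCont (\<lambda>t. f (x + t * x') (y + t * y') t) 0" for x y x' y'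
      unfolding f_def by (intro continuous_intros)
    fix x y z :: complex
    assume z: "z \<noteq> 0" and on: "a * x + b * y + c * z = 0"
    have "a * (x / z) + b * (y / z) + c = 0" using z on by (simp add: field_simps)
    from tangent[OF this]
    have "z ^ Suc n * (a * (x / z - (x / z) ^ n) + b * (y / z - (y / z) ^ n)) = 0" by simp
    also have "z ^ Suc n * (a * (x / z - (x / z) ^ n) + b * (y / z - (y / z) ^ n)) =
       a * (z ^ n * x - x ^ n * z) + b * (z ^ n * y - y ^ n * z)"
      using z by (simp add: power_divide field_simps)
    finally have 1: "a * (z ^ n * x - x ^ n * z) = b * (y ^ n * z - z ^ n * y)"
      by (simp add: algebra_simps eq_neg_iff_add_eq_0)
    define P Q where "P = y ^ n * z - z ^ n * y" and "Q = z ^ n * x - x ^ n * z"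
    have zf: "z * f x y z = P * (z * v$1 - v$3 * x) + Q * (z * v$2 - v$3 * y)"
      by (simp add: f_def P_def Q_def algebra_simps)
    have 2: "a * (z * v$1 - v$3 * x) + b * (z * v$2 - v$3 * y) = 0"
      using on v by algebra
    \<comment> \<open>By \<open>a Q = b P\<close>, the products of \<open>z f\<close> with
      \<open>a\<close> and with \<open>b\<close> are \<open>P\<close> and \<open>Q\<close> times the
      left side of \<open>2\<close>. One of \<open>a\<close>, \<open>b\<close> is nonzero.\<close>
    have "a * (z * f x y z) = 0" "b * (z * f x y z) = 0"
      unfolding zf using 1[folded P_def Q_def] 2 by algebra+
    then show "f x y z = 0" using ab z by auto
  qed
  then show "(m$2 ^ n * m$3 - m$3 ^ n * m$2) * v$1 + (m$3 ^ n * m$1 - m$1 ^ n * m$3) * v$2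
     + (m$1 ^ n * m$2 - m$2 ^ n * m$1) * v$3 = 0"
    by (simp add: f_def)
qed

section \<open>Lines on which a genericity condition fails identically\<close>

lemma two_power_neq: "n \<ge> 2 \<Longrightarrow> (2 :: complex) ^ n \<noteq> 2"
proof
  assume "n \<ge> 2" "(2 :: complex) ^ n = 2"
  then have "(of_nat (2 ^ n) :: complex) = of_nat 2" by simp
  then have "(2 :: nat) ^ n = 2 ^ 1" by (simp only: of_nat_eq_iff power_one_right)
  with \<open>n \<ge> 2\<close> show False by (simp only: power_inject_exp)
qed

lemma three_power_neq: "n \<ge> 2 \<Longrightarrow> (3 :: complex) ^ n \<noteq> 3"
proof
  assume "n \<ge> 2" "(3 :: complex) ^ n = 3"
  then have "(of_nat (3 ^ n) :: complex) = of_nat 3" by simp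
  then have "(3 :: nat) ^ n = 3 ^ 1" by (simp only: of_nat_eq_iff power_one_right)
  with \<open>n \<ge> 2\<close> show False by (simp only: power_inject_exp)
qed

lemma side_point_singular:
  fixes u v :: complex
  assumes "v \<noteq> 0" "(u / v) ^ n = u / v"
  shows "u ^ n * v = v ^ n * u"
  using assms by (simp add: power_divide field_simps)

text \<open>If \<open>b \<noteq> 0\<close>, the coordinate \<open>x\<close> takes every value on the
  line, also 2, which is not a root of \<open>x^n = x\<close>. Hence the line is vertical and joins
  \<open>(0 : 1 : 0)\<close> to a singularity on \<open>y = 0\<close>.\<close>

lemma invariant_line_x_fixed:
  assumes n: "n \<ge> 2" and ab: "a \<noteq> 0 \<or> b \<noteq> 0"
    and fixed: "\<And>x y. a * x + b * y + c = 0 \<Longrightarrow> x ^ n = x"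
  shows "invariant_line (fermat_form n) (vector [a, b, c])"
proof -
  have b: "b = 0"
  proof (rule ccontr)
    assume "b \<noteq> 0"
    with fixed[of 2 "- (c + a * 2) / b"] have "(2 :: complex) ^ n = 2" by (simp add: field_simps)
    with two_power_neq[OF n] show False by simp
  qed
  with ab have a: "a \<noteq> 0" by simp
  then have "(- c / a) ^ n = - c / a" using b fixed[of "- c / a" 0] by simp
  from side_point_singular[OF a this] show ?thesis
    unfolding b using a n by (intro invariant_line_y) auto
qed

lemma invariant_line_y_fixed:
  assumes n: "n \<ge> 2" and ab: "a \<noteq> 0 \<or> b \<noteq> 0"
    and fixed: "\<And>x y. a * x + b * y + c = 0 \<Longrightarrow> y ^ n = y"
  shows "invariant_line (fermat_form n) (vector [a, b, c])"
proof -
  have a: "a = 0"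
  proof (rule ccontr)
    assume "a \<noteq> 0"
    with fixed[of "- (c + b * 2) / a" 2] have "(2 :: complex) ^ n = 2" by (simp add: field_simps)
    with two_power_neq[OF n] show False by simp
  qed
  with ab have b: "- b \<noteq> 0" by simp
  then have "(c / - b) ^ n = c / - b" using a fixed[of 0 "c / - b"] by simp
  from side_point_singular[OF b this] show ?thesis
    unfolding a using b n by (intro invariant_line_x) auto
qed

text \<open>The hypothesis says \<open>y x^n = x y^n\<close> on the line. If
  \<open>c \<noteq> 0\<close>, the line meets \<open>y = k x\<close> away from the origin whenever
  \<open>a + b k \<noteq> 0\<close>, and then \<open>k^n = k\<close>. As 2 and 3 are not such
  values, \<open>a + 2 b = a + 3 b = 0\<close>, which is impossible. So the line passes through the
  origin and a singularity at infinity.\<close>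

lemma invariant_line_through_origin:
  assumes n: "n \<ge> 2" and ab: "a \<noteq> 0 \<or> b \<noteq> 0"
    and fixed: "\<And>x y. a * x + b * y + c = 0 \<Longrightarrow> (y - y ^ n) * x - y * (x - x ^ n) = 0"
  shows "invariant_line (fermat_form n) (vector [a, b, c])"
proof (cases "c = 0")
  case True
  have "b ^ n * (- a) = (- a) ^ n * b"
  proof -
    have "(- a - (- a) ^ n) * b - (- a) * (b - b ^ n) = 0"
      using True by (intro fixed) simp
    also have "(- a - (- a) ^ n) * b - (- a) * (b - b ^ n) = b ^ n * (- a) - (- a) ^ n * b"
      by (simp add: algebra_simps)
    finally show ?thesis by simp
  qed
  then show ?thesis unfolding True using ab n by (intro invariant_line_z) auto
next
  case False
  have *: False if k: "a + b * k \<noteq> 0" "k ^ n \<noteq> k" for k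
  proof -
    define s where "s = - c / (a + b * k)"
    have "(a + b * k) * s = - c" using k by (simp add: s_def)
    then have s: "s \<noteq> 0" "a * s + b * (k * s) + c = 0"
      using False by (auto simp: algebra_simps)
    from fixed[OF s(2)] have "s ^ n * s * (k - k ^ n) = 0"
      by (simp add: power_mult_distrib algebra_simps)
    with s k show False by simp
  qed
  have "a + b * 2 = 0" "a + b * 3 = 0"
    using *[of 2] *[of 3] two_power_neq[OF n] three_power_neq[OF n] by auto
  then have "b = 0" "a = 0" by algebra+
  with ab show ?thesis by simp
qed

text \<open>Substitute \<open>y = k + t x\<close> and compare coefficients. For
  \<open>n \<ge> 3\<close> the power \<open>x^(n - 1)\<close> forces \<open>k = 0\<close>, and the
  line turns out to be invariant. For \<open>n = 2\<close> this is the linear coefficient, to which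
  other terms contribute, and the line \<open>x + y = 1\<close> survives.\<close>

lemma tangents_through_point_at_infinity:
  assumes n: "n \<ge> 2" and ab: "a \<noteq> 0 \<or> b \<noteq> 0" and \<rho>: "\<rho> ^ (n - 1) = 1"
    and pencil: "\<And>x y. a * x + b * y + c = 0 \<Longrightarrow> (y - y ^ n) - \<rho> * (x - x ^ n) = 0"
    and inv: "\<not> invariant_line (fermat_form n) (vector [a, b, c])"
  shows "n = 2 \<and> a \<noteq> 0 \<and> b = a \<and> c = - a"
proof -
  have \<rho>0: "\<rho> \<noteq> 0" using \<rho> n by (auto simp: power_0_left)
  have n0: "n > 0" using n by simp
  have b: "b \<noteq> 0"
  proof
    assume b: "b = 0"
    define x where "x = - c / a"
    have x: "a * x + b * y + c = 0" for y using ab b by (simp add: x_def)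
    have e: "\<rho> * (x - x ^ n) = 0" using pencil[OF x, of 0] n0 by (simp add: power_0_left)
    from pencil[OF x, of 2] have "(2 :: complex) ^ n = 2" unfolding e by simp
    with two_power_neq[OF n] show False by simp
  qed
  have a: "a \<noteq> 0"
  proof
    assume a: "a = 0"
    define y where "y = - c / b"
    have y: "a * x + b * y + c = 0" for x using b a by (simp add: y_def)
    from pencil[OF y, of 0] pencil[OF y, of 2] have "(2 :: complex) ^ n = 2"
      using n0 \<rho>0 by (simp add: power_0_left)
    with two_power_neq[OF n] show False by simp
  qed
  define t k where "t = - a / b" and "k = - c / b"
  have t0: "t \<noteq> 0" using a b by (simp add: t_def)
  have kt: "(k + t * x - (k + t * x) ^ n) - \<rho> * (x - x ^ n) = 0" for x
    using pencil[of x "k + t * x"] b by (simp add: t_def k_def field_simps)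
  have "poly ([:k, t:] - [:k, t:] ^ n - smult \<rho> ([:0, 1:] - monom 1 n)) x = 0" for x
    using kt[of x] by (simp add: poly_monom algebra_simps)
  then have P: "[:k, t:] - [:k, t:] ^ n - smult \<rho> ([:0, 1:] - monom 1 n) = 0"
    using poly_eq_0_if_zero_off_finite[of "{}"] by blast
  have coeff: "coeff [:k, t:] i - of_nat (n choose i) * t ^ i * k ^ (n - i)
      - \<rho> * (coeff [:0, 1:] i - (if i = n then 1 else 0)) = 0" if "i \<le> n" for i
    using arg_cong[OF P, of "\<lambda>p. coeff p i"] coeff_linear_poly_power[OF that, of k t] by auto
  show ?thesis
  proof (cases "n = 2")
    case True
    have \<rho>1: "\<rho> = 1" using \<rho> True by simp
    have c0: "k - k ^ 2 = 0" and c1: "t - 2 * t * k = 1" and c2: "t ^ 2 = 1"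
      using coeff[of 0] coeff[of 1] coeff[of 2]
      by (simp_all add: True \<rho>1 coeff_pCons numeral_2_eq_2)
    have "k \<noteq> 0"
    proof
      assume "k = 0"
      then have "c = 0" "b = - a" using c1 b by (auto simp: k_def t_def field_simps)
      then have "invariant_line (fermat_form n) (vector [a, b, c])"
        using a n0 by (auto intro!: invariant_line_z)
      with inv show False by simp
    qed
    with c0 have k: "k = 1" by (simp add: power2_eq_square)
    with c1 have t: "t = - 1" by (simp add: algebra_simps) (metis add.inverse_inverse)
    from k t b have "- c = b" "a = b" by (simp_all add: k_def t_def field_simps)
    with True a show ?thesis by (metis minus_minus)
  next
    case False
    then have n3: "n \<ge> 3" using n by simp
    obtain j where "n = 3 + j" using n3 le_Suc_ex by blast
    then have j: "n = Suc (Suc (Suc j))" by simp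
    have "t ^ n = \<rho>" using coeff[of n] by (simp add: j)
    have "n choose (n - 1) = n"
      using n0 by (subst binomial_symmetric) auto
    then have "k = 0"
      using coeff[of "n - 1"] t0 by (simp add: j del: binomial_Suc_Suc of_nat_Suc)
    moreover have "t = \<rho>"
      using coeff[of 1] n3 \<open>k = 0\<close> by (simp add: power_0_left)
    ultimately have "c = 0" "(- a / b) ^ n = - a / b"
      using b \<open>t ^ n = \<rho>\<close> by (auto simp: k_def t_def)
    moreover from side_point_singular[OF b this(2)] have "b ^ n * (- a) = (- a) ^ n * b" by simp
    ultimately have "invariant_line (fermat_form n) (vector [a, b, c])"
      using a n0 by (auto intro!: invariant_line_z)
    with inv show ?thesis by simp
  qed
qed

text \<open>A zero coefficient puts a vertex of the coordinate triangle on the line; if the line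
  meets the opposite side in a singularity, it is invariant. This serves the exceptional lines as
  well as those satisfying the barycenter condition.\<close>

lemma side_ratios:
  assumes n: "n \<ge> 2" and l: "a \<noteq> 0 \<or> b \<noteq> 0 \<or> c \<noteq> 0"
    and inv: "\<not> invariant_line (fermat_form n) (vector [a, b, c])"
    and z: "c = 0 \<Longrightarrow> b ^ n * (- a) = (- a) ^ n * b"
    and y: "b = 0 \<Longrightarrow> a ^ n * (- c) = (- c) ^ n * a"
    and x: "a = 0 \<Longrightarrow> c ^ n * (- b) = (- b) ^ n * c"
  shows "a \<noteq> 0" "b \<noteq> 0" "c \<noteq> 0"
proof -
  have n1: "n \<ge> 1" using n by simp
  show "c \<noteq> 0"
  proof
    assume c: "c = 0"
    show False
    proof (cases "a = 0 \<and> b = 0")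
      case True
      then show ?thesis using l c by simp
    next
      case False
      then show ?thesis using invariant_line_z[OF _ z[OF c] n1] inv c by simp
    qed
  qed
  then show "b \<noteq> 0" using invariant_line_y[OF _ y n1] inv by auto
  then show "a \<noteq> 0" using invariant_line_x[OF _ x n1] inv by auto
qed

text \<open>The polynomial \<open>f\<close> of the proof is the Fermat form contracted with
  \<open>(\<xi>, \<zeta>, 1)\<close>. Its vanishing on the line makes the intersections with the
  three axes singular, which excludes \<open>n = 2\<close> and determines the line for
  \<open>n = 3\<close>; larger \<open>n\<close> are excluded by comparing coefficients.\<close>

lemma tangents_through_radial_point:
  assumes n: "n \<ge> 2" and ab: "a \<noteq> 0 \<or> b \<noteq> 0" and \<xi>: "\<xi> ^ (n - 1) = 1" and \<zeta>: "\<zeta> ^ (n - 1) = 1"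
    and pencil: "\<And>x y. a * x + b * y + c = 0 \<Longrightarrow> (\<xi> - x) * (y - y ^ n) - (\<zeta> - y) * (x - x ^ n) = 0"
    and inv: "\<not> invariant_line (fermat_form n) (vector [a, b, c])"
  shows "n = 3 \<and> a \<noteq> 0 \<and> b ^ 2 = a ^ 2 \<and> c ^ 2 = a ^ 2"
proof -
  have nz: "\<xi> \<noteq> 0" "\<zeta> \<noteq> 0" using \<xi> \<zeta> n by (auto simp: power_0_left)
  have n1: "n \<ge> 1" "n > 0" using n by simp_all
  define f where "f x y z = \<xi> * (y ^ n * z - z ^ n * y) + \<zeta> * (z ^ n * x - x ^ n * z)
     + (x ^ n * y - y ^ n * x)" for x y z
  have f: "f x y z = 0" if "a * x + b * y + c * z = 0" for x y z
  proof (rule line_limit_at_infinity[OF ab _ _ that])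
    show "isCont (\<lambda>t. f (x + t * x') (y + t * y') t) 0" for x y x' y'
      unfolding f_def by (intro continuous_intros)
    fix x y z :: complex
    assume z: "z \<noteq> 0" and on: "a * x + b * y + c * z = 0"
    have "a * (x / z) + b * (y / z) + c = 0" using z on by (simp add: field_simps)
    from pencil[OF this]
    have "- (z ^ Suc n) * ((\<xi> - x / z) * (y / z - (y / z) ^ n) - (\<zeta> - y / z) * (x / z - (x / z) ^ n)) = 0"
      by simp
    also have "- (z ^ Suc n) * ((\<xi> - x / z) * (y / z - (y / z) ^ n) - (\<zeta> - y / z) * (x / z - (x / z) ^ n)) = f x y z"
      using z by (simp add: f_def power_divide field_simps)
    finally show "f x y z = 0" .
  qed
  have sz: "b ^ n * (- a) = (- a) ^ n * b"
    using f[of b "- a" 0] n1 by (simp add: f_def power_0_left)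
  have sy: "a ^ n * (- c) = (- c) ^ n * a"
    using f[of "- c" 0 a] n1 nz by (simp add: f_def power_0_left)
  have sx: "c ^ n * (- b) = (- b) ^ n * c"
    using f[of 0 c "- b"] n1 nz by (simp add: f_def power_0_left)
  have abc: "a \<noteq> 0" "b \<noteq> 0" "c \<noteq> 0"
    using side_ratios[OF n _ inv sz sy sx] ab by auto
  have ratio: "(- u) ^ (n - 1) = v ^ (n - 1)" if "v ^ n * (- u) = (- u) ^ n * v" "u \<noteq> 0" "v \<noteq> 0" for u v :: complex
  proof -
    have "w ^ n = w * w ^ (n - 1)" for w :: complex using n1 by (cases n) auto
    then have "(v * (- u)) * v ^ (n - 1) = (v * (- u)) * (- u) ^ (n - 1)"
      using that(1) by (simp add: mult_ac)
    with that show ?thesis by simp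
  qed
  note rz = ratio[OF sz abc(1,2)] and ry = ratio[OF sy abc(3,1)] and rx = ratio[OF sx abc(2,3)]
  show ?thesis
  proof (cases "n \<ge> 4")
    case False
    have "n \<noteq> 2"
    proof
      assume "n = 2"
      with rz ry rx have "- a = b" "- c = a" "- b = c" by simp_all
      then have "a = - a" by (metis minus_minus)
      with abc show False by simp
    qed
    with n False have "n = 3" by simp
    with rz ry abc show ?thesis by simp
  next
    case True
    define x0 k where "x0 = - c / a" and "k = - b / a"
    have x0: "x0 \<noteq> 0" "k \<noteq> 0" using abc by (simp_all add: x0_def k_def)
    have f1: "f (x0 + k * y) y 1 = 0" for y
      using abc by (intro f) (simp add: x0_def k_def field_simps)
    have "poly (smult \<xi> (monom 1 n - [:0, 1:]) + smult \<zeta> ([:x0, k:] - [:x0, k:] ^ n)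
        + ([:0, 1:] * [:x0, k:] ^ n - monom 1 n * [:x0, k:])) y = 0" for y
      using f1[of y] by (simp add: f_def poly_monom algebra_simps)
    then have P: "smult \<xi> (monom 1 n - [:0, 1:]) + smult \<zeta> ([:x0, k:] - [:x0, k:] ^ n)
        + ([:0, 1:] * [:x0, k:] ^ n - monom 1 n * [:x0, k:]) = 0"
      using poly_eq_0_if_zero_off_finite[of "{}"] by blast
    \<comment> \<open>As \<open>n \<ge> 4\<close>, the coefficients of \<open>y^2\<close> and
      \<open>y^3\<close> receive nothing from the terms with \<open>y^n\<close>. They yield
      \<open>2 x0 = \<zeta> (n - 1) k\<close> and \<open>3 x0 = \<zeta> (n - 2) k\<close>, hence
      \<open>3 (n - 1) = 2 (n - 2)\<close>.\<close>
    have c2: "of_nat (n choose 1) * k * x0 ^ (n - 1) = \<zeta> * of_nat (n choose 2) * k ^ 2 * x0 ^ (n - 2)"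
      using arg_cong[OF P, of "\<lambda>p. coeff p 2"] True
      by (simp add: coeff_linear_poly_power coeff_monom_mult numeral_2_eq_2 algebra_simps)
    have c3: "of_nat (n choose 2) * k ^ 2 * x0 ^ (n - 2) = \<zeta> * of_nat (n choose 3) * k ^ 3 * x0 ^ (n - 3)"
      using arg_cong[OF P, of "\<lambda>p. coeff p 3"] True
      by (simp add: coeff_linear_poly_power coeff_monom_mult numeral_3_eq_3 numeral_2_eq_2 algebra_simps)
    obtain m where "n = 4 + m" using True le_Suc_ex by blast
    then have m: "n = Suc (Suc (Suc (Suc m)))" by simp
    have "x0 * of_nat n = \<zeta> * of_nat (n choose 2) * k"
    proof -
      have "k * x0 ^ (n - 2) * (x0 * of_nat n) = k * x0 ^ (n - 2) * (\<zeta> * of_nat (n choose 2) * k)"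
        using c2 by (simp add: m power2_eq_square mult_ac)
      then show ?thesis using x0 by simp
    qed
    then have "2 * x0 * of_nat n = \<zeta> * of_nat (2 * (n choose 2)) * k" by (simp add: algebra_simps)
    also have "2 * (n choose 2) = n * (n - 1)"
      using binomial_absorption[of 1 n] by (simp add: numeral_2_eq_2)
    finally have "of_nat n * (2 * x0) = of_nat n * (\<zeta> * of_nat (n - 1) * k)"
      by (simp only: of_nat_mult mult_ac)
    then have e2: "2 * x0 = \<zeta> * of_nat (n - 1) * k" using n1 by simp
    have "x0 * of_nat (n choose 2) = \<zeta> * of_nat (n choose 3) * k"
    proof -
      have "k ^ 2 * x0 ^ (n - 3) * (x0 * of_nat (n choose 2)) = k ^ 2 * x0 ^ (n - 3) * (\<zeta> * of_nat (n choose 3) * k)"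
        using c3 by (simp add: m power2_eq_square power3_eq_cube mult_ac)
      then show ?thesis using x0 by simp
    qed
    then have "3 * x0 * of_nat (n choose 2) = \<zeta> * of_nat (3 * (n choose 3)) * k" by (simp add: algebra_simps)
    also have "3 * (n choose 3) = (n - 2) * (n choose 2)"
      using binomial_absorb_comp[of n 2] binomial_absorption[of 2 n]
      by (simp add: numeral_3_eq_3 numeral_2_eq_2)
    finally have "of_nat (n choose 2) * (3 * x0) = of_nat (n choose 2) * (\<zeta> * of_nat (n - 2) * k)"
      by (simp only: of_nat_mult mult_ac)
    then have e3: "3 * x0 = \<zeta> * of_nat (n - 2) * k" using n by (simp add:)
    have "of_nat (n - 1) * (3 * x0) = of_nat (n - 2) * (2 * x0)"
      unfolding e2 e3 by simp
    then have "of_nat ((n - 1) * 3) * x0 = of_nat ((n - 2) * 2) * x0" by (simp add: mult_ac)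
    then have "(n - 1) * 3 = (n - 2) * 2" using x0 by (simp only: mult_cancel_right of_nat_eq_iff) simp
    then show ?thesis using True by simp
  qed
qed

section \<open>From a general point of the line to all of its points\<close>

lemma barycenter_conditionI:
  assumes ab: "a \<noteq> 0 \<or> b \<noteq> 0" and n: "n \<ge> 1"
    and affine: "\<And>x y. a * x + b * y + c = 0 \<Longrightarrow>
      a * x * (1 - x ^ (n - 1)) * (2 * of_nat n * y ^ (n - 1) - 1 - x ^ (n - 1) - y ^ (n - 1))
      + b * y * (1 - y ^ (n - 1)) * (2 * of_nat n * x ^ (n - 1) - 1 - x ^ (n - 1) - y ^ (n - 1)) = 0"
  shows "barycenter_condition n a b c"
  unfolding barycenter_condition_def Let_def
proof (intro allI impI)
  fix x y z :: complex
  assume on: "a * x + b * y + c * z = 0"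
  define m where "m = n - 1"
  define N :: complex where "N = 2 * of_nat n"
  define f where "f x y z = a * x * (y ^ m - x ^ m) * (N * z ^ m - (x ^ m + y ^ m + z ^ m))
     - c * z * (z ^ m - y ^ m) * (N * x ^ m - (x ^ m + y ^ m + z ^ m))" for x y z
  have "f x y z = 0"
  proof (rule line_limit_at_infinity[OF ab _ _ on])
    show "isCont (\<lambda>t. f (x + t * x') (y + t * y') t) 0" for x y x' y'
      unfolding f_def by (intro continuous_intros)
    fix x y z :: complex
    assume z: "z \<noteq> 0" and on: "a * x + b * y + c * z = 0"
    define u v where "u = x / z" and "v = y / z"
    have xy: "x = u * z" "y = v * z" using z by (simp_all add: u_def v_def)
    have uv: "a * u + b * v + c = 0" using z on by (simp add: u_def v_def field_simps)
    define U V where "U = u ^ m" and "V = v ^ m"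
    have 1: "a * u * (1 - U) * (N * V - 1 - U - V) + b * v * (1 - V) * (N * U - 1 - U - V) = 0"
      using affine[OF uv] by (simp add: U_def V_def N_def m_def)
    have bv: "b * v = - c - a * u" using uv by (simp add: eq_diff_eq eq_neg_iff_add_eq_0 algebra_simps)
    have "a * u * (V - U) * (N - (U + V + 1)) - c * (1 - V) * (N * U - (U + V + 1)) = 0"
      using 1 unfolding bv by (simp add: algebra_simps)
    then have "z * z ^ m * z ^ m * (a * u * (V - U) * (N - (U + V + 1)) - c * (1 - V) * (N * U - (U + V + 1))) = 0"
      by simp
    also have "z * z ^ m * z ^ m * (a * u * (V - U) * (N - (U + V + 1)) - c * (1 - V) * (N * U - (U + V + 1))) = f x y z"
      unfolding f_def xy power_mult_distrib U_def[symmetric] V_def[symmetric] by (simp add: algebra_simps)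
    finally show "f x y z = 0" .
  qed
  then show "a * x * (y ^ (n - 1) - x ^ (n - 1)) * (2 * of_nat n * z ^ (n - 1) - (x ^ (n - 1) + y ^ (n - 1) + z ^ (n - 1))) =
      c * z * (z ^ (n - 1) - y ^ (n - 1)) * (2 * of_nat n * x ^ (n - 1) - (x ^ (n - 1) + y ^ (n - 1) + z ^ (n - 1)))"
    by (simp add: f_def m_def N_def)
qed

text \<open>Along a parametrization of the line, every genericity hypothesis of
  \<open>flat_line_condition_at\<close> says that a polynomial in the parameter is nonzero. If one
  of these polynomials is zero, the line is invariant or exceptional; otherwise the condition holds
  off a finite set of parameters, hence identically.\<close>

lemma flat_line_cases:
  fixes a b c :: complex
  assumes n: "n \<ge> 2" and flat: "flat_web (Suc n) (legendre (vector [a, b, c]) (fermat_form n))"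
    and ab: "a \<noteq> 0 \<or> b \<noteq> 0"
    and inv: "\<not> invariant_line (fermat_form n) (vector [a, b, c])"
  shows "barycenter_condition n a b c \<or> (n = 2 \<and> a \<noteq> 0 \<and> b = a \<and> c = - a)
     \<or> (n = 3 \<and> a \<noteq> 0 \<and> b ^ 2 = a ^ 2 \<and> c ^ 2 = a ^ 2)"
proof (rule ccontr)
  assume contra: "\<not> ?thesis"
  obtain x0 y0 where base: "a * x0 + b * y0 + c = 0"
  proof (cases "a = 0")
    case True
    with ab that[of 0 "- c / b"] show ?thesis by simp
  next
    case False
    with that[of "- c / a" 0] show ?thesis by simp
  qed
  have on_t: "a * (x0 + t * b) + b * (y0 - t * a) + c = 0" for t
  proof -
    have "a * (x0 + t * b) + b * (y0 - t * a) + c = a * x0 + b * y0 + c" by (simp add: algebra_simps)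
    then show ?thesis using base by simp
  qed
  have param: "\<exists>t. x = x0 + t * b \<and> y = y0 - t * a" if "a * x + b * y + c = 0" for x y
  proof -
    have e: "a * (x - x0) = - b * (y - y0)" using that base by algebra
    show ?thesis
    proof (cases "a = 0")
      case True
      then have "y = y0" using e ab by simp
      with True ab show ?thesis by (intro exI[of _ "(x - x0) / b"]) simp
    next
      case False
      have "x = x0 + (y0 - y) / a * b" using e False by (simp add: field_simps)
      with False show ?thesis by (intro exI[of _ "(y0 - y) / a"]) simp
    qed
  qed
  define x y where "x = [:x0, b:]" and "y = [:y0, - a:]"
  have px: "poly x t = x0 + t * b" "poly y t = y0 - t * a" for t
    by (simp_all add: x_def y_def)
  have on: "a * poly x t + b * poly y t + c = 0" for t
    unfolding px by (rule on_t)
  have vanish: "f u v = 0" if "P = 0" "\<And>t. poly P t = f (poly x t) (poly y t)" "a * u + b * v + c = 0"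
    for P f u v
    using param[OF that(3)] that(1,2) px by (metis poly_0)
  define \<mu> where "\<mu> = {z :: complex. z ^ (n - 1) = 1}"
  have fin: "finite \<mu>"
  proof -
    have "\<mu> = {z. poly (monom 1 (n - 1) - 1) z = 0}" by (auto simp: \<mu>_def poly_monom)
    moreover have "monom 1 (n - 1) - 1 \<noteq> (0 :: complex poly)"
    proof
      assume "monom 1 (n - 1) - 1 = (0 :: complex poly)"
      then have "poly (monom 1 (n - 1) - 1) 0 = (0 :: complex)" by simp
      then show False using n by (simp add: poly_monom power_0_left)
    qed
    ultimately show ?thesis by (metis poly_roots_finite)
  qed
  define u v where "u = x - x ^ n" and "v = y - y ^ n"
  define S where "S = {u, v, v * x - y * u, smult a u + smult b v} \<union> (\<lambda>\<rho>. v - smult \<rho> u) ` \<mu>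
     \<union> (\<Union>\<xi>\<in>\<mu>. (\<lambda>\<zeta>. ([:\<xi>:] - x) * v - ([:\<zeta>:] - y) * u) ` \<mu>)"
  have S: "finite S" using fin by (auto simp: S_def)
  have 1: "u \<noteq> 0" "v \<noteq> 0"
  proof -
    show "u \<noteq> 0"
    proof
      assume "u = 0"
      from vanish[OF this, of "\<lambda>x y. x - x ^ n"] have "p ^ n = p" if "a * p + b * q + c = 0" for p q
        using that by (simp add: u_def)
      with inv invariant_line_x_fixed[OF n ab] show False by blast
    qed
    show "v \<noteq> 0"
    proof
      assume "v = 0"
      from vanish[OF this, of "\<lambda>x y. y - y ^ n"] have "q ^ n = q" if "a * p + b * q + c = 0" for p q
        using that by (simp add: v_def)
      with inv invariant_line_y_fixed[OF n ab] show False by blast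
    qed
  qed
  have 2: "v * x - y * u \<noteq> 0"
  proof
    assume "v * x - y * u = 0"
    from vanish[OF this, of "\<lambda>x y. (y - y ^ n) * x - y * (x - x ^ n)"]
    have "(q - q ^ n) * p - q * (p - p ^ n) = 0" if "a * p + b * q + c = 0" for p q
      using that by (simp add: u_def v_def)
    with inv invariant_line_through_origin[OF n ab] show False by blast
  qed
  have 3: "smult a u + smult b v \<noteq> 0"
  proof
    assume "smult a u + smult b v = 0"
    from vanish[OF this, of "\<lambda>x y. a * (x - x ^ n) + b * (y - y ^ n)"]
    have "a * (p - p ^ n) + b * (q - q ^ n) = 0" if "a * p + b * q + c = 0" for p q
      using that by (simp add: u_def v_def)
    with inv invariant_line_tangent[OF ab] n show False by auto
  qed
  have 4: "v - smult \<rho> u \<noteq> 0" if "\<rho> \<in> \<mu>" for \<rho>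
  proof
    assume "v - smult \<rho> u = 0"
    from vanish[OF this, of "\<lambda>x y. (y - y ^ n) - \<rho> * (x - x ^ n)"]
    have "(q - q ^ n) - \<rho> * (p - p ^ n) = 0" if "a * p + b * q + c = 0" for p q
      using that by (simp add: u_def v_def)
    from tangents_through_point_at_infinity[OF n ab _ this inv] that contra show False
      by (auto simp: \<mu>_def)
  qed
  have 5: "([:\<xi>:] - x) * v - ([:\<zeta>:] - y) * u \<noteq> 0" if "\<xi> \<in> \<mu>" "\<zeta> \<in> \<mu>" for \<xi> \<zeta>
  proof
    assume "([:\<xi>:] - x) * v - ([:\<zeta>:] - y) * u = 0"
    from vanish[OF this, of "\<lambda>x y. (\<xi> - x) * (y - y ^ n) - (\<zeta> - y) * (x - x ^ n)"]
    have "(\<xi> - p) * (q - q ^ n) - (\<zeta> - q) * (p - p ^ n) = 0" if "a * p + b * q + c = 0" for p q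
      using that by (simp add: u_def v_def)
    from tangents_through_radial_point[OF n ab _ _ this inv] that contra show False
      by (auto simp: \<mu>_def)
  qed
  have S0: "P \<noteq> 0" if P: "P \<in> S" for P
  proof -
    consider "P = u" | "P = v" | "P = v * x - y * u" | "P = smult a u + smult b v"
      | \<rho> where "\<rho> \<in> \<mu>" "P = v - smult \<rho> u"
      | \<xi> \<zeta> where "\<xi> \<in> \<mu>" "\<zeta> \<in> \<mu>" "P = ([:\<xi>:] - x) * v - ([:\<zeta>:] - y) * u"
      using P unfolding S_def by blast
    then show ?thesis by cases (use 1 2 3 4 5 in \<open>simp_all only: not_False_eq_True\<close>)
  qed
  define K where "K = smult a x * (1 - x ^ (n - 1)) * (smult (2 * of_nat n) (y ^ (n - 1)) - 1 - x ^ (n - 1) - y ^ (n - 1))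
     + smult b y * (1 - y ^ (n - 1)) * (smult (2 * of_nat n) (x ^ (n - 1)) - 1 - x ^ (n - 1) - y ^ (n - 1))"
  define B where "B = (\<Union>P\<in>S. {t. poly P t = 0})"
  have "finite B"
    unfolding B_def using S S0 poly_roots_finite by blast
  moreover have "poly K t = 0" if "t \<notin> B" for t
  proof -
    have ne: "poly P t \<noteq> 0" if "P \<in> S" for P
      using \<open>t \<notin> B\<close> that by (auto simp: B_def)
    have "poly u t \<noteq> 0" "poly v t \<noteq> 0" "poly (v * x - y * u) t \<noteq> 0" "poly (smult a u + smult b v) t \<noteq> 0"
      by (rule ne; simp add: S_def)+
    moreover have "poly (v - smult \<rho> u) t \<noteq> 0" if "\<rho> ^ (n - 1) = 1" for \<rho>
      using that by (intro ne) (auto simp: S_def \<mu>_def)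
    moreover have "poly (([:\<xi>:] - x) * v - ([:\<zeta>:] - y) * u) t \<noteq> 0" if "\<xi> ^ (n - 1) = 1" "\<zeta> ^ (n - 1) = 1" for \<xi> \<zeta>
      using that by (intro ne) (auto simp: S_def \<mu>_def)
    ultimately show ?thesis
      using flat_line_condition_at[OF n flat on[of t]]
      by (simp add: K_def u_def v_def mult.assoc)
  qed
  ultimately have "K = 0" by (rule poly_eq_0_if_zero_off_finite)
  from vanish[OF this, of "\<lambda>x y. a * x * (1 - x ^ (n - 1)) * (2 * of_nat n * y ^ (n - 1) - 1 - x ^ (n - 1) - y ^ (n - 1))
      + b * y * (1 - y ^ (n - 1)) * (2 * of_nat n * x ^ (n - 1) - 1 - x ^ (n - 1) - y ^ (n - 1))"]
  have "barycenter_condition n a b c"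
    using n by (intro barycenter_conditionI ab) (simp_all add: K_def mult.assoc)
  with contra show False by simp
qed

section \<open>Solving the barycenter condition\<close>

lemma barycenter_condition_zero_coefficient:
  assumes n: "n \<ge> 2" and P: "barycenter_condition n a b 0"
  shows "b ^ n * (- a) = (- a) ^ n * b"
proof (cases "a = 0 \<or> b = 0")
  case True
  then show ?thesis using n by (auto simp: power_0_left)
next
  case False
  define A B where "A = b ^ (n - 1)" and "B = (- a) ^ (n - 1)"
  have "B = A"
  proof (rule ccontr)
    assume ne: "B \<noteq> A"
    \<comment> \<open>As \<open>c = 0\<close>, the points \<open>(s b : - s a : 1)\<close> lie on
      the line and the right side of the condition vanishes. The equations for \<open>s = 1\<close>
      and \<open>s = 2\<close> contradict each other.\<close>
    have eq: "2 * of_nat n - 1 = s ^ (n - 1) * (A + B)" if "s \<noteq> 0" for s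
    proof -
      have "a * (s * b) + b * (s * (- a)) + 0 * 1 = 0" by simp
      with P have "a * (s * b) * ((s * (- a)) ^ (n - 1) - (s * b) ^ (n - 1)) *
         (2 * of_nat n * 1 ^ (n - 1) - ((s * b) ^ (n - 1) + (s * (- a)) ^ (n - 1) + 1 ^ (n - 1))) = 0"
        unfolding barycenter_condition_def Let_def by fastforce
      then have "a * (s * b) * s ^ (n - 1) * (B - A) * (2 * of_nat n - 1 - s ^ (n - 1) * (A + B)) = 0"
        unfolding power_mult_distrib A_def B_def by (simp add: algebra_simps)
      with False that ne show ?thesis by simp
    qed
    have n0: "(2 * of_nat n - 1 :: complex) \<noteq> 0"
    proof
      assume "2 * of_nat n - 1 = (0 :: complex)"
      then have "of_nat (2 * n) = (of_nat 1 :: complex)" by simp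
      then have "2 * n = 1" by (simp only: of_nat_eq_iff)
      then show False by presburger
    qed
    have AB: "A + B = 2 * of_nat n - 1" using eq[of 1] by simp
    have "(2 :: complex) ^ (n - 1) = 1" using eq[of 2] n0 unfolding AB by simp
    then have "of_nat (2 ^ (n - 1)) = (of_nat 1 :: complex)" by simp
    then have "(2 :: nat) ^ (n - 1) = 1" by (simp only: of_nat_eq_iff)
    then show False using n by simp
  qed
  then show ?thesis
    using n by (cases n) (auto simp: A_def B_def)
qed

text \<open>Since \<open>3 C(2m + 1, 3) = (2m + 1) C(2m, 2)\<close>, the equation amounts to
  \<open>3 m (m - 1) = 2 m (2 m - 1)\<close>, whose roots are 0 and -1.\<close>

lemma nat_binomial_contradiction:
  assumes m: "m \<ge> 2" and e: "(2 * m + 1) * (m choose 2) = (2 * m + 1) choose 3"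
  shows False
proof -
  have "3 * ((2 * m + 1) choose 3) = (2 * m + 1) * (2 * m choose 2)"
    using binomial_absorption[of 2 "2 * m + 1"] by (simp add: numeral_3_eq_3 numeral_2_eq_2)
  then have "(2 * m + 1) * (3 * (m choose 2)) = (2 * m + 1) * (2 * m choose 2)"
    unfolding e[symmetric] by (simp add: mult_ac)
  then have "3 * (m choose 2) = (2 * m choose 2)" by (simp only: mult_cancel1) simp
  then have 1: "3 * (2 * (m choose 2)) = 2 * (2 * m choose 2)" by simp
  have two: "2 * (k choose 2) = k * (k - 1)" for k :: nat
    using binomial_absorption[of 1 k] by (simp add: numeral_2_eq_2)
  obtain j where j: "m = 2 + j" using m le_Suc_ex by blast
  from 1 show False unfolding two j by (simp add: algebra_simps)
qed

text \<open>
  Expand the condition in powers of \<open>y\<close> at \<open>(- c : 0 : a)\<close>, with \<open>z = 1\<close> and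
  \<open>x = - c / a (1 + \<epsilon> y)\<close>: the terms containing \<open>y^(n - 1)\<close> do not affect the lower coefficients.
\<close>

lemma barycenter_condition_side_ratio:
  assumes n: "n \<ge> 2" and P: "barycenter_condition n a b c" and nz: "a \<noteq> 0" "b \<noteq> 0" "c \<noteq> 0"
  defines "s \<equiv> (- c / a) ^ (n - 1)"
  shows "s ^ 2 = 1" "n \<ge> 3 \<Longrightarrow> s = 1 \<and> n \<le> 4"
proof -
  define m where "m = n - 1"
  have nm: "n = Suc m" "m \<ge> 1" using n by (auto simp: m_def)
  define N :: complex where "N = 2 * of_nat n"
  define \<epsilon> where "\<epsilon> = b / c"
  have \<epsilon>0: "\<epsilon> \<noteq> 0" using nz by (simp add: \<epsilon>_def)
  define W where "W = [:1, \<epsilon>:]"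
  define M :: "complex poly" where "M = monom 1 m"
  \<comment> \<open>\<open>M * R\<close> collects the terms divisible by \<open>y^m\<close>; modulo
    \<open>y^m\<close> the condition is a relation between powers of
    \<open>W = 1 + \<epsilon> y\<close>.\<close>
  define R where "R = - W * ([:N - 1:] - smult s (W ^ m) - M) - smult s (W ^ Suc m) + 1
      + smult ((N - 1) * s) (W ^ m) - 1 - M"
  have eq: "poly (smult (s * (N - 1)) (W ^ Suc m - W ^ m) - smult (s ^ 2) (W ^ (2 * m + 1)) + 1 + M * R) y = 0" for y
  proof -
    define w Y where "w = 1 + \<epsilon> * y" and "Y = y ^ m"
    define x where "x = - c / a * w"
    have ax: "a * x = - c * w" using nz by (simp add: x_def)
    have "a * x + b * y + c * 1 = 0" unfolding ax using nz by (simp add: w_def \<epsilon>_def field_simps)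
    with P have "a * x * (y ^ m - x ^ m) * (N * 1 ^ m - (x ^ m + y ^ m + 1 ^ m)) =
       c * 1 * (1 ^ m - y ^ m) * (N * x ^ m - (x ^ m + y ^ m + 1 ^ m))"
      unfolding barycenter_condition_def Let_def N_def m_def by blast
    moreover have "x ^ m = s * w ^ m" by (simp only: x_def power_mult_distrib s_def m_def)
    ultimately have "c * (- w * (Y - s * w ^ m) * (N - (s * w ^ m + Y + 1)))
       = c * ((1 - Y) * (N * (s * w ^ m) - (s * w ^ m + Y + 1)))"
      unfolding ax Y_def by (simp add: mult_ac)
    then have "- w * (Y - s * w ^ m) * (N - (s * w ^ m + Y + 1)) = (1 - Y) * (N * (s * w ^ m) - (s * w ^ m + Y + 1))"
      using nz(3) by (metis mult_cancel_left)
    then have e: "- w * (Y - s * w ^ m) * (N - (s * w ^ m + Y + 1)) - (1 - Y) * (N * (s * w ^ m) - (s * w ^ m + Y + 1)) = 0"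
      by (simp only: diff_self)
    have p: "poly W y = w" "poly M y = Y"
      by (simp_all add: W_def M_def w_def Y_def poly_monom mult.commute)
    have "poly (smult (s * (N - 1)) (W ^ Suc m - W ^ m) - smult (s ^ 2) (W ^ (2 * m + 1)) + 1 + M * R) y
       = - w * (Y - s * w ^ m) * (N - (s * w ^ m + Y + 1)) - (1 - Y) * (N * (s * w ^ m) - (s * w ^ m + Y + 1))"
      unfolding R_def by (simp add: p power2_eq_square algebra_simps) (simp add: mult_2_right power_add)
    then show ?thesis using e by simp
  qed
  have Q: "smult (s * (N - 1)) (W ^ Suc m - W ^ m) - smult (s ^ 2) (W ^ (2 * m + 1)) + 1 + M * R = 0"
    by (rule poly_eq_0_if_zero_off_finite[of "{}"]) (use eq in auto)
  have coeffW: "coeff (W ^ j) i = of_nat (j choose i) * \<epsilon> ^ i" for i j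
  proof (cases "i \<le> j")
    case True
    then show ?thesis using coeff_linear_poly_power[OF True, of 1 \<epsilon>] by (simp add: W_def)
  next
    case False
    have "degree (W ^ j) \<le> j" using degree_power_le[of W j] \<epsilon>0 by (simp add: W_def)
    with False show ?thesis by (simp add: coeff_eq_0 binomial_eq_0)
  qed
  have coeff: "s * (N - 1) * of_nat ((Suc m choose i) - (m choose i)) * \<epsilon> ^ i
      - s ^ 2 * of_nat ((2 * m + 1) choose i) * \<epsilon> ^ i + (if i = 0 then 1 else 0) = 0" if "i < m" for i
  proof -
    have le: "m choose i \<le> Suc m choose i" by (cases i) auto
    have "coeff (smult (s * (N - 1)) (W ^ Suc m - W ^ m) - smult (s ^ 2) (W ^ (2 * m + 1)) + 1 + M * R) i =
      s * (N - 1) * (of_nat (Suc m choose i) * \<epsilon> ^ i - of_nat (m choose i) * \<epsilon> ^ i)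
      - s ^ 2 * (of_nat ((2 * m + 1) choose i) * \<epsilon> ^ i) + (if i = 0 then 1 else 0)"
      using that by (simp only: coeff_add coeff_diff coeff_smult coeffW M_def coeff_monom_mult coeff_1) auto
    then show ?thesis
      unfolding Q of_nat_diff[OF le] by (simp add: algebra_simps)
  qed
  show s2: "s ^ 2 = 1"
    using coeff[of 0] nm(2) by simp
  show "s = 1 \<and> n \<le> 4" if "n \<ge> 3"
  proof -
    have N1: "N - 1 = of_nat (2 * m + 1)" by (simp add: N_def nm(1))
    have N10: "N - 1 \<noteq> 0" unfolding N1 by (simp only: of_nat_eq_0_iff)
    have "s * (N - 1) * \<epsilon> - s ^ 2 * (N - 1) * \<epsilon> = 0"
      using coeff[of 1] that nm unfolding N1 by simp
    then have "(s - s ^ 2) * ((N - 1) * \<epsilon>) = 0" by (simp add: algebra_simps)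
    then have s: "s = 1" using N10 \<epsilon>0 s2 by simp
    have "n \<le> 4"
    proof (rule ccontr)
      assume "\<not> n \<le> 4"
      \<comment> \<open>With \<open>s = 1\<close> the coefficient of \<open>y^2\<close> vanishes by
        itself, because \<open>(2 m + 1) m = C(2 m + 1, 2)\<close>. The first obstruction to large
        \<open>n\<close> is the coefficient of \<open>y^3\<close>, unaffected by
        \<open>M * R\<close> once \<open>m > 3\<close>.\<close>
      then have m4: "3 < m" using nm by simp
      have "(Suc m choose 3) - (m choose 3) = m choose 2"
        by (simp add: numeral_3_eq_3 numeral_2_eq_2)
      then have "((N - 1) * of_nat (m choose 2) - of_nat ((2 * m + 1) choose 3)) * \<epsilon> ^ 3 = 0"
        using coeff[OF m4] s by (simp add: algebra_simps)
      then have "(N - 1) * of_nat (m choose 2) = of_nat ((2 * m + 1) choose 3)"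
        using \<epsilon>0 by simp
      then have "of_nat ((2 * m + 1) * (m choose 2)) = (of_nat ((2 * m + 1) choose 3) :: complex)"
        unfolding N1 by (simp only: of_nat_mult)
      then have "(2 * m + 1) * (m choose 2) = (2 * m + 1) choose 3"
        by (simp only: of_nat_eq_iff)
      then show False using nat_binomial_contradiction[of m] m4 by simp
    qed
    with s show ?thesis by simp
  qed
qed

lemma barycenter_condition_cases:
  assumes n: "n \<ge> 2" and P: "barycenter_condition n a b c" and l: "a \<noteq> 0 \<or> b \<noteq> 0 \<or> c \<noteq> 0"
    and inv: "\<not> invariant_line (fermat_form n) (vector [a, b, c])"
  shows "a \<noteq> 0" and "(n = 2 \<and> ((b = a \<and> c = - a) \<or> (b = - a \<and> c = a) \<or> (b = - a \<and> c = - a)))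
     \<or> (n = 3 \<and> b ^ 2 = a ^ 2 \<and> c ^ 2 = a ^ 2)"
proof -
  note P' = barycenter_condition_rotate[OF P]
  note P'' = barycenter_condition_rotate[OF P']
  have "a \<noteq> 0 \<and> b \<noteq> 0 \<and> c \<noteq> 0"
    using side_ratios[OF n l inv] barycenter_condition_zero_coefficient[OF n] P P' P'' by metis
  then have nz: "a \<noteq> 0" "b \<noteq> 0" "c \<noteq> 0" by auto
  then show "a \<noteq> 0" by simp
  note r1 = barycenter_condition_side_ratio[OF n P nz]
  note r2 = barycenter_condition_side_ratio[OF n P' nz(2,3,1)]
  note r3 = barycenter_condition_side_ratio[OF n P'' nz(3,1,2)]
  show "(n = 2 \<and> ((b = a \<and> c = - a) \<or> (b = - a \<and> c = a) \<or> (b = - a \<and> c = - a)))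
     \<or> (n = 3 \<and> b ^ 2 = a ^ 2 \<and> c ^ 2 = a ^ 2)"
  proof (cases "n = 2")
    case True
    have "(- c / a) ^ 2 = 1" "(- a / b) ^ 2 = 1" using r1(1) r2(1) True by simp_all
    then have "c ^ 2 = a ^ 2" "b ^ 2 = a ^ 2"
      using nz by (auto simp: power_divide field_simps)
    then have "c = a \<or> c = - a" "b = a \<or> b = - a"
      by (simp_all add: power2_eq_iff)
    moreover have "\<not> (b = a \<and> c = a)"
    proof
      assume e: "b = a \<and> c = a"
      \<comment> \<open>For \<open>n = 2\<close> the ratios leave the signs open. The line
        \<open>x + y + z = 0\<close> is excluded by the point \<open>(1, 2, -3)\<close>: there
        \<open>T = 0\<close>, and the two sides are \<open>-12 a\<close> and
        \<open>60 a\<close>.\<close>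
      have "a * 1 + b * 2 + c * (- 3) = 0" using e by (simp add: algebra_simps)
      with P have "a * 1 * (2 ^ (n - 1) - 1 ^ (n - 1)) * (2 * of_nat n * (- 3) ^ (n - 1) - (1 ^ (n - 1) + 2 ^ (n - 1) + (- 3) ^ (n - 1))) =
         c * (- 3) * ((- 3) ^ (n - 1) - 2 ^ (n - 1)) * (2 * of_nat n * 1 ^ (n - 1) - (1 ^ (n - 1) + 2 ^ (n - 1) + (- 3) ^ (n - 1)))"
        unfolding barycenter_condition_def Let_def by blast
      with True e nz show False by simp
    qed
    ultimately show ?thesis using True by auto
  next
    case False
    then have n3: "n \<ge> 3" using n by simp
    have n4: "n \<le> 4" using r1(2)[OF n3] by simp
    have s: "(- c / a) ^ (n - 1) = 1" "(- a / b) ^ (n - 1) = 1" "(- b / c) ^ (n - 1) = 1"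
      using r1(2)[OF n3] r2(2)[OF n3] r3(2)[OF n3] by auto
    \<comment> \<open>The three quotients multiply to \<open>-1\<close>, so \<open>n - 1\<close> is
      even.\<close>
    have "((- c / a) * (- a / b) * (- b / c)) ^ (n - 1) = 1"
      unfolding power_mult_distrib s by simp
    also have "(- c / a) * (- a / b) * (- b / c) = - 1" using nz by simp
    finally have "n \<noteq> 4" by auto
    with n3 n4 have n: "n = 3" by simp
    then have "(- c / a) ^ 2 = 1" "(- a / b) ^ 2 = 1" using s by simp_all
    then have "c ^ 2 = a ^ 2" "b ^ 2 = a ^ 2"
      using nz by (auto simp: power_divide field_simps)
    with n show ?thesis by simp
  qed
qed

section \<open>Radial singularities\<close>

lemma det_eq_0_if_covector:
  fixes k s e f :: "complex^3"
  assumes "k \<noteq> 0" "pairing k s = 0" "pairing k e = 0" "pairing k f = 0"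
  shows "det (vector [s, e, f] :: complex^3^3) = 0"
proof -
  have D: "k$1 * det (vector [s, e, f] :: complex^3^3) = 0" "k$2 * det (vector [s, e, f] :: complex^3^3) = 0"
    "k$3 * det (vector [s, e, f] :: complex^3^3) = 0"
    using assms(2-4) unfolding pairing_def sum_3 det_3 vector_3 by algebra+
  have "k$1 \<noteq> 0 \<or> k$2 \<noteq> 0 \<or> k$3 \<noteq> 0"
    using assms(1) by (auto simp: vec_eq_iff forall_3)
  with D show ?thesis by auto
qed

lemma pairing_add: "pairing k (u + v) = pairing k u + pairing k v"
  and pairing_scale: "pairing k (c *s v) = c * pairing k v"
  by (simp_all add: pairing_def sum_3 algebra_simps)

text \<open>
  At a radial singularity \<open>s\<close> the linear part of \<open>\<Omega>\<close> is skew on a complement of \<open>s\<close>.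
\<close>

lemma radial_skew:
  assumes "radial \<Omega> s"
  obtains e f where "det (vector [s, e, f] :: complex^3^3) \<noteq> 0"
    "\<And>\<alpha> \<beta>. ((\<lambda>t. pairing (\<Omega> (s + t *s (\<alpha> *s e + \<beta> *s f))) (\<alpha> *s e + \<beta> *s f)) has_field_derivative 0) (at 0)"
proof -
  obtain e f c where det: "det (vector [s, e, f] :: complex^3^3) \<noteq> 0"
    and D: "(local_field \<Omega> s e f has_derivative (\<lambda>(u, v). (c * u, c * v))) (at (0, 0))"
    using assms unfolding radial_def by blast
  show ?thesis
  proof (rule that[OF det])
    fix \<alpha> \<beta> :: complex
    define L where "L t = local_field \<Omega> s e f (\<alpha> * t, \<beta> * t)" for t
    have "((\<lambda>t. (\<alpha> * t, \<beta> * t)) has_derivative (\<lambda>h. (\<alpha> * h, \<beta> * h))) (at 0)"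
      by (intro has_derivative_Pair has_derivative_mult_right has_derivative_ident)
    from has_derivative_compose[OF this] D
    have L: "(L has_derivative (\<lambda>h. (c * (\<alpha> * h), c * (\<beta> * h)))) (at 0)"
      unfolding L_def by fastforce
    have "((\<lambda>t. fst (L t)) has_field_derivative c * \<alpha>) (at 0)" "((\<lambda>t. snd (L t)) has_field_derivative c * \<beta>) (at 0)"
      using has_derivative_fst[OF L] has_derivative_snd[OF L]
      unfolding has_field_derivative_def fst_conv snd_conv mult.assoc[symmetric] by simp_all
    then have "((\<lambda>t. \<beta> * fst (L t) - \<alpha> * snd (L t)) has_field_derivative (\<beta> * (c * \<alpha>) - \<alpha> * (c * \<beta>))) (at 0)"
      by (intro DERIV_diff DERIV_cmult)
    moreover have "\<beta> * fst (L t) - \<alpha> * snd (L t) =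
        pairing (\<Omega> (s + t *s (\<alpha> *s e + \<beta> *s f))) (\<alpha> *s e + \<beta> *s f)" for t
      by (simp add: L_def local_field_def Let_def pairing_add pairing_scale vec.scale_right_distrib
          vector_add_ldistrib vector_smult_assoc mult_ac add.assoc)
    ultimately show "((\<lambda>t. pairing (\<Omega> (s + t *s (\<alpha> *s e + \<beta> *s f))) (\<alpha> *s e + \<beta> *s f)) has_field_derivative 0) (at 0)"
      by (simp add: mult_ac)
  qed
qed

text \<open>At a radial point the quadratic form would vanish on the plane spanned by
  \<open>e\<close> and \<open>f\<close>. A product of two linear forms does so only if one factor
  does; that covector also annihilates \<open>s\<close>, hence a whole basis.\<close>

lemma not_radial_if_quadratic_part_splits:
  assumes quad: "\<And>h. ((\<lambda>t. pairing (\<Omega> (s + t *s h)) h) has_field_derivative k * (pairing L h * pairing M h)) (at 0)"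
    and k: "k \<noteq> 0" and L: "L \<noteq> 0" "pairing L s = 0" and M: "M \<noteq> 0" "pairing M s = 0"
  shows "\<not> radial \<Omega> s"
proof
  assume "radial \<Omega> s"
  then obtain e f where det: "det (vector [s, e, f] :: complex^3^3) \<noteq> 0"
    and D: "\<And>\<alpha> \<beta>. ((\<lambda>t. pairing (\<Omega> (s + t *s (\<alpha> *s e + \<beta> *s f))) (\<alpha> *s e + \<beta> *s f)) has_field_derivative 0) (at 0)"
    by (rule radial_skew) blast
  have z: "pairing L (\<alpha> *s e + \<beta> *s f) * pairing M (\<alpha> *s e + \<beta> *s f) = 0" for \<alpha> \<beta>
    using DERIV_unique[OF D quad] k by (metis mult_eq_0_iff)
  have "pairing L e * pairing M e = 0" "pairing L f * pairing M f = 0"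
     "(pairing L e + pairing L f) * (pairing M e + pairing M f) = 0"
    using z[of 1 0] z[of 0 1] z[of 1 1] by (simp_all add: pairing_add pairing_scale)
  then have "(pairing L e = 0 \<and> pairing L f = 0) \<or> (pairing M e = 0 \<and> pairing M f = 0)"
    by auto
  with det_eq_0_if_covector[OF L, of e f] det_eq_0_if_covector[OF M, of e f] det show False by auto
qed

lemma fermat_singular_iff:
  "singular (fermat_form n) s \<longleftrightarrow> s \<noteq> 0 \<and> s$2 ^ n * s$3 = s$3 ^ n * s$2 \<and>
     s$3 ^ n * s$1 = s$1 ^ n * s$3 \<and> s$1 ^ n * s$2 = s$2 ^ n * s$1"
  by (simp add: singular_def fermat_form_def Let_def vec_eq_iff forall_3)

text \<open>The points concerned lie on an axis but are not vertices. For \<open>x = 0\<close> the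
  quadratic part is \<open>n h\<^sub>1 (y^(n - 1) z h\<^sub>2 - z^(n - 1) y h\<^sub>3)\<close>; the
  first factor annihilates \<open>s\<close> because \<open>x = 0\<close>, the second because
  \<open>s\<close> is singular.\<close>

lemma fermat_not_radial:
  assumes n: "n \<ge> 2" and s: "singular (fermat_form n) s"
    and one: "s$1 = 0 \<and> s$2 \<noteq> 0 \<and> s$3 \<noteq> 0 \<or> s$1 \<noteq> 0 \<and> s$2 = 0 \<and> s$3 \<noteq> 0 \<or> s$1 \<noteq> 0 \<and> s$2 \<noteq> 0 \<and> s$3 = 0"
  shows "\<not> radial (fermat_form n) s"
proof -
  define x y z where "x = s$1" and "y = s$2" and "z = s$3"
  have n1: "0 < n" "0 < n - 1" using n by auto
  have pw: "w ^ n = w * w ^ (n - 1)" for w :: complex using n by (cases n) auto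
  have sing: "y ^ n * z = z ^ n * y" "z ^ n * x = x ^ n * z" "x ^ n * y = y ^ n * x"
    using s by (simp_all add: fermat_singular_iff x_def y_def z_def)
  have quad: "((\<lambda>t. pairing (fermat_form n (s + t *s h)) h) has_field_derivative
     (of_nat n * y ^ (n - 1) * h$2 * z + y ^ n * h$3 - (of_nat n * z ^ (n - 1) * h$3 * y + z ^ n * h$2)) * h$1
     + (of_nat n * z ^ (n - 1) * h$3 * x + z ^ n * h$1 - (of_nat n * x ^ (n - 1) * h$1 * z + x ^ n * h$3)) * h$2
     + (of_nat n * x ^ (n - 1) * h$1 * y + x ^ n * h$2 - (of_nat n * y ^ (n - 1) * h$2 * x + y ^ n * h$1)) * h$3) (at 0)" for h
    unfolding fermat_form_pairing x_def y_def z_def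
    by (auto intro!: derivative_eq_intros simp: algebra_simps)
  from one consider "x = 0" "y \<noteq> 0" "z \<noteq> 0" | "x \<noteq> 0" "y = 0" "z \<noteq> 0" | "x \<noteq> 0" "y \<noteq> 0" "z = 0"
    by (auto simp: x_def y_def z_def)
  then show ?thesis
  proof cases
    case 1
    show ?thesis
    proof (rule not_radial_if_quadratic_part_splits[of _ _ "of_nat n" "vector [1, 0, 0]" "vector [0, y ^ (n - 1) * z, - (z ^ (n - 1) * y)]"])
      fix h
      show "((\<lambda>t. pairing (fermat_form n (s + t *s h)) h) has_field_derivative
          of_nat n * (pairing (vector [1, 0, 0]) h * pairing (vector [0, y ^ (n - 1) * z, - (z ^ (n - 1) * y)]) h)) (at 0)"
        by (rule DERIV_cong[OF quad])
           (use n1 in \<open>simp add: pairing_def sum_3 1 power_0_left algebra_simps\<close>)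
    qed (use n1 1 sing(1) pw[of y] pw[of z] in \<open>auto simp: pairing_def sum_3 vec_eq_iff forall_3 x_def y_def z_def\<close>)
  next
    case 2
    show ?thesis
    proof (rule not_radial_if_quadratic_part_splits[of _ _ "of_nat n" "vector [0, 1, 0]" "vector [- (x ^ (n - 1) * z), 0, z ^ (n - 1) * x]"])
      fix h
      show "((\<lambda>t. pairing (fermat_form n (s + t *s h)) h) has_field_derivative
          of_nat n * (pairing (vector [0, 1, 0]) h * pairing (vector [- (x ^ (n - 1) * z), 0, z ^ (n - 1) * x]) h)) (at 0)"
        by (rule DERIV_cong[OF quad])
           (use n1 in \<open>simp add: pairing_def sum_3 2 power_0_left algebra_simps\<close>)
    qed (use n1 2 sing(2) pw[of x] pw[of z] in \<open>auto simp: pairing_def sum_3 vec_eq_iff forall_3 x_def y_def z_def\<close>)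
  next
    case 3
    show ?thesis
    proof (rule not_radial_if_quadratic_part_splits[of _ _ "of_nat n" "vector [0, 0, 1]" "vector [x ^ (n - 1) * y, - (y ^ (n - 1) * x), 0]"])
      fix h
      show "((\<lambda>t. pairing (fermat_form n (s + t *s h)) h) has_field_derivative
          of_nat n * (pairing (vector [0, 0, 1]) h * pairing (vector [x ^ (n - 1) * y, - (y ^ (n - 1) * x), 0]) h)) (at 0)"
        by (rule DERIV_cong[OF quad])
           (use n1 in \<open>simp add: pairing_def sum_3 3 power_0_left algebra_simps\<close>)
    qed (use n1 3 sing(3) pw[of x] pw[of y] in \<open>auto simp: pairing_def sum_3 vec_eq_iff forall_3 x_def y_def z_def\<close>)
  qed
qed

section \<open>Singularities on the line\<close>

lemma proj_point_scale:
  assumes "k \<noteq> 0"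
  shows "proj_point (k *s v) = proj_point v"
proof
  show "proj_point (k *s v) \<subseteq> proj_point v"
    using assms by (auto simp: proj_point_def vector_smult_assoc)
  show "proj_point v \<subseteq> proj_point (k *s v)"
  proof
    fix w assume "w \<in> proj_point v"
    then obtain c where "w = c *s v" "c \<noteq> 0" by (auto simp: proj_point_def)
    with assms show "w \<in> proj_point (k *s v)"
      by (auto simp: proj_point_def vector_smult_assoc intro!: exI[of _ "c / k"])
  qed
qed

lemma card_proj_points:
  assumes S: "\<And>s. s \<in> S \<longleftrightarrow> (\<exists>k v. k \<noteq> 0 \<and> v \<in> vs \<and> s = k *s v)"
    and inj: "\<And>v w k. v \<in> vs \<Longrightarrow> w \<in> vs \<Longrightarrow> v = k *s w \<Longrightarrow> v = w"
  shows "card (proj_point ` S) = card vs"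
proof -
  have "proj_point ` S = proj_point ` vs"
  proof
    show "proj_point ` S \<subseteq> proj_point ` vs"
      using proj_point_scale by (auto simp: S)
    have "v \<in> S" if "v \<in> vs" for v
      unfolding S by (rule exI[of _ 1], rule exI[of _ v]) (use that in simp)
    then show "proj_point ` vs \<subseteq> proj_point ` S" by auto
  qed
  moreover have "inj_on proj_point vs"
  proof (rule inj_onI)
    fix v w assume "v \<in> vs" "w \<in> vs" and eq: "proj_point v = proj_point w"
    have "v \<in> proj_point v" unfolding proj_point_def by (force intro: exI[of _ 1])
    then show "v = w" using inj[OF \<open>v \<in> vs\<close> \<open>w \<in> vs\<close>] unfolding eq by (auto simp: proj_point_def)
  qed
  ultimately show ?thesis by (simp add: card_image)
qed

text \<open>Each of the three lines passes through exactly two of the points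
  \<open>(0 : 1 : 1)\<close>, \<open>(1 : 0 : 1)\<close>, \<open>(1 : 1 : 0)\<close>; the relation
  between the coefficients in each disjunct records which of them are on the line.\<close>

lemma singular_on_line_2:
  fixes a b c :: complex
  assumes a: "a \<noteq> 0" and bc: "b = a \<and> c = - a \<or> b = - a \<and> c = a \<or> b = - a \<and> c = - a"
    and s: "singular (fermat_form 2) s" "on_line (vector [a, b, c]) s"
  shows "s$1 = 0 \<and> s$2 \<noteq> 0 \<and> s$3 = s$2 \<and> c = - b \<or> s$2 = 0 \<and> s$1 \<noteq> 0 \<and> s$3 = s$1 \<and> c = - a
    \<or> s$3 = 0 \<and> s$1 \<noteq> 0 \<and> s$2 = s$1 \<and> b = - a"
proof -
  define x y z where "x = s$1" and "y = s$2" and "z = s$3"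
  have nz: "x \<noteq> 0 \<or> y \<noteq> 0 \<or> z \<noteq> 0"
    using s(1) by (auto simp: fermat_singular_iff vec_eq_iff forall_3 x_def y_def z_def)
  have "y ^ 2 * z = z ^ 2 * y" "z ^ 2 * x = x ^ 2 * z" "x ^ 2 * y = y ^ 2 * x"
    using s(1) by (simp_all add: fermat_singular_iff x_def y_def z_def)
  then have h: "y = 0 \<or> z = 0 \<or> y = z" "z = 0 \<or> x = 0 \<or> z = x" "x = 0 \<or> y = 0 \<or> x = y"
    by (auto simp: power2_eq_square)
  \<comment> \<open>At a singularity for \<open>n = 2\<close> the nonzero coordinates are equal. If
    one coordinate is the sum \<open>u + v\<close> of the others with both summands nonzero, then
    \<open>u = v\<close>, and the sum, being different from \<open>u\<close>, is 0.\<close>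
  have add: "u = 0 \<or> v = 0"
    if "u = 0 \<or> v = 0 \<or> u = v" "u + v = 0 \<or> u = 0 \<or> u + v = u" for u v :: complex
  proof (rule ccontr)
    assume "\<not> ?thesis"
    with that have "u = v" "u + v = 0" by auto
    then have "2 * u = 0" by simp
    with \<open>\<not> ?thesis\<close> show False by simp
  qed
  have on: "a * x + b * y + c * z = 0" using s(2) by (simp add: on_line_vector x_def y_def z_def)
  from bc have "x = 0 \<and> y \<noteq> 0 \<and> z = y \<and> c = - b \<or> y = 0 \<and> x \<noteq> 0 \<and> z = x \<and> c = - a
    \<or> z = 0 \<and> x \<noteq> 0 \<and> y = x \<and> b = - a"
  proof (elim disjE conjE)
    assume bc: "b = a" "c = - a"
    then have "a * (x + y - z) = 0" using on by (simp add: algebra_simps)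
    then have "z = x + y" using a by simp
    moreover from this have "x = 0 \<or> y = 0" using h add[of x y] by auto
    ultimately show ?thesis using nz bc by auto
  next
    assume bc: "b = - a" "c = a"
    then have "a * (x + z - y) = 0" using on by (simp add: algebra_simps)
    then have "y = x + z" using a by simp
    moreover from this have "x = 0 \<or> z = 0" using h add[of x z] by auto
    ultimately show ?thesis using nz bc by auto
  next
    assume bc: "b = - a" "c = - a"
    then have "a * (y + z - x) = 0" using on by (simp add: algebra_simps)
    then have "x = y + z" using a by simp
    moreover from this have "y = 0 \<or> z = 0" using h add[of y z] by auto
    ultimately show ?thesis using nz bc by auto
  qed
  then show ?thesis by (simp add: x_def y_def z_def)
qed

lemma singular_on_line_3:
  fixes a b c :: complex
  assumes a: "a \<noteq> 0" and bc: "b ^ 2 = a ^ 2" "c ^ 2 = a ^ 2"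
    and s: "singular (fermat_form 3) s" "on_line (vector [a, b, c]) s"
  shows "\<exists>k. k \<noteq> 0 \<and> (s = k *s vector [0, c, - b] \<or> s = k *s vector [- c, 0, a] \<or> s = k *s vector [b, - a, 0])"
proof -
  define x y z where "x = s$1" and "y = s$2" and "z = s$3"
  have b: "b \<noteq> 0" "c \<noteq> 0" using a bc by auto
  have nz: "x \<noteq> 0 \<or> y \<noteq> 0 \<or> z \<noteq> 0"
    using s(1) by (auto simp: fermat_singular_iff vec_eq_iff forall_3 x_def y_def z_def)
  have on: "a * x + b * y + c * z = 0" using s(2) by (simp add: on_line_vector x_def y_def z_def)
  have eqs: "y ^ 3 * z = z ^ 3 * y" "z ^ 3 * x = x ^ 3 * z" "x ^ 3 * y = y ^ 3 * x"
    using s(1) by (simp_all add: fermat_singular_iff x_def y_def z_def)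
  \<comment> \<open>Off the axes a singularity has \<open>x^2 = y^2 = z^2\<close>, so
    \<open>a x\<close>, \<open>b y\<close>, \<open>c z\<close> have a common nonzero square. Such
    numbers cannot sum to 0: solving for \<open>a x\<close> and squaring twice would give
    \<open>4 (a x)^4 = (a x)^4\<close>.\<close>
  have "x = 0 \<or> y = 0 \<or> z = 0"
  proof (rule ccontr)
    assume "\<not> ?thesis"
    then have n0: "x \<noteq> 0" "y \<noteq> 0" "z \<noteq> 0" by auto
    have "x * y * (x ^ 2 - y ^ 2) = x ^ 3 * y - y ^ 3 * x" "x * z * (z ^ 2 - x ^ 2) = z ^ 3 * x - x ^ 3 * z"
      by (simp_all add: power2_eq_square power3_eq_cube algebra_simps)
    then have "x * y * (x ^ 2 - y ^ 2) = 0" "x * z * (z ^ 2 - x ^ 2) = 0"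
      using eqs by simp_all
    then have yz: "y ^ 2 = x ^ 2" "z ^ 2 = x ^ 2" using n0 by simp_all
    have sq: "(b * y) ^ 2 = (a * x) ^ 2" "(c * z) ^ 2 = (a * x) ^ 2"
      by (simp_all add: power_mult_distrib bc yz)
    have "a * x = - (b * y + c * z)" using on by algebra
    then have "(a * x) ^ 2 = (b * y) ^ 2 + (c * z) ^ 2 + 2 * (b * y) * (c * z)"
      by (simp only: power2_minus power2_sum)
    then have "2 * (b * y) * (c * z) = (a * x) ^ 2 - (b * y) ^ 2 - (c * z) ^ 2"
      by (simp only: diff_diff_eq add_diff_cancel_left')
    also have "\<dots> = - ((a * x) ^ 2)"
      unfolding sq by simp
    finally have "2 * (b * y) * (c * z) = - ((a * x) ^ 2)" .
    then have "(2 * (b * y) * (c * z)) ^ 2 = (a * x) ^ 4" by (simp add: power2_eq_square power4_eq_xxxx)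
    moreover have "(2 * (b * y) * (c * z)) ^ 2 = 4 * (a * x) ^ 4"
      unfolding power_mult_distrib bc yz by (simp add: power2_eq_square power4_eq_xxxx)
    ultimately have "3 * (a * x) ^ 4 = 0" by algebra
    with a n0 show False by simp
  qed
  then consider "x = 0" | "y = 0" | "z = 0" by auto
  then show ?thesis
  proof cases
    case 1
    have "z = y / c * - b" "y \<noteq> 0" using on nz 1 b by (auto simp: field_simps eq_neg_iff_add_eq_0)
    then have "s = (y / c) *s vector [0, c, - b]"
      using 1 b by (simp add: vec_eq_iff forall_3 x_def y_def z_def)
    with \<open>y \<noteq> 0\<close> b show ?thesis by (intro exI[of _ "y / c"]) simp
  next
    case 2
    have "x = z / a * - c" "z \<noteq> 0" using on nz 2 a by (auto simp: field_simps eq_neg_iff_add_eq_0)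
    then have "s = (z / a) *s vector [- c, 0, a]"
      using 2 a by (simp add: vec_eq_iff forall_3 x_def y_def z_def)
    with \<open>z \<noteq> 0\<close> a show ?thesis by (intro exI[of _ "z / a"]) simp
  next
    case 3
    have "y = x / b * - a" "x \<noteq> 0" using on nz 3 b by (auto simp: field_simps eq_neg_iff_add_eq_0)
    then have "s = (x / b) *s vector [b, - a, 0]"
      using 3 b by (simp add: vec_eq_iff forall_3 x_def y_def z_def)
    with \<open>x \<noteq> 0\<close> b show ?thesis by (intro exI[of _ "x / b"]) simp
  qed
qed

lemma card_singular_on_line_3:
  fixes a b c :: complex
  assumes a: "a \<noteq> 0" and bc: "b ^ 2 = a ^ 2" "c ^ 2 = a ^ 2"
  shows "card (proj_point ` {s. singular (fermat_form 3) s \<and> on_line (vector [a, b, c]) s}) = 3"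
proof -
  have b: "b \<noteq> 0" "c \<noteq> 0" using a bc by auto
  define vs :: "(complex^3) set" where "vs = {vector [0, c, - b], vector [- c, 0, a], vector [b, - a, 0]}"
  have "card (proj_point ` {s. singular (fermat_form 3) s \<and> on_line (vector [a, b, c]) s}) = card vs"
  proof (rule card_proj_points)
    fix s
    have "b ^ 3 = a ^ 2 * b" "c ^ 3 = a ^ 2 * c" "a ^ 3 = a ^ 2 * a"
      using bc by (simp_all add: power3_eq_cube power2_eq_square mult_ac)
    then have "singular (fermat_form 3) (k *s v) \<and> on_line (vector [a, b, c]) (k *s v)"
      if "k \<noteq> 0" "v \<in> vs" for k v
      using that a b
      by (auto simp: vs_def fermat_singular_iff on_line_vector vec_eq_iff forall_3 power_mult_distrib)
    then show "s \<in> {s. singular (fermat_form 3) s \<and> on_line (vector [a, b, c]) s} \<longleftrightarrow> (\<exists>k v. k \<noteq> 0 \<and> v \<in> vs \<and> s = k *s v)"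
      using singular_on_line_3[OF a bc, of s] by (auto simp: vs_def)
  next
    fix v w :: "complex^3" and k
    assume "v \<in> vs" "w \<in> vs" "v = k *s w"
    then show "v = w"
      using a b by (auto simp: vs_def vec_eq_iff forall_3)
  qed
  also have "card vs = 3"
    using a b by (simp add: vs_def vec_eq_iff forall_3 card_insert_if)
  finally show ?thesis .
qed

lemma card_singular_on_line_2:
  fixes a b c :: complex
  assumes a: "a \<noteq> 0" and bc: "b = a \<and> c = - a \<or> b = - a \<and> c = a \<or> b = - a \<and> c = - a"
  shows "card (proj_point ` {s. singular (fermat_form 2) s \<and> on_line (vector [a, b, c]) s}) = 2"
proof -
  \<comment> \<open>Those of the three side points that lie on the given line; in each case of
    \<open>bc\<close> exactly two of the tests succeed.\<close>
  define vs :: "(complex^3) set" where "vs = (if c = - b then {vector [0, 1, 1]} else {})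
    \<union> (if c = - a then {vector [1, 0, 1]} else {}) \<union> (if b = - a then {vector [1, 1, 0]} else {})"
  have aa: "a \<noteq> - a" "- a \<noteq> a" using a by auto
  have "card (proj_point ` {s. singular (fermat_form 2) s \<and> on_line (vector [a, b, c]) s}) = card vs"
  proof (rule card_proj_points)
    fix s
    have 1: "singular (fermat_form 2) (k *s v) \<and> on_line (vector [a, b, c]) (k *s v)"
      if "k \<noteq> 0" "v \<in> vs" for k v
      using that
      by (auto simp: vs_def fermat_singular_iff on_line_vector vec_eq_iff forall_3 split: if_splits)
    have 2: "\<exists>k v. k \<noteq> 0 \<and> v \<in> vs \<and> s = k *s v"
      if "singular (fermat_form 2) s" "on_line (vector [a, b, c]) s"
      using singular_on_line_2[OF a bc that]
    proof (elim disjE conjE)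
      assume "s$1 = 0" "s$2 \<noteq> 0" "s$3 = s$2" "c = - b"
      then show ?thesis
        by (intro exI[of _ "s$2"] exI[of _ "vector [0, 1, 1]"]) (simp add: vs_def vec_eq_iff forall_3)
    next
      assume "s$2 = 0" "s$1 \<noteq> 0" "s$3 = s$1" "c = - a"
      then show ?thesis
        by (intro exI[of _ "s$1"] exI[of _ "vector [1, 0, 1]"]) (simp add: vs_def vec_eq_iff forall_3)
    next
      assume "s$3 = 0" "s$1 \<noteq> 0" "s$2 = s$1" "b = - a"
      then show ?thesis
        by (intro exI[of _ "s$1"] exI[of _ "vector [1, 1, 0]"]) (simp add: vs_def vec_eq_iff forall_3)
    qed
    show "s \<in> {s. singular (fermat_form 2) s \<and> on_line (vector [a, b, c]) s} \<longleftrightarrow> (\<exists>k v. k \<noteq> 0 \<and> v \<in> vs \<and> s = k *s v)"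
      using 1 2 by auto
  next
    fix v w :: "complex^3" and k
    assume "v \<in> vs" "w \<in> vs" and eq: "v = k *s w"
    then have "v \<in> {vector [0, 1, 1], vector [1, 0, 1], vector [1, 1, 0]}"
      "w \<in> {vector [0, 1, 1], vector [1, 0, 1], vector [1, 1, 0]}"
      by (auto simp: vs_def split: if_splits)
    with eq show "v = w"
      by (elim insertE emptyE) (simp_all add: vec_eq_iff forall_3)
  qed
  also have "card vs = 2"
    using bc aa by (elim disjE conjE) (simp_all add: vs_def vec_eq_iff forall_3 card_insert_if)
  finally show ?thesis .
qed

theorem propositionF:
  fixes d :: nat and l :: "complex^3"
  assumes "d \<ge> 3"
    and "l \<noteq> 0"
    and "\<not> invariant_line (fermat_form (d - 1)) l"
    and "flat_web d (legendre l (fermat_form (d - 1)))"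
  shows "d \<in> {3, 4} \<and>
    card (proj_point ` {s. singular (fermat_form (d - 1)) s \<and> on_line l s})
      = (if d = 3 then 2 else 3) \<and>
    (\<forall>s. singular (fermat_form (d - 1)) s \<and> on_line l s \<longrightarrow> \<not> radial (fermat_form (d - 1)) s)"
proof -
  define n where "n = d - 1"
  have n: "n \<ge> 2" "d = Suc n" using assms(1) by (auto simp: n_def)
  define a b c where "a = l$1" and "b = l$2" and "c = l$3"
  have l: "l = vector [a, b, c]"
    by (simp add: a_def b_def c_def vec_eq_iff forall_3)
  have abc: "a \<noteq> 0 \<or> b \<noteq> 0 \<or> c \<noteq> 0"
    using assms(2) by (auto simp: a_def b_def c_def vec_eq_iff forall_3)
  have inv: "\<not> invariant_line (fermat_form n) (vector [a, b, c])"
    using assms(3) unfolding l[symmetric] n_def .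
  have flat: "flat_web (Suc n) (legendre (vector [a, b, c]) (fermat_form n))"
    using assms(4) unfolding l[symmetric] n_def using assms(1) by simp
  \<comment> \<open>The line at infinity \<open>z = 0\<close> is invariant, so the given line meets
    the affine chart.\<close>
  have ab: "a \<noteq> 0 \<or> b \<noteq> 0"
  proof (rule ccontr)
    assume "\<not> ?thesis"
    then have "a = 0" "b = 0" by auto
    then show False using invariant_line_x[of b c n] inv abc n by (simp add: power_0_left)
  qed
  have "a \<noteq> 0 \<and> ((n = 2 \<and> ((b = a \<and> c = - a) \<or> (b = - a \<and> c = a) \<or> (b = - a \<and> c = - a)))
     \<or> (n = 3 \<and> b ^ 2 = a ^ 2 \<and> c ^ 2 = a ^ 2))"
    using flat_line_cases[OF n(1) flat ab inv] barycenter_condition_cases[OF n(1) _ abc inv] by blast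
  then have a: "a \<noteq> 0" and "(n = 2 \<and> ((b = a \<and> c = - a) \<or> (b = - a \<and> c = a) \<or> (b = - a \<and> c = - a)))
     \<or> (n = 3 \<and> b ^ 2 = a ^ 2 \<and> c ^ 2 = a ^ 2)" by auto
  then consider (two) "n = 2" "b = a \<and> c = - a \<or> b = - a \<and> c = a \<or> b = - a \<and> c = - a"
    | (three) "n = 3" "b ^ 2 = a ^ 2" "c ^ 2 = a ^ 2" by blast
  then show ?thesis
  proof cases
    case two
    have "\<not> radial (fermat_form 2) s" if "singular (fermat_form 2) s" "on_line l s" for s
      by (rule fermat_not_radial[OF _ that(1)])
         (use singular_on_line_2[OF a two(2) that(1)] that(2) in \<open>auto simp: l\<close>)
    then show ?thesis
      using card_singular_on_line_2[OF a two(2)] two(1) n(2) by (auto simp: l numeral_2_eq_2 numeral_3_eq_3)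
  next
    case three
    have bc: "b \<noteq> 0" "c \<noteq> 0" using a three by auto
    have "\<not> radial (fermat_form 3) s" if "singular (fermat_form 3) s" "on_line l s" for s
      by (rule fermat_not_radial[OF _ that(1)])
         (use singular_on_line_3[OF a three(2,3) that(1)] that(2) a bc in \<open>auto simp: l\<close>)
    then show ?thesis
      using card_singular_on_line_3[OF a three(2,3)] three(1) n(2) by (auto simp: l)
  qed
qed

end
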